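(* Let $M^n$ be a Riemannian manifold admitting a totally geodesic transversally orientable hyperfoliation $\mathcal F=\{\mathcal F_\alpha;\alpha\in A\}$. Let $\xi$ be a field of normals of the foliation having constant length. Then $\xi(M^n)$ is an $(n-1)$-ruled submanifold of $TM^n$ (with the Sasaki metric) with the elements $\xi(\mathcal F_\alpha)$, $\alpha\in A$.
   Context: All manifolds and vector fields are smooth; superscripts denote dimensions. $M^n$ is $\nu$-foliated if it admits a family $\mathcal F=\{\mathcal F_\alpha;\alpha\in A\}$ (a $\nu$-foliation) of connected $\nu$-dimensional submanifolds, called leaves, such that (i) $M^n=\bigcup_{\alpha}\mathcal F_\alpha$; (ii) $\mathcal F_\alpha\cap\mathcal F_\beta=\emptyset$ for $\alpha\neq\beta$; (iii) there is a covering of $M^n$ by coordinate charts in each of which the leaves are locally level submanifolds $u^{\nu+1}=c_{\nu+1},\dots,u^n=c_n$. A hyperfoliation is an $(n-1)$-foliation; it is transversally orientable if $M^n$ admits a vector field transversal to the leaves; it is totally geodesic if each leaf is totally geodesic in $M^n$. A field of normals of the foliation is a vector field on $M^n$ which is normal to each leaf along that leaf. A submanifold $F^{k+\nu}$ of a Riemannian manifold $P$ is $\nu$-ruled if it admits a $\nu$-foliation whose leaves are all totally geodesic in $P$; these leaves are called its elements (generators). Sasaki metric: with $\bar g$ the metric of $M^n$, $\pi:TM^n\to M^n$ the projection and $K:TTM^n\to TM^n$ the connection map of the Levi-Civita connection (in induced coordinates $(x^a,\xi^a)$, $K(\tilde X^a\partial_{x^a}+\tilde X^{n+a}\partial_{\xi^a})=(\tilde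 X^{n+a}+\bar\Gamma^a_{bc}\xi^b\tilde X^c)\partial_{x^a}$), $g_s(\tilde X,\tilde Y)=\bar g(\pi_*\tilde X,\pi_*\tilde Y)+\bar g(K\tilde X,K\tilde Y)$. Vector fields are regarded as maps $\xi:M^n\to TM^n$. *)

theory Defs
  imports "HOL-Analysis.Analysis"
begin

section \<open>Smooth manifolds\<close>

text \<open>Smooth means C-infinity. The definition is meant for open sets \<open>S\<close>.\<close>

fun higher_differentiable_on ::
  "'a::real_normed_vector set \<Rightarrow> ('a \<Rightarrow> 'b::real_normed_vector) \<Rightarrow> nat \<Rightarrow> bool" where
  "higher_differentiable_on S f 0 \<longleftrightarrow> continuous_on S f"
| "higher_differentiable_on S f (Suc k) \<longleftrightarrow>
     (\<forall>x\<in>S. f differentiable (at x)) \<and>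
     (\<forall>v. higher_differentiable_on S (\<lambda>x. frechet_derivative f (at x) v) k)"

definition smooth_on :: "'a::real_normed_vector set \<Rightarrow> ('a \<Rightarrow> 'b::real_normed_vector) \<Rightarrow> bool" where
  "smooth_on S f \<longleftrightarrow> (\<forall>k. higher_differentiable_on S f k)"

text \<open>A chart is a domain together with a coordinate map into a Euclidean space \<open>'e\<close>; the dimension
  of the manifold is \<open>DIM('e)\<close>, and the coordinates of a point are the inner products of its image
  with the elements of \<open>Basis\<close>. Values of the coordinate map outside the domain are irrelevant.\<close>

type_synonym ('a, 'e) chart = "'a set \<times> ('a \<Rightarrow> 'e)"

definition is_chart :: "('a, 'e::euclidean_space) chart \<Rightarrow> bool" where
  "is_chart c \<longleftrightarrow> inj_on (snd c) (fst c) \<and> open (snd c ` fst c)"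

definition chart_inv :: "('a, 'e) chart \<Rightarrow> 'e \<Rightarrow> 'a" where
  "chart_inv c = inv_into (fst c) (snd c)"

definition transition :: "('a, 'e) chart \<Rightarrow> ('a, 'e) chart \<Rightarrow> 'e \<Rightarrow> 'e" where
  "transition c d = (\<lambda>x. snd d (chart_inv c x))"

definition compatible :: "('a, 'e::euclidean_space) chart \<Rightarrow> ('a, 'e) chart \<Rightarrow> bool" where
  "compatible c d \<longleftrightarrow>
     open (snd c ` (fst c \<inter> fst d)) \<and> open (snd d ` (fst c \<inter> fst d)) \<and>
     smooth_on (snd c ` (fst c \<inter> fst d)) (transition c d) \<and>
     smooth_on (snd d ` (fst c \<inter> fst d)) (transition d c)"

definition points :: "('a, 'e) chart set \<Rightarrow> 'a set" where
  "points A = \<Union> (fst ` A)"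

definition mtop :: "('a, 'e::euclidean_space) chart set \<Rightarrow> 'a topology" where
  "mtop A = topology_generated_by {{p \<in> fst c. snd c p \<in> Q} | c Q. c \<in> A \<and> open Q}"

definition maximal_atlas :: "('a, 'e::euclidean_space) chart set \<Rightarrow> ('a, 'e) chart set" where
  "maximal_atlas A = {c. is_chart c \<and> fst c \<subseteq> points A \<and> (\<forall>d\<in>A. compatible c d)}"

text \<open>A manifold is given by its maximal atlas, which also determines its underlying set and its
  topology.\<close>

definition smooth_manifold :: "('a, 'e::euclidean_space) chart set \<Rightarrow> bool" where
  "smooth_manifold A \<longleftrightarrow>
     (\<forall>c\<in>A. is_chart c) \<and> (\<forall>c\<in>A. \<forall>d\<in>A. compatible c d) \<and> maximal_atlas A = A \<and>
     Hausdorff_space (mtop A) \<and> second_countable (mtop A)"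

definition smooth_map_on ::
  "'a set \<Rightarrow> ('a, 'e::euclidean_space) chart set \<Rightarrow> ('b, 'f::euclidean_space) chart set \<Rightarrow>
   ('a \<Rightarrow> 'b) \<Rightarrow> bool" where
  "smooth_map_on Q A B f \<longleftrightarrow>
     (\<forall>p\<in>Q. \<exists>c\<in>A. \<exists>d\<in>B. p \<in> fst c \<and> fst c \<subseteq> Q \<and> f ` fst c \<subseteq> fst d \<and>
        smooth_on (snd c ` fst c) (\<lambda>x. snd d (f (chart_inv c x))))"

section \<open>The tangent bundle\<close>

text \<open>A tangent vector at \<open>p\<close> is a pair of \<open>p\<close> and a rule assigning to every chart around \<open>p\<close> the
  vector of components in that chart, these being related by the Jacobians of the coordinate
  changes. The rule is normalised to be zero off the charts around \<open>p\<close>, so that equal tangent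
  vectors are equal as HOL values.\<close>

type_synonym ('a, 'e) tvec = "'a \<times> (('a, 'e) chart \<Rightarrow> 'e)"

definition tangent_bundle :: "('a, 'e::euclidean_space) chart set \<Rightarrow> ('a, 'e) tvec set" where
  "tangent_bundle A = {(p, w). p \<in> points A \<and>
     (\<forall>c\<in>A. \<forall>d\<in>A. p \<in> fst c \<longrightarrow> p \<in> fst d \<longrightarrow>
        w d = frechet_derivative (transition c d) (at (snd c p)) (w c)) \<and>
     (\<forall>c. \<not> (c \<in> A \<and> p \<in> fst c) \<longrightarrow> w c = 0)}"

definition tangent_space :: "('a, 'e::euclidean_space) chart set \<Rightarrow> 'a \<Rightarrow> ('a, 'e) tvec set" where
  "tangent_space A p = {X \<in> tangent_bundle A. fst X = p}"

text \<open>The tangent vector at the point with coordinates \<open>x\<close> in \<open>c\<close> whose components in \<open>c\<close> are \<open>v\<close>.\<close>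

definition coord_vec ::
  "('a, 'e::euclidean_space) chart set \<Rightarrow> ('a, 'e) chart \<Rightarrow> 'e \<Rightarrow> 'e \<Rightarrow> ('a, 'e) tvec" where
  "coord_vec A c x v = (chart_inv c x,
     \<lambda>d. if d \<in> A \<and> chart_inv c x \<in> fst d then frechet_derivative (transition c d) (at x) v else 0)"

text \<open>The induced chart on the tangent bundle, with coordinates \<open>(x, \<xi>)\<close>, and the resulting manifold
  structure, of dimension \<open>2 * DIM('e)\<close>.\<close>

definition lift_chart ::
  "('a, 'e::euclidean_space) chart set \<Rightarrow> ('a, 'e) chart \<Rightarrow> (('a, 'e) tvec, 'e \<times> 'e) chart" where
  "lift_chart A c = ({X \<in> tangent_bundle A. fst X \<in> fst c}, \<lambda>X. (snd c (fst X), snd X c))"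

definition TM ::
  "('a, 'e::euclidean_space) chart set \<Rightarrow> (('a, 'e) tvec, 'e \<times> 'e) chart set" where
  "TM A = maximal_atlas (lift_chart A ` A)"

text \<open>The differential of a map. For smooth maps it does not depend on the chart \<open>c\<close> chosen.\<close>

definition differential ::
  "('a, 'e::euclidean_space) chart set \<Rightarrow> ('b, 'f::euclidean_space) chart set \<Rightarrow> ('a \<Rightarrow> 'b) \<Rightarrow>
   ('a, 'e) tvec \<Rightarrow> ('b, 'f) tvec" where
  "differential A B f X =
     (let p = fst X; c = (SOME c. c \<in> A \<and> p \<in> fst c)
      in (f p, \<lambda>d. if d \<in> B \<and> f p \<in> fst d
                   then frechet_derivative (\<lambda>x. snd d (f (chart_inv c x))) (at (snd c p)) (snd X c)
                   else 0))"

text \<open>Smooth vector fields on an open set \<open>Q\<close>, as maps into the tangent bundle.\<close>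

definition vector_field_on ::
  "('a, 'e::euclidean_space) chart set \<Rightarrow> 'a set \<Rightarrow> ('a \<Rightarrow> ('a, 'e) tvec) \<Rightarrow> bool" where
  "vector_field_on A Q X \<longleftrightarrow>
     openin (mtop A) Q \<and> (\<forall>p\<in>Q. X p \<in> tangent_space A p) \<and> smooth_map_on Q A (TM A) X"

abbreviation vector_field ::
  "('a, 'e::euclidean_space) chart set \<Rightarrow> ('a \<Rightarrow> ('a, 'e) tvec) \<Rightarrow> bool" where
  "vector_field A X \<equiv> vector_field_on A (points A) X"

section \<open>Riemannian metrics and the Levi-Civita connection\<close>

type_synonym ('a, 'e) metric = "('a, 'e) tvec \<Rightarrow> ('a, 'e) tvec \<Rightarrow> real"

definition metric_comp ::
  "('a, 'e::euclidean_space) chart set \<Rightarrow> ('a, 'e) metric \<Rightarrow> ('a, 'e) chart \<Rightarrow>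
   'e \<Rightarrow> 'e \<Rightarrow> 'e \<Rightarrow> real" where
  "metric_comp A g c x v w = g (coord_vec A c x v) (coord_vec A c x w)"

definition riemannian_manifold ::
  "('a, 'e::euclidean_space) chart set \<Rightarrow> ('a, 'e) metric \<Rightarrow> bool" where
  "riemannian_manifold A g \<longleftrightarrow> smooth_manifold A \<and>
     (\<forall>c\<in>A.
        (\<forall>x \<in> snd c ` fst c. bilinear (metric_comp A g c x) \<and>
           (\<forall>v w. metric_comp A g c x v w = metric_comp A g c x w v) \<and>
           (\<forall>v. v \<noteq> 0 \<longrightarrow> metric_comp A g c x v v > 0)) \<and>
        (\<forall>v w. smooth_on (snd c ` fst c) (\<lambda>x. metric_comp A g c x v w)))"

definition tvec_length :: "('a, 'e) metric \<Rightarrow> ('a, 'e) tvec \<Rightarrow> real" where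
  "tvec_length g X = sqrt (g X X)"

text \<open>\<open>christoffel A g c x v w\<close> is the vector with components
  \<open>\<Gamma>\<^sup>a\<^sub>b\<^sub>c v\<^sup>b w\<^sup>c\<close>, where
  \<open>g\<^sub>d\<^sub>a \<Gamma>\<^sup>a\<^sub>b\<^sub>c = (\<partial>\<^sub>b g\<^sub>c\<^sub>d + \<partial>\<^sub>c g\<^sub>b\<^sub>d - \<partial>\<^sub>d g\<^sub>b\<^sub>c) / 2\<close>
  at the point with coordinates \<open>x\<close>; the vector \<open>z\<close> below carries the index \<open>d\<close>.\<close>

definition christoffel ::
  "('a, 'e::euclidean_space) chart set \<Rightarrow> ('a, 'e) metric \<Rightarrow> ('a, 'e) chart \<Rightarrow>
   'e \<Rightarrow> 'e \<Rightarrow> 'e \<Rightarrow> 'e" where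
  "christoffel A g c x v w = (THE u. \<forall>z. metric_comp A g c x u z =
     (frechet_derivative (\<lambda>y. metric_comp A g c y w z) (at x) v
      + frechet_derivative (\<lambda>y. metric_comp A g c y v z) (at x) w
      - frechet_derivative (\<lambda>y. metric_comp A g c y v w) (at x) z) / 2)"

text \<open>The Levi-Civita covariant derivative of \<open>Y\<close> in direction \<open>X\<close> at \<open>p\<close>.\<close>

definition cov_deriv ::
  "('a, 'e::euclidean_space) chart set \<Rightarrow> ('a, 'e) metric \<Rightarrow> ('a \<Rightarrow> ('a, 'e) tvec) \<Rightarrow>
   ('a \<Rightarrow> ('a, 'e) tvec) \<Rightarrow> 'a \<Rightarrow> ('a, 'e) tvec" where
  "cov_deriv A g X Y p = (p, \<lambda>c. if c \<in> A \<and> p \<in> fst c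
     then frechet_derivative (\<lambda>x. snd (Y (chart_inv c x)) c) (at (snd c p)) (snd (X p) c)
          + christoffel A g c (snd c p) (snd (X p) c) (snd (Y p) c)
     else 0)"

section \<open>The Sasaki metric\<close>

text \<open>The components of a tangent vector \<open>V\<close> of the tangent bundle in an induced chart form a pair
  (components along \<open>x\<close>, components along \<open>\<xi>\<close>).\<close>

definition connection_map ::
  "('a, 'e::euclidean_space) chart set \<Rightarrow> ('a, 'e) metric \<Rightarrow>
   (('a, 'e) tvec, 'e \<times> 'e) tvec \<Rightarrow> ('a, 'e) tvec" where
  "connection_map A g V =
     (let \<xi> = fst V; p = fst \<xi>
      in (p, \<lambda>c. if c \<in> A \<and> p \<in> fst c
                 then snd (snd V (lift_chart A c))
                      + christoffel A g c (snd c p) (snd \<xi> c) (fst (snd V (lift_chart A c)))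
                 else 0))"

definition sasaki ::
  "('a, 'e::euclidean_space) chart set \<Rightarrow> ('a, 'e) metric \<Rightarrow> (('a, 'e) tvec, 'e \<times> 'e) metric" where
  "sasaki A g V W =
     g (differential (TM A) A fst V) (differential (TM A) A fst W)
     + g (connection_map A g V) (connection_map A g W)"

section \<open>Submanifolds\<close>

text \<open>A submanifold (possibly only immersed, as leaves of foliations are) is a subset with a topology
  of its own, so it is represented by a topology \<open>N\<close> with underlying set \<open>topspace N\<close>. Near each
  point, in the topology of \<open>N\<close>, it is a level submanifold of a chart of the ambient manifold,
  carrying there the topology induced from the ambient manifold. It is embedded iff \<open>N\<close> is a
  subspace topology of the ambient topology. \<open>B\<close> is the set of those basis vectors whose
  coordinates vary on the level submanifold, so that the coordinates outside \<open>B\<close> play the part of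
  \<open>u\<^sup>m\<^sup>+\<^sup>1, \<dots>, u\<^sup>n\<close>.\<close>

definition level_set :: "('a, 'e::euclidean_space) chart \<Rightarrow> 'e set \<Rightarrow> 'a \<Rightarrow> 'a set" where
  "level_set c B p = {q \<in> fst c. \<forall>b \<in> Basis - B. snd c q \<bullet> b = snd c p \<bullet> b}"

definition adapted_chart ::
  "('a, 'e::euclidean_space) chart set \<Rightarrow> nat \<Rightarrow> 'a topology \<Rightarrow> 'a \<Rightarrow> ('a, 'e) chart \<Rightarrow> 'e set \<Rightarrow> bool"
  where
  "adapted_chart A m N p c B \<longleftrightarrow> c \<in> A \<and> p \<in> fst c \<and> B \<subseteq> Basis \<and> card B = m \<and>
     openin N (level_set c B p) \<and>
     subtopology N (level_set c B p) = subtopology (mtop A) (level_set c B p)"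

definition submanifold ::
  "('a, 'e::euclidean_space) chart set \<Rightarrow> nat \<Rightarrow> 'a topology \<Rightarrow> bool" where
  "submanifold A m N \<longleftrightarrow> topspace N \<subseteq> points A \<and> second_countable N \<and>
     (\<forall>p \<in> topspace N. \<exists>c B. adapted_chart A m N p c B)"

definition tangent_to ::
  "('a, 'e::euclidean_space) chart set \<Rightarrow> nat \<Rightarrow> 'a topology \<Rightarrow> 'a \<Rightarrow> ('a, 'e) tvec set" where
  "tangent_to A m N p = {X \<in> tangent_space A p.
     \<exists>c B. adapted_chart A m N p c B \<and> (\<forall>b \<in> Basis - B. snd X c \<bullet> b = 0)}"

text \<open>Vanishing of the second fundamental form: covariant derivatives of local fields tangent to \<open>N\<close>
  are tangent to \<open>N\<close>. The fields live on an ambient open set but only need to be tangent along a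
  piece \<open>W\<close> of \<open>N\<close>, because a non-embedded \<open>N\<close> may return to the ambient open set.\<close>

definition totally_geodesic ::
  "('a, 'e::euclidean_space) chart set \<Rightarrow> ('a, 'e) metric \<Rightarrow> nat \<Rightarrow> 'a topology \<Rightarrow> bool" where
  "totally_geodesic A g m N \<longleftrightarrow>
     (\<forall>Q W X Y. vector_field_on A Q X \<and> vector_field_on A Q Y \<and> openin N W \<and> W \<subseteq> Q \<and>
        (\<forall>p\<in>W. X p \<in> tangent_to A m N p \<and> Y p \<in> tangent_to A m N p) \<longrightarrow>
        (\<forall>p\<in>W. cov_deriv A g X Y p \<in> tangent_to A m N p))"

text \<open>The image of a submanifold under an injective map, with the transported topology.\<close>

definition image_submanifold :: "('a \<Rightarrow> 'b) \<Rightarrow> 'a topology \<Rightarrow> 'b topology" where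
  "image_submanifold f N = topology_generated_by {f ` U | U. openin N U}"

section \<open>Foliations and ruled submanifolds\<close>

text \<open>A \<open>\<nu>\<close>-foliation of an \<open>m\<close>-dimensional submanifold \<open>N\<close>; the index set is \<open>I\<close> and the leaves are
  \<open>F \<alpha>\<close>. Coordinates on \<open>N\<close> are the coordinates \<open>B\<close> of a chart \<open>c\<close> adapted to \<open>N\<close>, on the chart
  neighbourhood \<open>level_set c B p\<close> in \<open>N\<close>; fixing further coordinates, namely those in \<open>B - B'\<close>, must
  give open pieces of leaves. For \<open>N\<close> the whole manifold, \<open>B = Basis\<close>, the chart neighbourhood is
  all of \<open>fst c\<close>, and this is the usual definition of a foliation of a manifold.\<close>

definition foliation_of ::
  "('a, 'e::euclidean_space) chart set \<Rightarrow> nat \<Rightarrow> 'a topology \<Rightarrow> nat \<Rightarrow> 'i set \<Rightarrow> ('i \<Rightarrow> 'a topology) \<Rightarrow>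
   bool" where
  "foliation_of A m N \<nu> I F \<longleftrightarrow>
     submanifold A m N \<and>
     (\<forall>\<alpha>\<in>I. submanifold A \<nu> (F \<alpha>) \<and> connected_space (F \<alpha>) \<and> topspace (F \<alpha>) \<noteq> {}) \<and>
     topspace N = (\<Union>\<alpha>\<in>I. topspace (F \<alpha>)) \<and>
     (\<forall>\<alpha>\<in>I. \<forall>\<beta>\<in>I. \<alpha> \<noteq> \<beta> \<longrightarrow> topspace (F \<alpha>) \<inter> topspace (F \<beta>) = {}) \<and>
     (\<forall>p \<in> topspace N. \<exists>c B B'. adapted_chart A m N p c B \<and> B' \<subseteq> B \<and>
        (\<forall>\<alpha>\<in>I. \<forall>q \<in> topspace (F \<alpha>) \<inter> level_set c B p. adapted_chart A \<nu> (F \<alpha>) q c B'))"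

abbreviation foliation ::
  "('a, 'e::euclidean_space) chart set \<Rightarrow> nat \<Rightarrow> 'i set \<Rightarrow> ('i \<Rightarrow> 'a topology) \<Rightarrow> bool" where
  "foliation A \<nu> I F \<equiv> foliation_of A DIM('e) (mtop A) \<nu> I F"

abbreviation hyperfoliation ::
  "('a, 'e::euclidean_space) chart set \<Rightarrow> 'i set \<Rightarrow> ('i \<Rightarrow> 'a topology) \<Rightarrow> bool" where
  "hyperfoliation A I F \<equiv> foliation A (DIM('e) - 1) I F"

definition transversally_orientable ::
  "('a, 'e::euclidean_space) chart set \<Rightarrow> 'i set \<Rightarrow> ('i \<Rightarrow> 'a topology) \<Rightarrow> bool" where
  "transversally_orientable A I F \<longleftrightarrow>
     (\<exists>\<eta>. vector_field A \<eta> \<and>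
        (\<forall>\<alpha>\<in>I. \<forall>p \<in> topspace (F \<alpha>). \<eta> p \<notin> tangent_to A (DIM('e) - 1) (F \<alpha>) p))"

definition totally_geodesic_foliation ::
  "('a, 'e::euclidean_space) chart set \<Rightarrow> ('a, 'e) metric \<Rightarrow> nat \<Rightarrow> 'i set \<Rightarrow> ('i \<Rightarrow> 'a topology) \<Rightarrow>
   bool" where
  "totally_geodesic_foliation A g \<nu> I F \<longleftrightarrow> (\<forall>\<alpha>\<in>I. totally_geodesic A g \<nu> (F \<alpha>))"

definition field_of_normals ::
  "('a, 'e::euclidean_space) chart set \<Rightarrow> ('a, 'e) metric \<Rightarrow> nat \<Rightarrow> 'i set \<Rightarrow> ('i \<Rightarrow> 'a topology) \<Rightarrow>
   ('a \<Rightarrow> ('a, 'e) tvec) \<Rightarrow> bool" where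
  "field_of_normals A g \<nu> I F \<xi> \<longleftrightarrow> vector_field A \<xi> \<and>
     (\<forall>\<alpha>\<in>I. \<forall>p \<in> topspace (F \<alpha>). \<forall>X \<in> tangent_to A \<nu> (F \<alpha>) p. g (\<xi> p) X = 0)"

text \<open>\<open>N\<close> is a \<open>\<nu>\<close>-ruled \<open>m\<close>-dimensional submanifold with the elements \<open>F \<alpha>\<close>, \<open>\<alpha> \<in> I\<close>.\<close>

definition ruled_submanifold ::
  "('a, 'e::euclidean_space) chart set \<Rightarrow> ('a, 'e) metric \<Rightarrow> nat \<Rightarrow> nat \<Rightarrow> 'a topology \<Rightarrow>
   'i set \<Rightarrow> ('i \<Rightarrow> 'a topology) \<Rightarrow> bool" where
  "ruled_submanifold P g m \<nu> N I F \<longleftrightarrow>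
     submanifold P m N \<and> foliation_of P m N \<nu> I F \<and> totally_geodesic_foliation P g \<nu> I F"

end

theory Submission
  imports Defs
begin

text \<open>A normal field \<open>\<xi>\<close> of constant length is parallel along the leaves: for \<open>X\<close> tangent to a leaf,
  \<open>\<nabla>\<^sub>X \<xi>\<close> is orthogonal to \<open>\<xi>\<close> because \<open>g \<xi> \<xi>\<close> is constant, and orthogonal to the leaf because
  \<open>g (\<nabla>\<^sub>X \<xi>) Y = - g \<xi> (\<nabla>\<^sub>X Y) = 0\<close> for \<open>Y\<close> tangent to the leaf, which is totally geodesic.

  Take induced coordinates \<open>(x, v)\<close> of the tangent bundle over a foliated chart and replace \<open>v\<close> by
  \<open>w = v - \<xi> x\<close>. Then \<open>w = 0\<close> is the image of \<open>\<xi>\<close>, and fixing in addition the transversal coordinate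
  of \<open>x\<close> gives the images of the leaves, so these form a foliation. In these coordinates the Sasaki
  product of \<open>(a, 0)\<close>, with \<open>a\<close> tangent to the leaves, and any \<open>(z, \<zeta>)\<close> is
  \<open>g a z + g (\<Gamma> w a) (\<zeta> + \<dots>)\<close>, since \<open>\<xi>\<close> is parallel. The second summand vanishes at \<open>w = 0\<close>, together
  with its derivative along the leaves, and to second order if \<open>z\<close> is tangent to the leaves and \<open>\<zeta> = 0\<close>.
  Hence the Christoffel symbols of the Sasaki metric at \<open>w = 0\<close> are \<open>\<Gamma> (a, 0) (b, 0) = (\<Gamma> a b, 0)\<close>
  for \<open>a\<close>, \<open>b\<close> tangent to the leaves, and the images of the leaves are totally geodesic. No curvature
  has to be computed.\<close>

section \<open>Calculus of smooth maps\<close>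

text \<open>Total geodesy is defined through arbitrary local fields, so nothing can be computed
  until it is turned into a condition on Christoffel symbols in a single adapted chart: they must
  map pairs of vectors tangent to the level submanifold to such vectors. Both directions are proved,
  one to exploit the leaves of \<open>F\<close>, the other to conclude on the tangent bundle. This
  requires tangency and the covariant derivative to be independent of the chart, hence the
  transformation law of the Christoffel symbols, hence symmetric second derivatives. The Sasaki
  metric itself contains Christoffel symbols of \<open>g\<close>. Its own Christoffel symbols need
  only one derivative of it, so metrics in coordinates are assumed differentiable once, and the
  Christoffel symbols of \<open>g\<close> are shown to be differentiable by the inverse function
  theorem. Parallelism is needed on a whole chart and not along one leaf only: the Koszul formula
  differentiates across the leaves.\<close>

abbreviation FD :: "('a::real_normed_vector \<Rightarrow> 'b::real_normed_vector) \<Rightarrow> 'a \<Rightarrow> 'a \<Rightarrow> 'b" where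
  "FD f x \<equiv> frechet_derivative f (at x)"

abbreviation FD2 :: "('a::real_normed_vector \<Rightarrow> 'b::real_normed_vector) \<Rightarrow> 'a \<Rightarrow> 'a \<Rightarrow> 'a \<Rightarrow> 'b" where
  "FD2 f x v w \<equiv> FD (\<lambda>y. FD f y w) x v"

lemma FD_eqI: "(f has_derivative f') (at x) \<Longrightarrow> FD f x = f'"
  using frechet_derivative_at by blast

lemma has_derivative_FD: "f differentiable at x \<Longrightarrow> (f has_derivative FD f x) (at x)"
  using frechet_derivative_works by blast

lemma linear_FD: "f differentiable at x \<Longrightarrow> linear (FD f x)"
  using has_derivative_FD has_derivative_linear by blast

section \<open>Calculus rules for finitely often differentiable maps on open sets\<close>

lemma higher_differentiable_on_cong:
  assumes "open S" "\<And>x. x \<in> S \<Longrightarrow> f x = g x" "higher_differentiable_on S f k"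
  shows "higher_differentiable_on S g k"
  using assms(2,3)
proof (induction k arbitrary: f g)
  case 0
  then show ?case using continuous_on_cong[of S S f g] by simp
next
  case (Suc k)
  have d: "(g has_derivative FD f x) (at x)" if "x \<in> S" for x
  proof (rule has_derivative_transform_within_open[OF _ assms(1) that])
    show "(f has_derivative FD f x) (at x)"
      using Suc.prems(2) that by (auto intro: has_derivative_FD)
  qed (use Suc.prems in auto)
  then have "FD f x = FD g x" if "x \<in> S" for x
    using FD_eqI that by metis
  moreover have "\<forall>x\<in>S. g differentiable (at x)"
    using d differentiable_def by blast
  ultimately show ?case
    using Suc.IH[of "\<lambda>x. FD f x v" "\<lambda>x. FD g x v" for v] Suc.prems by simp
qed

lemma higher_differentiable_on_subset:
  "higher_differentiable_on S f k \<Longrightarrow> T \<subseteq> S \<Longrightarrow> higher_differentiable_on T f k"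
  by (induction k arbitrary: f) (auto intro: continuous_on_subset)

lemma higher_differentiable_on_Suc_imp:
  "higher_differentiable_on S f (Suc k) \<Longrightarrow> higher_differentiable_on S f k"
proof (induction k arbitrary: f)
  case 0
  then show ?case
    by (auto intro!: continuous_at_imp_continuous_on dest: differentiable_imp_continuous_within)
qed auto

text \<open>Lets every closure rule below work with an explicit formula for the derivative: the
  induction on \<open>k\<close> is applied to \<open>f'\<close>, and \<open>FD f\<close> agrees with
  it on the open set \<open>S\<close>.\<close>

lemma higher_differentiable_on_SucI:
  assumes "open S" "\<And>x. x \<in> S \<Longrightarrow> (f has_derivative f' x) (at x)"
    and "\<And>v. higher_differentiable_on S (\<lambda>x. f' x v) k"
  shows "higher_differentiable_on S f (Suc k)"
proof -
  have "FD f x = f' x" if "x \<in> S" for x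
    using assms(2) that FD_eqI by blast
  then have "higher_differentiable_on S (\<lambda>x. FD f x v) k" for v
    using higher_differentiable_on_cong[OF assms(1) _ assms(3)[of v]] by simp
  then show ?thesis
    using assms(2) by (auto simp: differentiable_def)
qed

lemma higher_differentiable_on_SucD:
  assumes "higher_differentiable_on S f (Suc k)"
  shows "x \<in> S \<Longrightarrow> (f has_derivative FD f x) (at x)"
    and "higher_differentiable_on S (\<lambda>x. FD f x v) k"
  using assms by (auto intro: has_derivative_FD)

lemma higher_differentiable_on_local:
  assumes "\<And>x. x \<in> S \<Longrightarrow> \<exists>U. open U \<and> x \<in> U \<and> higher_differentiable_on U f k"
  shows "higher_differentiable_on S f k"
  using assms
proof (induction k arbitrary: f)
  case 0
  show ?case
    unfolding higher_differentiable_on.simps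
    using 0 unfolding higher_differentiable_on.simps
    by (intro continuous_at_imp_continuous_on ballI) (meson continuous_on_eq_continuous_at)
next
  case (Suc k)
  have "f differentiable at x" if "x \<in> S" for x
    using Suc.prems[OF that] by auto
  moreover have "higher_differentiable_on S (\<lambda>x. FD f x v) k" for v
    by (rule Suc.IH) (use Suc.prems in fastforce)
  ultimately show ?case by simp
qed

lemma higher_differentiable_on_const: "higher_differentiable_on S (\<lambda>x. c) k"
  by (induction k arbitrary: c) auto

lemma higher_differentiable_on_bounded_linear:
  assumes "bounded_linear L" "open S" "higher_differentiable_on S f k"
  shows "higher_differentiable_on S (\<lambda>x. L (f x)) k"
  using assms(3)
proof (induction k arbitrary: f)
  case 0
  then show ?case by (simp add: assms(1) bounded_linear.continuous_on)
next
  case (Suc k)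
  show ?case
  proof (rule higher_differentiable_on_SucI[OF assms(2)])
    show "((\<lambda>x. L (f x)) has_derivative (\<lambda>v. L (FD f x v))) (at x)" if "x \<in> S" for x
      using bounded_linear.has_derivative[OF assms(1) higher_differentiable_on_SucD(1)[OF Suc.prems that]] .
    show "higher_differentiable_on S (\<lambda>x. L (FD f x v)) k" for v
      using Suc.IH higher_differentiable_on_SucD(2)[OF Suc.prems] .
  qed
qed

lemma higher_differentiable_on_ident: "open S \<Longrightarrow> higher_differentiable_on S (\<lambda>x. x) k"
  by (cases k) (auto simp: higher_differentiable_on_const)

lemma higher_differentiable_on_add:
  assumes "open S" "higher_differentiable_on S f k" "higher_differentiable_on S g k"
  shows "higher_differentiable_on S (\<lambda>x. f x + g x) k"
  using assms(2,3)
proof (induction k arbitrary: f g)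
  case 0
  then show ?case by (simp add: continuous_on_add)
next
  case (Suc k)
  show ?case
  proof (rule higher_differentiable_on_SucI[OF assms(1)])
    show "((\<lambda>x. f x + g x) has_derivative (\<lambda>v. FD f x v + FD g x v)) (at x)" if "x \<in> S" for x
      using Suc.prems that by (intro has_derivative_add higher_differentiable_on_SucD)
    show "higher_differentiable_on S (\<lambda>x. FD f x v + FD g x v) k" for v
      using Suc.IH higher_differentiable_on_SucD(2) Suc.prems by blast
  qed
qed

lemma higher_differentiable_on_sum:
  assumes "open S" "\<And>i. i \<in> J \<Longrightarrow> higher_differentiable_on S (f i) k"
  shows "higher_differentiable_on S (\<lambda>x. \<Sum>i\<in>J. f i x) k"
  using assms(2)
  by (induction J rule: infinite_finite_induct)
    (auto simp: higher_differentiable_on_const intro!: higher_differentiable_on_add assms(1))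

lemma higher_differentiable_on_scaleR:
  assumes "open S" "higher_differentiable_on S f k" "higher_differentiable_on S g k"
  shows "higher_differentiable_on S (\<lambda>x. f x *\<^sub>R g x) k"
  using assms(2,3)
proof (induction k arbitrary: f g)
  case 0
  then show ?case by (simp add: continuous_on_scaleR)
next
  case (Suc k)
  show ?case
  proof (rule higher_differentiable_on_SucI[OF assms(1)])
    show "((\<lambda>x. f x *\<^sub>R g x) has_derivative (\<lambda>v. f x *\<^sub>R FD g x v + FD f x v *\<^sub>R g x)) (at x)"
      if "x \<in> S" for x
      using Suc.prems that by (intro has_derivative_scaleR higher_differentiable_on_SucD)
    show "higher_differentiable_on S (\<lambda>x. f x *\<^sub>R FD g x v + FD f x v *\<^sub>R g x) k" for v
      by (rule higher_differentiable_on_add[OF assms(1)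
            Suc.IH[OF higher_differentiable_on_Suc_imp[OF Suc.prems(1)] higher_differentiable_on_SucD(2)[OF Suc.prems(2)]]
            Suc.IH[OF higher_differentiable_on_SucD(2)[OF Suc.prems(1)] higher_differentiable_on_Suc_imp[OF Suc.prems(2)]]])
  qed
qed

lemma linear_euclidean_expand:
  fixes L :: "'a::euclidean_space \<Rightarrow> 'b::real_vector"
  assumes "linear L"
  shows "L v = (\<Sum>b\<in>Basis. (v \<bullet> b) *\<^sub>R L b)"
proof -
  have "L v = L (\<Sum>b\<in>Basis. (v \<bullet> b) *\<^sub>R b)"
    by (simp add: euclidean_representation)
  also have "\<dots> = (\<Sum>b\<in>Basis. (v \<bullet> b) *\<^sub>R L b)"
    by (simp add: linear_sum[OF assms] linear_cmul[OF assms])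
  finally show ?thesis .
qed

text \<open>By the chain rule the direction \<open>FD g x v\<close> of \<open>FD f\<close> moves
  with \<open>x\<close>, while the induction hypothesis speaks of fixed directions. Expanding the
  direction in a basis leaves sums of products of maps to which the hypothesis applies.\<close>

lemma higher_differentiable_on_compose:
  fixes f :: "'b::euclidean_space \<Rightarrow> 'c::real_normed_vector"
  assumes "open S" "open T" "g ` S \<subseteq> T"
    and "higher_differentiable_on T f k" "higher_differentiable_on S g k"
  shows "higher_differentiable_on S (\<lambda>x. f (g x)) k"
  using assms(4,5)
proof (induction k arbitrary: f)
  case 0
  then show ?case
    using continuous_on_compose2[of T f S g] assms(3) by auto
next
  case (Suc k)
  have fT: "(f has_derivative FD f (g x)) (at (g x))" if "x \<in> S" for x
    using Suc.prems assms(3) that by (intro higher_differentiable_on_SucD) auto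
  show ?case
  proof (rule higher_differentiable_on_SucI[OF assms(1)])
    show "((\<lambda>x. f (g x)) has_derivative
            (\<lambda>v. \<Sum>b\<in>Basis. (FD g x v \<bullet> b) *\<^sub>R FD f (g x) b)) (at x)" if "x \<in> S" for x
    proof -
      have "((\<lambda>x. f (g x)) has_derivative (\<lambda>v. FD f (g x) (FD g x v))) (at x)"
        using has_derivative_compose[OF higher_differentiable_on_SucD(1)[OF Suc.prems(2) that] fT[OF that]] .
      moreover have "FD f (g x) (FD g x v) = (\<Sum>b\<in>Basis. (FD g x v \<bullet> b) *\<^sub>R FD f (g x) b)" for v
        by (rule linear_euclidean_expand) (metis fT has_derivative_linear that)
      ultimately show ?thesis by simp
    qed
    show "higher_differentiable_on S (\<lambda>x. \<Sum>b\<in>Basis. (FD g x v \<bullet> b) *\<^sub>R FD f (g x) b) k" for v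
    proof (intro higher_differentiable_on_sum higher_differentiable_on_scaleR assms(1))
      fix b :: 'b
      show "higher_differentiable_on S (\<lambda>x. FD g x v \<bullet> b) k"
        using higher_differentiable_on_bounded_linear[OF bounded_linear_inner_left assms(1)]
          higher_differentiable_on_SucD(2)[OF Suc.prems(2)] by blast
      show "higher_differentiable_on S (\<lambda>x. FD f (g x) b) k"
        using Suc.IH[OF higher_differentiable_on_SucD(2)[OF Suc.prems(1)]]
          higher_differentiable_on_Suc_imp[OF Suc.prems(2)] .
    qed
  qed
qed

lemma higher_differentiable_on_Pair:
  fixes f :: "'a::real_normed_vector \<Rightarrow> 'b::real_normed_vector"
    and g :: "'a \<Rightarrow> 'c::real_normed_vector"
  assumes "open S" "higher_differentiable_on S f k" "higher_differentiable_on S g k"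
  shows "higher_differentiable_on S (\<lambda>x. (f x, g x)) k"
proof -
  have "bounded_linear (\<lambda>z::'b. (z, 0::'c))" "bounded_linear (\<lambda>z::'c. (0::'b, z))"
    by (rule bounded_linear_Pair[OF bounded_linear_ident bounded_linear_zero],
        rule bounded_linear_Pair[OF bounded_linear_zero bounded_linear_ident])
  note l = this[THEN higher_differentiable_on_bounded_linear, OF assms(1)]
  have "higher_differentiable_on S (\<lambda>x. (f x, 0) + (0, g x)) k"
    by (rule higher_differentiable_on_add[OF assms(1) l(1)[OF assms(2)] l(2)[OF assms(3)]])
  then show ?thesis by simp
qed

section \<open>The same rules for C-infinity maps\<close>

lemma smooth_on_cong:
  "open S \<Longrightarrow> (\<And>x. x \<in> S \<Longrightarrow> f x = g x) \<Longrightarrow> smooth_on S f \<Longrightarrow> smooth_on S g"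
  unfolding smooth_on_def by (blast intro: higher_differentiable_on_cong)

lemma smooth_on_subset: "smooth_on S f \<Longrightarrow> T \<subseteq> S \<Longrightarrow> smooth_on T f"
  unfolding smooth_on_def by (blast intro: higher_differentiable_on_subset)

lemma smooth_on_local:
  "(\<And>x. x \<in> S \<Longrightarrow> \<exists>U. open U \<and> x \<in> U \<and> smooth_on U f) \<Longrightarrow> smooth_on S f"
  unfolding smooth_on_def by (intro allI higher_differentiable_on_local) blast

lemma smooth_on_const: "smooth_on S (\<lambda>x. c)"
  by (simp add: smooth_on_def higher_differentiable_on_const)

lemma smooth_on_ident: "open S \<Longrightarrow> smooth_on S (\<lambda>x. x)"
  by (simp add: smooth_on_def higher_differentiable_on_ident)

lemma smooth_on_bounded_linear:
  "bounded_linear L \<Longrightarrow> open S \<Longrightarrow> smooth_on S f \<Longrightarrow> smooth_on S (\<lambda>x. L (f x))"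
  by (simp add: smooth_on_def higher_differentiable_on_bounded_linear)

lemma smooth_on_add:
  "open S \<Longrightarrow> smooth_on S f \<Longrightarrow> smooth_on S g \<Longrightarrow> smooth_on S (\<lambda>x. f x + g x)"
  by (simp add: smooth_on_def higher_differentiable_on_add)

lemma smooth_on_sum:
  "open S \<Longrightarrow> (\<And>i. i \<in> J \<Longrightarrow> smooth_on S (f i)) \<Longrightarrow> smooth_on S (\<lambda>x. \<Sum>i\<in>J. f i x)"
  by (simp add: smooth_on_def higher_differentiable_on_sum)

lemma smooth_on_scaleR:
  "open S \<Longrightarrow> smooth_on S f \<Longrightarrow> smooth_on S g \<Longrightarrow> smooth_on S (\<lambda>x. f x *\<^sub>R g x)"
  by (simp add: smooth_on_def higher_differentiable_on_scaleR)

lemma smooth_on_Pair: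
  "open S \<Longrightarrow> smooth_on S f \<Longrightarrow> smooth_on S g \<Longrightarrow> smooth_on S (\<lambda>x. (f x, g x))"
  by (simp add: smooth_on_def higher_differentiable_on_Pair)

lemma smooth_on_fst: "open S \<Longrightarrow> smooth_on S f \<Longrightarrow> smooth_on S (\<lambda>x. fst (f x))"
  by (rule smooth_on_bounded_linear[OF bounded_linear_fst])

lemma smooth_on_snd: "open S \<Longrightarrow> smooth_on S f \<Longrightarrow> smooth_on S (\<lambda>x. snd (f x))"
  by (rule smooth_on_bounded_linear[OF bounded_linear_snd])

lemma smooth_on_compose:
  fixes f :: "'b::euclidean_space \<Rightarrow> 'c::real_normed_vector"
  shows "open S \<Longrightarrow> open T \<Longrightarrow> g ` S \<subseteq> T \<Longrightarrow> smooth_on T f \<Longrightarrow> smooth_on S g \<Longrightarrow>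
    smooth_on S (\<lambda>x. f (g x))"
  unfolding smooth_on_def by (blast intro: higher_differentiable_on_compose)

lemma smooth_on_imp_differentiable: "smooth_on S f \<Longrightarrow> x \<in> S \<Longrightarrow> f differentiable at x"
  unfolding smooth_on_def by (drule spec[of _ "Suc 0"]) simp

lemma smooth_on_FD: "smooth_on S f \<Longrightarrow> smooth_on S (\<lambda>x. FD f x v)"
  unfolding smooth_on_def
proof
  fix k assume "\<forall>k. higher_differentiable_on S f k"
  then have "higher_differentiable_on S f (Suc k)" ..
  then show "higher_differentiable_on S (\<lambda>x. FD f x v) k"
    by simp
qed

lemma smooth_on_imp_continuous_on: "smooth_on S f \<Longrightarrow> continuous_on S f"
  unfolding smooth_on_def by (drule spec[of _ 0]) simp

text \<open>The direction is a variable here, as in the fibre component of a transition between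
  induced charts; linearity in it reduces the claim to the directions in
  \<open>Basis\<close>.\<close>

lemma smooth_on_FD_joint:
  fixes f :: "'a::euclidean_space \<Rightarrow> 'b::real_normed_vector"
  assumes "open S" "smooth_on S f"
  shows "smooth_on (S \<times> UNIV) (\<lambda>p. FD f (fst p) (snd p))"
proof -
  have o: "open (S \<times> (UNIV::'a set))"
    using assms(1) by (simp add: open_Times)
  have "smooth_on (S \<times> (UNIV::'a set)) (\<lambda>p. FD f (fst p) b)" for b
    using smooth_on_compose[OF o assms(1) _ smooth_on_FD[OF assms(2)] smooth_on_fst[OF o smooth_on_ident[OF o]], of b]
    by auto
  then have 1: "smooth_on (S \<times> (UNIV::'a set)) (\<lambda>p. \<Sum>b\<in>Basis. (snd p \<bullet> b) *\<^sub>R FD f (fst p) b)"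
    by (intro smooth_on_sum smooth_on_scaleR o smooth_on_ident smooth_on_snd
        smooth_on_bounded_linear[OF bounded_linear_inner_left])
  have "(\<Sum>b\<in>Basis. (snd p \<bullet> b) *\<^sub>R FD f (fst p) b) = FD f (fst p) (snd p)"
       if "p \<in> S \<times> (UNIV::'a set)" for p
    using that assms by (intro linear_euclidean_expand[symmetric] linear_FD smooth_on_imp_differentiable) auto
  from smooth_on_cong[OF o this 1] show ?thesis .
qed

text \<open>The second difference of \<open>f\<close> over a small parallelogram with sides
  \<open>t *\<^sub>R v\<close> and \<open>t *\<^sub>R w\<close> is symmetric in the sides, and it
  equals \<open>t * t\<close> times either mixed derivative at some intermediate point. Continuity
  of the mixed derivatives gives equality at \<open>x\<close>.\<close>

lemma real_second_derivative_symmetric: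
  fixes f :: "'a::euclidean_space \<Rightarrow> real"
  assumes "open S" "smooth_on S f" "x \<in> S"
  shows "FD2 f x v w = FD2 f x w v"
proof (rule ccontr)
  assume ne: "FD2 f x v w \<noteq> FD2 f x w v"
  \<comment> \<open>Half the gap: no number lies within \<open>e\<close> of both mixed derivatives
    at \<open>x\<close>.\<close>
  define e where "e = \<bar>FD2 f x v w - FD2 f x w v\<bar> / 2"
  have e: "e > 0" using ne by (simp add: e_def)
  have sm: "smooth_on S (\<lambda>y. FD2 f y v w)" "smooth_on S (\<lambda>y. FD2 f y w v)"
    using smooth_on_FD assms(2) by blast+
  then have "isCont (\<lambda>y. FD2 f y v w) x" "isCont (\<lambda>y. FD2 f y w v) x"
    using assms(1,3) smooth_on_imp_continuous_on continuous_on_eq_continuous_at by blast+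
  then obtain d1 d2 where d12: "d1 > 0" "\<And>y. dist y x < d1 \<Longrightarrow> dist (FD2 f y v w) (FD2 f x v w) < e"
    "d2 > 0" "\<And>y. dist y x < d2 \<Longrightarrow> dist (FD2 f y w v) (FD2 f x w v) < e"
    using e unfolding continuous_at_eps_delta by (metis dist_commute)
  obtain d3 where d3: "d3 > 0" "ball x d3 \<subseteq> S"
    using assms(1,3) open_contains_ball by blast
  define d where "d = min d1 (min d2 d3)"
  have d: "d > 0" using d12 d3 by (simp add: d_def)
  \<comment> \<open>So small that the whole parallelogram stays within \<open>d\<close> of
    \<open>x\<close>; the \<open>+ 1\<close> keeps the denominator positive.\<close>
  define t where "t = d / (2 * (norm v + norm w + 1))"
  have npos: "norm v + norm w + 1 > 0"
    by (simp add: add_nonneg_pos)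
  have t: "t > 0" using d npos by (simp add: t_def)
  have near: "dist (x + a *\<^sub>R v + b *\<^sub>R w) x < d" if "0 \<le> a" "a \<le> t" "0 \<le> b" "b \<le> t" for a b
  proof -
    have "dist (x + a *\<^sub>R v + b *\<^sub>R w) x = norm (a *\<^sub>R v + b *\<^sub>R w)"
      by (simp add: dist_norm)
    also have "\<dots> \<le> a * norm v + b * norm w"
      using norm_triangle_ineq[of "a *\<^sub>R v" "b *\<^sub>R w"] that by simp
    also have "\<dots> \<le> t * norm v + t * norm w"
      using that by (intro add_mono mult_right_mono) auto
    also have "\<dots> < d"
    proof -
      have "t * norm v + t * norm w \<le> t * (norm v + norm w + 1)"
        using t by (simp add: algebra_simps)
      also have "\<dots> = d / 2" using npos nonzero_eq_divide_eq[of "norm v + norm w + 1" "d / 2"]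
        by (simp add: t_def field_simps del: distrib_left_numeral)
      finally show ?thesis using d by simp
    qed
    finally show ?thesis .
  qed
  have inS: "x + a *\<^sub>R v + b *\<^sub>R w \<in> S" if "0 \<le> a" "a \<le> t" "0 \<le> b" "b \<le> t" for a b
    using near[OF that] d3(2) by (auto simp: d_def dist_commute)
  have line: "((\<lambda>s. h (z + s *\<^sub>R u)) has_derivative (\<lambda>r. r * FD h (z + s *\<^sub>R u) u)) (at s)"
    if "smooth_on S h" "z + s *\<^sub>R u \<in> S" for h :: "'a \<Rightarrow> real" and z u s
  proof -
    have h: "(h has_derivative FD h (z + s *\<^sub>R u)) (at (z + s *\<^sub>R u))"
      using that has_derivative_FD smooth_on_imp_differentiable by blast
    have "((\<lambda>s. z + s *\<^sub>R u) has_derivative (\<lambda>r. r *\<^sub>R u)) (at s)"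
      by (auto intro!: derivative_eq_intros)
    from has_derivative_compose[OF this h] show ?thesis
      using linear_cmul[OF has_derivative_linear[OF h]] by simp
  qed
  \<comment> \<open>Mean value theorem twice: in the direction \<open>u\<close> for the difference
    of \<open>f\<close> along two parallel sides, then in the direction \<open>u'\<close> for the
    derivative of \<open>f\<close> in the direction \<open>u\<close>.\<close>
  have quad: "\<exists>a b. 0 \<le> a \<and> a \<le> t \<and> 0 \<le> b \<and> b \<le> t \<and>
      f (x + t *\<^sub>R u + t *\<^sub>R u') - f (x + t *\<^sub>R u) - f (x + t *\<^sub>R u') + f x
        = t * (t * FD2 f (x + a *\<^sub>R u + b *\<^sub>R u') u' u)"
    if inS: "\<And>a b. 0 \<le> a \<Longrightarrow> a \<le> t \<Longrightarrow> 0 \<le> b \<Longrightarrow> b \<le> t \<Longrightarrow> x + a *\<^sub>R u + b *\<^sub>R u' \<in> S" for u u'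
  proof -
    let ?p = "\<lambda>s. f ((x + t *\<^sub>R u') + s *\<^sub>R u) - f (x + s *\<^sub>R u)"
    have "\<exists>a\<in>{0<..<t}. ?p t - ?p 0 = (t - 0) * FD f ((x + t *\<^sub>R u') + a *\<^sub>R u) u - (t - 0) * FD f (x + a *\<^sub>R u) u"
    proof (rule mvt_simple[OF t])
      fix s assume s: "0 \<le> s" "s \<le> t"
      have i: "x + t *\<^sub>R u' + s *\<^sub>R u \<in> S" "x + s *\<^sub>R u \<in> S"
        using inS[of s t] inS[of s 0] s t by (auto simp: algebra_simps)
      show "(?p has_derivative (\<lambda>r. r * FD f ((x + t *\<^sub>R u') + s *\<^sub>R u) u - r * FD f (x + s *\<^sub>R u) u))
         (at s within {0..t})"
        by (rule has_derivative_at_withinI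
            [OF has_derivative_diff[OF line[OF assms(2) i(1)] line[OF assms(2) i(2)]]])
    qed
    then obtain a where a: "a \<in> {0<..<t}"
      "?p t - ?p 0 = t * (FD f ((x + t *\<^sub>R u') + a *\<^sub>R u) u - FD f (x + a *\<^sub>R u) u)"
      by (auto simp: algebra_simps)
    let ?q = "\<lambda>s. FD f ((x + a *\<^sub>R u) + s *\<^sub>R u') u"
    have "\<exists>b\<in>{0<..<t}. ?q t - ?q 0 = (t - 0) * FD2 f ((x + a *\<^sub>R u) + b *\<^sub>R u') u' u"
    proof (rule mvt_simple[OF t])
      fix s assume s: "0 \<le> s" "s \<le> t"
      show "(?q has_derivative (\<lambda>r. r * FD2 f ((x + a *\<^sub>R u) + s *\<^sub>R u') u' u)) (at s within {0..t})"
        by (rule has_derivative_at_withinI[OF line[OF smooth_on_FD[OF assms(2)]]])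
          (use a s in \<open>auto intro: inS\<close>)
    qed
    then obtain b where b: "b \<in> {0<..<t}" "?q t - ?q 0 = t * FD2 f ((x + a *\<^sub>R u) + b *\<^sub>R u') u' u"
      by auto
    have e: "(x + t *\<^sub>R u') + a *\<^sub>R u = (x + a *\<^sub>R u) + t *\<^sub>R u'"
      by simp
    have "?p t - ?p 0 = t * (?q t - ?q 0)"
      unfolding a(2) e by simp
    then have "?p t - ?p 0 = t * (t * FD2 f ((x + a *\<^sub>R u) + b *\<^sub>R u') u' u)"
      unfolding b(2) .
    moreover have "?p t - ?p 0
        = f (x + t *\<^sub>R u + t *\<^sub>R u') - f (x + t *\<^sub>R u) - f (x + t *\<^sub>R u') + f x"
      by (simp add: add.commute add.left_commute)
    ultimately show ?thesis
      using a(1) b(1) by (intro exI[of _ a] exI[of _ b]) auto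
  qed
  obtain a b where ab: "0 \<le> a" "a \<le> t" "0 \<le> b" "b \<le> t"
      "f (x + t *\<^sub>R v + t *\<^sub>R w) - f (x + t *\<^sub>R v) - f (x + t *\<^sub>R w) + f x
        = t * (t * FD2 f (x + a *\<^sub>R v + b *\<^sub>R w) w v)"
    using quad[of v w] inS by blast
  have "x + a *\<^sub>R w + b *\<^sub>R v \<in> S" if "0 \<le> a" "a \<le> t" "0 \<le> b" "b \<le> t" for a b
    using inS[of b a] that by (simp add: algebra_simps)
  then obtain a' b' where ab': "0 \<le> a'" "a' \<le> t" "0 \<le> b'" "b' \<le> t"
      "f (x + t *\<^sub>R w + t *\<^sub>R v) - f (x + t *\<^sub>R w) - f (x + t *\<^sub>R v) + f x
        = t * (t * FD2 f (x + a' *\<^sub>R w + b' *\<^sub>R v) v w)"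
    using quad[of w v] by blast
  have e: "x + t *\<^sub>R w + t *\<^sub>R v = x + t *\<^sub>R v + t *\<^sub>R w"
    by simp
  have "t * (t * FD2 f (x + a *\<^sub>R v + b *\<^sub>R w) w v) = t * (t * FD2 f (x + a' *\<^sub>R w + b' *\<^sub>R v) v w)"
    using ab(5) ab'(5) unfolding e by linarith
  then have "FD2 f (x + a *\<^sub>R v + b *\<^sub>R w) w v = FD2 f (x + b' *\<^sub>R v + a' *\<^sub>R w) v w"
    using t by (simp add: add.commute add.left_commute)
  moreover have "\<bar>FD2 f (x + a *\<^sub>R v + b *\<^sub>R w) w v - FD2 f x w v\<bar> < e"
    using d12(4) near[OF ab(1-4)] by (simp add: d_def dist_real_def)
  moreover have "\<bar>FD2 f (x + b' *\<^sub>R v + a' *\<^sub>R w) v w - FD2 f x v w\<bar> < e"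
    using d12(2) near[OF ab'(3,4,1,2)] by (simp add: d_def dist_real_def)
  ultimately show False
    by (auto simp: e_def abs_if split: if_splits)
qed

lemma second_derivative_symmetric:
  fixes f :: "'a::euclidean_space \<Rightarrow> 'b::euclidean_space"
  assumes "open S" "smooth_on S f" "x \<in> S"
  shows "FD2 f x v w = FD2 f x w v"
proof (rule euclidean_eqI)
  fix b :: 'b assume "b \<in> Basis"
  let ?h = "\<lambda>y. f y \<bullet> b"
  have sm: "smooth_on S ?h"
    using smooth_on_bounded_linear[OF bounded_linear_inner_left assms(1,2)] .
  have 1: "FD ?h y u = FD f y u \<bullet> b" if "y \<in> S" for y u
    using FD_eqI[OF has_derivative_inner_left[OF has_derivative_FD[OF smooth_on_imp_differentiable[OF assms(2) that]]], of b]
    by (simp add: fun_eq_iff)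
  have 2: "FD2 ?h x u u' = FD2 f x u u' \<bullet> b" for u u'
  proof -
    have "((\<lambda>y. FD f y u' \<bullet> b) has_derivative (\<lambda>u. FD2 f x u u' \<bullet> b)) (at x)"
      by (intro has_derivative_inner_left has_derivative_FD smooth_on_imp_differentiable[of S]
          smooth_on_FD assms)
    then have "((\<lambda>y. FD ?h y u') has_derivative (\<lambda>u. FD2 f x u u' \<bullet> b)) (at x)"
      by (rule has_derivative_transform_within_open[OF _ assms(1,3)]) (simp add: 1)
    then show ?thesis
      by (simp add: FD_eqI)
  qed
  show "FD2 f x v w \<bullet> b = FD2 f x w v \<bullet> b"
    using real_second_derivative_symmetric[OF assms(1) sm assms(3), of v w] by (simp add: 2)
qed

section \<open>Metrics in coordinates\<close>

lemma bilinear_expand: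
  fixes B :: "'a::euclidean_space \<Rightarrow> 'b::euclidean_space \<Rightarrow> 'c::real_vector"
  assumes "bilinear B"
  shows "B v w = (\<Sum>b\<in>Basis. \<Sum>b'\<in>Basis. (v \<bullet> b) *\<^sub>R (w \<bullet> b') *\<^sub>R B b b')"
proof -
  have l: "linear (\<lambda>v. B v w)" and r: "linear (B b)" for b
    using assms unfolding bilinear_def by auto
  have "B v w = (\<Sum>b\<in>Basis. (v \<bullet> b) *\<^sub>R B b w)"
    using linear_euclidean_expand[OF l] .
  also have "\<dots> = (\<Sum>b\<in>Basis. \<Sum>b'\<in>Basis. (v \<bullet> b) *\<^sub>R (w \<bullet> b') *\<^sub>R B b b')"
    by (subst linear_euclidean_expand[OF r]) (simp add: scaleR_sum_right)
  finally show ?thesis .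
qed

text \<open>Differentiability of \<open>B\<close> in the point is assumed for fixed arguments only;
  in finite dimension, expansion in bases turns this into the full product rule.\<close>

lemma has_derivative_bilinear_family:
  fixes B :: "'a::real_normed_vector \<Rightarrow> 'e::euclidean_space \<Rightarrow> 'f::euclidean_space \<Rightarrow> 'c::real_normed_vector"
    and T :: "'b::real_normed_vector \<Rightarrow> 'a"
  assumes "open S" "open U" "x \<in> U" "T ` U \<subseteq> S" and T: "(T has_derivative T') (at x)"
    and V: "(V has_derivative V') (at x)" and W: "(W has_derivative W') (at x)"
    and bil_B: "\<And>x. x \<in> S \<Longrightarrow> bilinear (B x)"
    and diff_B: "\<And>x v w. x \<in> S \<Longrightarrow> (\<lambda>y. B y v w) differentiable (at x)"
  shows "((\<lambda>y. B (T y) (V y) (W y)) has_derivative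
     (\<lambda>a. FD (\<lambda>y. B y (V x) (W x)) (T x) (T' a) + B (T x) (V' a) (W x) + B (T x) (V x) (W' a))) (at x)"
proof -
  have TS: "T y \<in> S" if "y \<in> U" for y using assms(4) that by blast
  note Tx = TS[OF assms(3)]
  have dB: "((\<lambda>y. B y b b') has_derivative FD (\<lambda>y. B y b b') (T x)) (at (T x))" for b b'
    using has_derivative_FD diff_B Tx by blast
  \<comment> \<open>Stated for arbitrary \<open>Q\<close> and domain because it is used twice: with
    \<open>Q\<close> the identity and constant arguments it also expands the derivative of
    \<open>B\<close> itself.\<close>
  have gen: "((\<lambda>y. B (Q y) (V y) (W y)) has_derivative
     (\<lambda>a. \<Sum>b\<in>Basis. \<Sum>b'\<in>Basis.
        (V x \<bullet> b) *\<^sub>R ((W x \<bullet> b') *\<^sub>R FD (\<lambda>y. B y b b') (Q x) (Q' a) + (W' a \<bullet> b') *\<^sub>R B (Q x) b b')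
        + (V' a \<bullet> b) *\<^sub>R ((W x \<bullet> b') *\<^sub>R B (Q x) b b'))) (at x)"
    if Q: "open U" "x \<in> U" "Q ` U \<subseteq> S" "(Q has_derivative Q') (at x)"
      and V: "(V has_derivative V') (at x)" and W: "(W has_derivative W') (at x)"
    for Q Q' V V' W W' U and x :: "'d::real_normed_vector"
  proof -
    have Qx: "Q x \<in> S" using Q by blast
    have dB: "((\<lambda>y. B y b b') has_derivative FD (\<lambda>y. B y b b') (Q x)) (at (Q x))" for b b'
      using has_derivative_FD diff_B Qx by blast
    have "((\<lambda>y. \<Sum>b\<in>Basis. \<Sum>b'\<in>Basis. (V y \<bullet> b) *\<^sub>R ((W y \<bullet> b') *\<^sub>R B (Q y) b b')) has_derivative
     (\<lambda>a. \<Sum>b\<in>Basis. \<Sum>b'\<in>Basis.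
        (V x \<bullet> b) *\<^sub>R ((W x \<bullet> b') *\<^sub>R FD (\<lambda>y. B y b b') (Q x) (Q' a) + (W' a \<bullet> b') *\<^sub>R B (Q x) b b')
        + (V' a \<bullet> b) *\<^sub>R ((W x \<bullet> b') *\<^sub>R B (Q x) b b'))) (at x)"
    proof (intro has_derivative_sum)
      fix b b'
      show "((\<lambda>y. (V y \<bullet> b) *\<^sub>R ((W y \<bullet> b') *\<^sub>R B (Q y) b b')) has_derivative
         (\<lambda>a. (V x \<bullet> b) *\<^sub>R ((W x \<bullet> b') *\<^sub>R FD (\<lambda>y. B y b b') (Q x) (Q' a) + (W' a \<bullet> b') *\<^sub>R B (Q x) b b')
        + (V' a \<bullet> b) *\<^sub>R ((W x \<bullet> b') *\<^sub>R B (Q x) b b'))) (at x)"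
        by (rule has_derivative_scaleR[OF has_derivative_inner_left[OF V]
              has_derivative_scaleR[OF has_derivative_inner_left[OF W]
                has_derivative_compose[OF Q(4) dB]]])
    qed
    moreover have "B (Q y) (V y) (W y)
        = (\<Sum>b\<in>Basis. \<Sum>b'\<in>Basis. (V y \<bullet> b) *\<^sub>R ((W y \<bullet> b') *\<^sub>R B (Q y) b b'))" if "y \<in> U" for y
      using bilinear_expand[OF bil_B[of "Q y"], of "V y" "W y"] Q(3) that by auto
    ultimately show ?thesis
      using has_derivative_transform_within_open[OF _ Q(1,2), of _ _ _ "\<lambda>y. B (Q y) (V y) (W y)"]
      by presburger
  qed
  have FD_expand: "FD (\<lambda>y. B y v w) (T x) a
      = (\<Sum>b\<in>Basis. \<Sum>b'\<in>Basis. (v \<bullet> b) *\<^sub>R ((w \<bullet> b') *\<^sub>R FD (\<lambda>y. B y b b') (T x) a))" for v w a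
    using FD_eqI[OF gen[OF assms(1) Tx _ has_derivative_ident has_derivative_const has_derivative_const, of v w]]
    by (simp add: fun_eq_iff)
  have B_expand: "B (T x) v w = (\<Sum>b\<in>Basis. \<Sum>b'\<in>Basis. (v \<bullet> b) *\<^sub>R ((w \<bullet> b') *\<^sub>R B (T x) b b'))" for v w
    using bilinear_expand[OF bil_B[OF Tx], of v w] by simp
  have "(\<lambda>a. FD (\<lambda>y. B y (V x) (W x)) (T x) (T' a) + B (T x) (V' a) (W x) + B (T x) (V x) (W' a))
     = (\<lambda>a. \<Sum>b\<in>Basis. \<Sum>b'\<in>Basis.
        (V x \<bullet> b) *\<^sub>R ((W x \<bullet> b') *\<^sub>R FD (\<lambda>y. B y b b') (T x) (T' a) + (W' a \<bullet> b') *\<^sub>R B (T x) b b')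
        + (V' a \<bullet> b) *\<^sub>R ((W x \<bullet> b') *\<^sub>R B (T x) b b'))"
  proof
    fix a
    show "FD (\<lambda>y. B y (V x) (W x)) (T x) (T' a) + B (T x) (V' a) (W x) + B (T x) (V x) (W' a)
     = (\<Sum>b\<in>Basis. \<Sum>b'\<in>Basis.
        (V x \<bullet> b) *\<^sub>R ((W x \<bullet> b') *\<^sub>R FD (\<lambda>y. B y b b') (T x) (T' a) + (W' a \<bullet> b') *\<^sub>R B (T x) b b')
        + (V' a \<bullet> b) *\<^sub>R ((W x \<bullet> b') *\<^sub>R B (T x) b b'))"
      unfolding FD_expand[of "V x" "W x" "T' a"] B_expand[of "V' a" "W x"] B_expand[of "V x" "W' a"]
        sum.distrib[symmetric]
      by (intro sum.cong refl) (simp add: scaleR_add_right algebra_simps)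
  qed
  from gen[OF assms(2-7), folded this] show ?thesis .
qed

lemma has_derivative_FD_compose:
  fixes f :: "'a::euclidean_space \<Rightarrow> 'b::real_normed_vector" and T :: "'c::real_normed_vector \<Rightarrow> 'a"
  assumes S: "open S" "smooth_on S f" and U: "open U" "x \<in> U" "T ` U \<subseteq> S"
    and T: "(T has_derivative T') (at x)" and Y: "(Y has_derivative Y') (at x)"
  shows "((\<lambda>y. FD f (T y) (Y y)) has_derivative
    (\<lambda>v. FD2 f (T x) (T' v) (Y x) + FD f (T x) (Y' v))) (at x)"
proof -
  \<comment> \<open>A dummy real factor makes the linear map \<open>FD f y\<close> bilinear, so that
    the product rule above covers it.\<close>
  let ?B = "\<lambda>y v (r::real). r *\<^sub>R FD f y v"
  have bil: "bilinear (?B y)" if "y \<in> S" for y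
    using linear_FD[OF smooth_on_imp_differentiable[OF S(2) that]]
    by (auto simp: bilinear_def linear_iff scaleR_add_left scaleR_add_right)
  have diff: "(\<lambda>y. ?B y v r) differentiable (at y)" if "y \<in> S" for y v r
    using has_derivative_scaleR_right[OF has_derivative_FD[OF smooth_on_imp_differentiable
          [OF smooth_on_FD[OF S(2)] that]]]
    unfolding differentiable_def by blast
  show ?thesis
    using has_derivative_bilinear_family[where B = ?B, OF S(1) U T Y has_derivative_const[of 1] bil diff]
    by simp
qed

text \<open>Positive definiteness makes the linear map \<open>L\<close>, which lowers the index of
  \<open>u\<close>, injective, hence surjective by dimension.\<close>

lemma riesz_representation:
  fixes B :: "'e::euclidean_space \<Rightarrow> 'e \<Rightarrow> real"
  assumes "bilinear B" "\<And>v. v \<noteq> 0 \<Longrightarrow> B v v > 0" "linear \<kappa>"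
  shows "\<exists>u. \<forall>z. B u z = \<kappa> z"
proof -
  define L where "L u = (\<Sum>b\<in>Basis. B u b *\<^sub>R b)" for u
  have l: "linear (\<lambda>u. B u z)" and r: "linear (B u)" for u z
    using assms(1) unfolding bilinear_def by auto
  have Lb: "L u \<bullet> b = B u b" if "b \<in> Basis" for u b
    using that by (simp add: L_def)
  have lin: "linear L"
    unfolding L_def
    by (intro linearI)
      (simp_all add: linear_add[OF l] linear_cmul[OF l] scaleR_add_left sum.distrib scaleR_sum_right)
  have "inj L"
    unfolding linear_injective_0[OF lin]
  proof (intro allI impI)
    fix u assume "L u = 0"
    then have "B u b = 0" if "b \<in> Basis" for b
      using Lb[OF that, of u] by simp
    then have "B u u = 0"
      using linear_euclidean_expand[OF r, of u u] by simp
    then show "u = 0"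
      using assms(2)[of u] by fastforce
  qed
  then obtain u where u: "L u = (\<Sum>b\<in>Basis. \<kappa> b *\<^sub>R b)"
    using linear_injective_imp_surjective[OF lin] by (metis surjD)
  have "B u b = \<kappa> b" if "b \<in> Basis" for b
    using Lb[OF that, of u] that by (simp add: u)
  then have "B u z = \<kappa> z" for z
    using linear_euclidean_expand[OF r, of u z] linear_euclidean_expand[OF assms(3), of z] by simp
  then show ?thesis by blast
qed

section \<open>Metrics on open sets of a Euclidean space and their Christoffel symbols\<close>

definition local_christoffel :: "('e::euclidean_space \<Rightarrow> 'e \<Rightarrow> 'e \<Rightarrow> real) \<Rightarrow> 'e \<Rightarrow> 'e \<Rightarrow> 'e \<Rightarrow> 'e" where
  "local_christoffel G x v w = (THE u. \<forall>z. G x u z =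
     (FD (\<lambda>y. G y w z) x v + FD (\<lambda>y. G y v z) x w - FD (\<lambda>y. G y v w) x z) / 2)"

lemma christoffel_eq_local: "christoffel A g c = local_christoffel (metric_comp A g c)"
  by (simp add: fun_eq_iff christoffel_def local_christoffel_def)

text \<open>A metric in one chart, detached from any manifold, so that the same results serve
  \<open>g\<close> and the Sasaki metric. One derivative is what the Koszul formula requires, and
  what is proved of the Sasaki metric.\<close>

locale local_metric =
  fixes S :: "'e::euclidean_space set" and G :: "'e \<Rightarrow> 'e \<Rightarrow> 'e \<Rightarrow> real"
  assumes open_S: "open S"
    and bil: "x \<in> S \<Longrightarrow> bilinear (G x)"
    and sym: "x \<in> S \<Longrightarrow> G x v w = G x w v"
    and pos: "x \<in> S \<Longrightarrow> v \<noteq> 0 \<Longrightarrow> G x v v > 0"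
    and diff: "x \<in> S \<Longrightarrow> (\<lambda>y. G y v w) differentiable (at x)"
begin

lemma G_simps:
  assumes "x \<in> S"
  shows "G x (u + v) w = G x u w + G x v w" "G x u (v + w) = G x u v + G x u w"
    "G x (u - v) w = G x u w - G x v w" "G x u (v - w) = G x u v - G x u w"
    "G x (r *\<^sub>R u) w = r * G x u w" "G x u (r *\<^sub>R w) = r * G x u w"
    "G x 0 w = 0" "G x u 0 = 0" "G x (- u) w = - G x u w"
  using bil[OF assms]
  by (simp_all add: bilinear_ladd bilinear_radd bilinear_lsub bilinear_rsub bilinear_lmul
      bilinear_rmul bilinear_lzero bilinear_rzero bilinear_lneg)

lemma nondegenerate:
  assumes "x \<in> S" "\<And>z. G x u z = G x u' z"
  shows "u = u'"
proof (rule ccontr)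
  assume "u \<noteq> u'"
  then have "G x (u - u') (u - u') > 0"
    using pos[OF assms(1)] by simp
  then show False
    using assms by (simp add: G_simps)
qed

lemma has_derivative_G_compose:
  fixes T :: "'b::real_normed_vector \<Rightarrow> 'e"
  assumes "open U" "x \<in> U" "T ` U \<subseteq> S" and "(T has_derivative T') (at x)"
    and "(V has_derivative V') (at x)" and "(W has_derivative W') (at x)"
  shows "((\<lambda>y. G (T y) (V y) (W y)) has_derivative
     (\<lambda>a. FD (\<lambda>y. G y (V x) (W x)) (T x) (T' a) + G (T x) (V' a) (W x) + G (T x) (V x) (W' a))) (at x)"
  by (rule has_derivative_bilinear_family[OF open_S assms bil diff])

lemmas has_derivative_G =
  has_derivative_G_compose[where T = "\<lambda>y. y", OF open_S _ _ has_derivative_ident, simplified]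

lemma FD_G_linear:
  assumes "x \<in> S"
  shows "FD (\<lambda>y. G y (u + v) w) x a = FD (\<lambda>y. G y u w) x a + FD (\<lambda>y. G y v w) x a"
    "FD (\<lambda>y. G y (r *\<^sub>R v) w) x a = r * FD (\<lambda>y. G y v w) x a"
    "FD (\<lambda>y. G y u (v + w)) x a = FD (\<lambda>y. G y u v) x a + FD (\<lambda>y. G y u w) x a"
    "FD (\<lambda>y. G y v (r *\<^sub>R w)) x a = r * FD (\<lambda>y. G y v w) x a"
    "FD (\<lambda>y. G y v w) x (a + b) = FD (\<lambda>y. G y v w) x a + FD (\<lambda>y. G y v w) x b"
    "FD (\<lambda>y. G y v w) x (r *\<^sub>R a) = r * FD (\<lambda>y. G y v w) x a"
    and FD_G_sym: "FD (\<lambda>y. G y v w) x a = FD (\<lambda>y. G y w v) x a"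
proof -
  have d: "((\<lambda>y. G y v w) has_derivative FD (\<lambda>y. G y v w) x) (at x)" for v w
    using has_derivative_FD diff assms by blast
  have tr: "FD f x a = f' a"
    if "(g has_derivative f') (at x)" "\<And>y. y \<in> S \<Longrightarrow> g y = f y" for f g :: "'e \<Rightarrow> real" and f' a
    using FD_eqI[OF has_derivative_transform_within_open[OF that(1) open_S assms that(2)]] by simp
  show "FD (\<lambda>y. G y (u + v) w) x a = FD (\<lambda>y. G y u w) x a + FD (\<lambda>y. G y v w) x a"
    by (rule tr[OF has_derivative_add[OF d d]]) (simp add: G_simps)
  show "FD (\<lambda>y. G y (r *\<^sub>R v) w) x a = r * FD (\<lambda>y. G y v w) x a"
    by (rule tr[OF has_derivative_mult_right[OF d]]) (simp add: G_simps)
  show "FD (\<lambda>y. G y u (v + w)) x a = FD (\<lambda>y. G y u v) x a + FD (\<lambda>y. G y u w) x a"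
    by (rule tr[OF has_derivative_add[OF d d]]) (simp add: G_simps)
  show "FD (\<lambda>y. G y v (r *\<^sub>R w)) x a = r * FD (\<lambda>y. G y v w) x a"
    by (rule tr[OF has_derivative_mult_right[OF d]]) (simp add: G_simps)
  show "FD (\<lambda>y. G y v w) x a = FD (\<lambda>y. G y w v) x a"
    by (rule tr[OF d]) (simp add: sym)
  show "FD (\<lambda>y. G y v w) x (a + b) = FD (\<lambda>y. G y v w) x a + FD (\<lambda>y. G y v w) x b"
    "FD (\<lambda>y. G y v w) x (r *\<^sub>R a) = r * FD (\<lambda>y. G y v w) x a"
    using has_derivative_linear[OF d[of v w]] by (simp_all add: linear_add linear_cmul)
qed

lemma local_christoffel_eq:
  assumes "x \<in> S"
  shows "G x (local_christoffel G x v w) z =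
     (FD (\<lambda>y. G y w z) x v + FD (\<lambda>y. G y v z) x w - FD (\<lambda>y. G y v w) x z) / 2"
proof -
  let ?k = "\<lambda>z. (FD (\<lambda>y. G y w z) x v + FD (\<lambda>y. G y v z) x w - FD (\<lambda>y. G y v w) x z) / 2"
  have "linear ?k"
    by (intro linearI) (simp_all add: FD_G_linear[OF assms] field_simps)
  then obtain u where u: "\<forall>z. G x u z = ?k z"
    using riesz_representation[OF bil pos] assms by blast
  have "\<forall>z. G x (local_christoffel G x v w) z = ?k z"
    unfolding local_christoffel_def
  proof (rule theI[of _ u])
    show "u' = u" if "\<forall>z. G x u' z = ?k z" for u'
      by (rule nondegenerate[OF assms]) (simp only: that u)
  qed (rule u)
  then show ?thesis ..
qed

text \<open>The way in which Christoffel symbols are determined from here on: a candidate is tested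
  against the Koszul formula, and nondegeneracy does the rest.\<close>

lemma local_christoffel_unique:
  assumes "x \<in> S" "\<And>z. G x u z =
     (FD (\<lambda>y. G y w z) x v + FD (\<lambda>y. G y v z) x w - FD (\<lambda>y. G y v w) x z) / 2"
  shows "local_christoffel G x v w = u"
  by (rule nondegenerate[OF assms(1)]) (simp add: local_christoffel_eq[OF assms(1)] assms(2))

lemma local_christoffel_sym: "x \<in> S \<Longrightarrow> local_christoffel G x v w = local_christoffel G x w v"
  using FD_G_sym[of x v w] by (intro local_christoffel_unique) (simp_all add: local_christoffel_eq add.commute)

lemma local_christoffel_linear_right:
  assumes "x \<in> S" shows "linear (local_christoffel G x v)"
proof (rule linearI)
  fix a b r
  show "local_christoffel G x v (a + b) = local_christoffel G x v a + local_christoffel G x v b"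
    by (rule local_christoffel_unique[OF assms])
      (simp add: G_simps assms local_christoffel_eq FD_G_linear add_divide_distrib diff_divide_distrib)
  show "local_christoffel G x v (r *\<^sub>R a) = r *\<^sub>R local_christoffel G x v a"
    by (rule local_christoffel_unique[OF assms])
      (simp add: G_simps assms local_christoffel_eq FD_G_linear algebra_simps)
qed

lemma bilinear_local_christoffel:
  assumes "x \<in> S" shows "bilinear (local_christoffel G x)"
  unfolding bilinear_def
proof (intro conjI allI local_christoffel_linear_right assms)
  fix w
  have "(\<lambda>v. local_christoffel G x v w) = local_christoffel G x w"
    using local_christoffel_sym[OF assms] by blast
  then show "linear (\<lambda>v. local_christoffel G x v w)"
    using local_christoffel_linear_right[OF assms] by simp
qed

text \<open>Adding the Koszul formulas of the two terms leaves only the derivative in the direction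
  \<open>a\<close>, by symmetry of \<open>G\<close>.\<close>

lemma metric_compatible:
  assumes "x \<in> S"
  shows "FD (\<lambda>y. G y v w) x a = G x (local_christoffel G x a v) w + G x v (local_christoffel G x a w)"
proof -
  have "G x v (local_christoffel G x a w) = G x (local_christoffel G x a w) v"
    using sym assms by blast
  then show ?thesis
    using FD_G_sym[OF assms, of v w a] FD_G_sym[OF assms, of a v w]
    by (simp add: local_christoffel_eq[OF assms] field_simps)
qed

lemma FD_covariant:
  assumes "x \<in> S" "(V has_derivative V') (at x)" "(W has_derivative W') (at x)"
  shows "((\<lambda>y. G y (V y) (W y)) has_derivative
    (\<lambda>a. G x (V' a + local_christoffel G x a (V x)) (W x) + G x (V x) (W' a + local_christoffel G x a (W x)))) (at x)"
  using has_derivative_G[OF assms]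
  by (simp add: metric_compatible[OF assms(1)] G_simps[OF assms(1)] algebra_simps)

text \<open>The symbol solves a linear system \<open>G y u = K y\<close> with differentiable
  coefficients. Instead of inverting matrices, the inverse function theorem is applied to
  \<open>(y, u) \<mapsto> (y, G y u)\<close> at the solution over \<open>x\<close>, and the inverse
  is evaluated along \<open>y \<mapsto> (y, K y)\<close>.\<close>

lemma differentiable_local_christoffel:
  assumes "x \<in> S" and DD: "\<And>a v w. (\<lambda>y. FD (\<lambda>z. G z v w) y a) differentiable (at x)"
  shows "(\<lambda>y. local_christoffel G y v w) differentiable (at x)"
proof -
  define f where "f p = (fst p, \<Sum>b\<in>Basis. G (fst p) (snd p) b *\<^sub>R b)" for p
  define inv where "inv y k = (SOME u. \<forall>z. G y u z = k \<bullet> z)" for y and k :: 'e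
  have inv: "G y (inv y k) z = k \<bullet> z" if "y \<in> S" for y k z
  proof -
    have "\<exists>u. \<forall>z. G y u z = k \<bullet> z"
      using that by (intro riesz_representation bil pos) (auto intro: bounded_linear.linear bounded_linear_inner_right)
    then show ?thesis
      unfolding inv_def by (rule someI2_ex) blast
  qed
  have inv_eqI: "inv y k = u" if "y \<in> S" "\<And>b. b \<in> Basis \<Longrightarrow> G y u b = k \<bullet> b" for y k u
  proof (rule nondegenerate[OF that(1)])
    fix z
    have "linear (G y u)"
      using bil[OF that(1)] unfolding bilinear_def by auto
    from linear_euclidean_expand[OF this, of z] have "G y u z = (\<Sum>b\<in>Basis. (z \<bullet> b) * (k \<bullet> b))"
      by (simp add: that)
    then show "G y (inv y k) z = G y u z"
      using inv[OF that(1), of k z] by (simp add: euclidean_inner[of k z] mult.commute)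
  qed
  define h where "h y b = (FD (\<lambda>z. G z w b) y v + FD (\<lambda>z. G z v b) y w - FD (\<lambda>z. G z v w) y b) / 2" for y b
  define K where "K y = (\<Sum>b\<in>Basis. h y b *\<^sub>R b)" for y
  have local_christoffel_inv: "local_christoffel G y v w = inv y (K y)" if "y \<in> S" for y
    using inv_eqI[OF that, of "local_christoffel G y v w" "K y"] by (simp add: K_def h_def local_christoffel_eq[OF that])
  have "\<exists>D. ((\<lambda>y. h y b) has_derivative D) (at x)" for b
  proof -
    obtain D1 D2 D3 where "((\<lambda>y. FD (\<lambda>z. G z w b) y v) has_derivative D1) (at x)"
      "((\<lambda>y. FD (\<lambda>z. G z v b) y w) has_derivative D2) (at x)"
      "((\<lambda>y. FD (\<lambda>z. G z v w) y b) has_derivative D3) (at x)"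
      using DD unfolding differentiable_def by metis
    from bounded_linear.has_derivative[OF bounded_linear_divide
        has_derivative_diff[OF has_derivative_add[OF this(1,2)] this(3)], of 2]
    show ?thesis
      unfolding h_def by blast
  qed
  then obtain D where "\<And>b. ((\<lambda>y. h y b) has_derivative D b) (at x)"
    by metis
  then have "(K has_derivative (\<lambda>a. \<Sum>b\<in>Basis. D b a *\<^sub>R b)) (at x)"
    unfolding K_def by (intro has_derivative_sum has_derivative_scaleR_left)
  then have dK: "K differentiable (at x)"
    unfolding differentiable_def by blast
  define u where "u = local_christoffel G x v w"
  \<comment> \<open>The derivative of \<open>f\<close> at \<open>(x, u)\<close> is block triangular;
    \<open>g'\<close> inverts it by subtracting the off-diagonal block before applying
    \<open>inv x\<close>.\<close>
  define f' where "f' p = (fst p, \<Sum>b\<in>Basis. (FD (\<lambda>y. G y u b) x (fst p) + G x (snd p) b) *\<^sub>R b)" for p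
  define g' where "g' p = (fst p, inv x (snd p - (\<Sum>b\<in>Basis. FD (\<lambda>y. G y u b) x (fst p) *\<^sub>R b)))" for p
  let ?g = "\<lambda>p. (fst p, inv (fst p) (snd p))"
  have o: "open (S \<times> (UNIV::'e set))"
    using open_S by (simp add: open_Times)
  have dG: "((\<lambda>p. G (fst p) (snd p) b) has_derivative
     (\<lambda>q. FD (\<lambda>y. G y (snd p) b) (fst p) (fst q) + G (fst p) (snd q) b)) (at p)"
    if "p \<in> S \<times> UNIV" for p b
  proof -
    have "fst ` (S \<times> (UNIV::'e set)) \<subseteq> S" by auto
    from has_derivative_G_compose[OF o that this has_derivative_fst[OF has_derivative_ident]
        has_derivative_snd[OF has_derivative_ident] has_derivative_const]
    show ?thesis
      using that by (auto simp: G_simps)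
  qed
  have df: "(f has_derivative (\<lambda>q. (fst q, \<Sum>b\<in>Basis. (FD (\<lambda>y. G y (snd p) b) (fst p) (fst q) + G (fst p) (snd q) b) *\<^sub>R b))) (at p)"
    if "p \<in> S \<times> UNIV" for p
    unfolding f_def
    by (intro has_derivative_Pair has_derivative_fst has_derivative_ident has_derivative_sum
        has_derivative_scaleR_left dG that)
  have xu: "(x, u) \<in> S \<times> UNIV" using assms(1) by simp
  have "(?g has_derivative g') (at (f (x, u)))"
  \<comment> \<open>A left inverse of \<open>f\<close> is already at hand, so continuity of
    \<open>f\<close> and an invertible derivative at the single point \<open>(x, u)\<close>
    suffice.\<close>
  proof (rule has_derivative_inverse_strong[OF o xu])
    show "continuous_on (S \<times> UNIV) f"
      using df by (intro continuous_at_imp_continuous_on ballI) (auto dest: has_derivative_continuous)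
    show "?g (f p) = p" if "p \<in> S \<times> UNIV" for p
      using that inv_eqI[of "fst p" "snd p"] by (auto simp: f_def)
    show "(f has_derivative f') (at (x, u))"
      using df[OF xu] by (simp add: f'_def[abs_def])
    show "f' \<circ> g' = id"
    proof
      fix p :: "'e \<times> 'e"
      have "(\<Sum>b\<in>Basis. (FD (\<lambda>y. G y u b) x (fst p) + (snd p - (\<Sum>b\<in>Basis. FD (\<lambda>y. G y u b) x (fst p) *\<^sub>R b)) \<bullet> b) *\<^sub>R b)
          = snd p"
        by (rule euclidean_eqI) (simp add: inner_diff_left)
      then show "(f' \<circ> g') p = id p"
        by (cases p) (simp add: f'_def g'_def inv[OF assms(1)])
    qed
  qed
  moreover have "f (x, u) = (x, K x)"
    by (simp add: f_def u_def K_def h_def local_christoffel_eq[OF assms(1)])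
  ultimately have "?g differentiable (at (x, K x))"
    unfolding differentiable_def by auto
  moreover have "(\<lambda>y. (y, K y)) differentiable (at x)"
    using dK has_derivative_Pair[OF has_derivative_ident] unfolding differentiable_def by blast
  ultimately have "(\<lambda>y. ?g (y, K y)) differentiable (at x)"
    using differentiable_chain_at[of "\<lambda>y. (y, K y)" x ?g] by (simp add: o_def)
  then obtain D where "((\<lambda>y. (y, inv y (K y))) has_derivative D) (at x)"
    unfolding differentiable_def by auto
  from has_derivative_snd[OF this] have "((\<lambda>y. inv y (K y)) has_derivative (\<lambda>a. snd (D a))) (at x)"
    by simp
  from has_derivative_transform_within_open[OF this open_S assms(1)] local_christoffel_inv show ?thesis
    unfolding differentiable_def by metis
qed

end

section \<open>Localisation, pullback and change of coordinates of metrics\<close>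

lemma local_metric_cong:
  assumes G: "local_metric S G" and eq: "\<And>x v w. x \<in> S \<Longrightarrow> G' x v w = G x v w"
  shows "local_metric S G'"
proof
  interpret local_metric S G by fact
  show "open S" by (rule open_S)
  fix x v w assume x: "x \<in> S"
  have "G' x = G x" using eq[OF x] by blast
  then show "bilinear (G' x)" "G' x v w = G' x w v" "v \<noteq> 0 \<Longrightarrow> G' x v v > 0"
    using bil[OF x] sym[OF x] pos[OF x] by simp_all
  have "((\<lambda>y. G' y v w) has_derivative FD (\<lambda>y. G y v w) x) (at x)"
    by (rule has_derivative_transform_within_open[OF has_derivative_FD[OF diff[OF x]] open_S x])
      (simp add: eq)
  then show "(\<lambda>y. G' y v w) differentiable (at x)"
    unfolding differentiable_def by blast
qed

lemma local_metric_local: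
  assumes "\<And>x. x \<in> S \<Longrightarrow> \<exists>U. open U \<and> x \<in> U \<and> U \<subseteq> S \<and> local_metric U G"
  shows "local_metric S G"
proof
  show "open S"
    using assms by (subst open_subopen) blast
qed (use assms in \<open>blast dest: local_metric.bil local_metric.sym local_metric.pos local_metric.diff\<close>)+

lemma local_metric_pullback:
  fixes T :: "'e::euclidean_space \<Rightarrow> 'f::euclidean_space"
  assumes "local_metric S' G'" "open U" "smooth_on U T" "T ` U \<subseteq> S'"
    and inj: "\<And>x v. x \<in> U \<Longrightarrow> FD T x v = 0 \<Longrightarrow> v = 0"
    and eq: "\<And>x v w. x \<in> U \<Longrightarrow> G x v w = G' (T x) (FD T x v) (FD T x w)"
  shows "local_metric U G"
proof
  interpret G': local_metric S' G' by fact
  show "open U" by fact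
  fix x v w assume x: "x \<in> U"
  have Tx: "T x \<in> S'" using assms(4) x by blast
  have l: "linear (FD T x)"
    using linear_FD smooth_on_imp_differentiable assms(3) x by blast
  show "bilinear (G x)"
    unfolding bilinear_def
    by (intro allI conjI linearI)
      (simp_all add: eq[OF x] linear_add[OF l] linear_cmul[OF l] G'.G_simps[OF Tx])
  show "G x v w = G x w v"
    using G'.sym[OF Tx] by (simp add: eq[OF x])
  show "G x v v > 0" if "v \<noteq> 0"
    using that G'.pos[OF Tx] inj[OF x] by (auto simp: eq[OF x])
  have "((\<lambda>y. FD T y u) has_derivative FD (\<lambda>y. FD T y u) x) (at x)" for u
    using has_derivative_FD smooth_on_imp_differentiable smooth_on_FD assms(3) x by blast
  then have "(\<lambda>y. G' (T y) (FD T y v) (FD T y w)) differentiable (at x)"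
    using G'.has_derivative_G_compose[OF assms(2) x assms(4)]
      has_derivative_FD[OF smooth_on_imp_differentiable[OF assms(3) x]]
    unfolding differentiable_def by blast
  then show "(\<lambda>y. G y v w) differentiable (at x)"
    unfolding differentiable_def
    using has_derivative_transform_within_open[OF _ assms(2) x, of _ _ _ "\<lambda>y. G y v w"] by (simp add: eq) blast
qed

text \<open>The inhomogeneous term is the reason why second derivatives have to be symmetric.\<close>

lemma local_christoffel_transform:
  fixes T :: "'e::euclidean_space \<Rightarrow> 'e"
  assumes "local_metric S G" "local_metric S' G'" "open U" "U \<subseteq> S" "smooth_on U T" "T ` U \<subseteq> S'"
    and eq: "\<And>x v w. x \<in> U \<Longrightarrow> G x v w = G' (T x) (FD T x v) (FD T x w)"
    and x: "x \<in> U" and surj: "surj (FD T x)"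
  shows "FD T x (local_christoffel G x a b) = local_christoffel G' (T x) (FD T x a) (FD T x b) + FD2 T x a b"
proof -
  interpret G: local_metric S G by fact
  interpret G': local_metric S' G' by fact
  have xS: "x \<in> S" and Tx: "T x \<in> S'" using assms x by auto
  have dT: "(T has_derivative FD T x) (at x)"
    using has_derivative_FD smooth_on_imp_differentiable assms(5) x by blast
  have dd: "((\<lambda>y. FD T y u) has_derivative FD (\<lambda>y. FD T y u) x) (at x)" for u
    using has_derivative_FD smooth_on_imp_differentiable smooth_on_FD assms(5) x by blast
  have DG: "FD (\<lambda>y. G y v w) x z = FD (\<lambda>y. G' y (FD T x v) (FD T x w)) (T x) (FD T x z)
     + G' (T x) (FD2 T x z v) (FD T x w) + G' (T x) (FD T x v) (FD2 T x z w)" for v w z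
    using FD_eqI[OF has_derivative_transform_within_open[OF G'.has_derivative_G_compose
        [OF assms(3) x assms(6) dT dd[of v] dd[of w]] assms(3) x eq[symmetric]]] by simp
  have s: "FD2 T x v w = FD2 T x w v" for v w
    using second_derivative_symmetric assms(3,5) x by blast
  \<comment> \<open>Solved for the symbols of \<open>G'\<close>, where the uniqueness lemma applies;
    as \<open>FD T x\<close> is onto, test vectors of the form \<open>FD T x y\<close>
    suffice.\<close>
  have "FD T x (local_christoffel G x a b) - FD2 T x a b = local_christoffel G' (T x) (FD T x a) (FD T x b)"
  proof (rule G'.local_christoffel_unique[OF Tx, symmetric])
    fix z
    obtain y where y: "z = FD T x y" using surj by (metis surjD)
    have 1: "G' (T x) (FD T x (local_christoffel G x a b)) (FD T x y)
      = (FD (\<lambda>x. G x b y) x a + FD (\<lambda>x. G x a y) x b - FD (\<lambda>y. G y a b) x y) / 2"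
      using eq[OF x] G.local_christoffel_eq[OF xS] by metis
    \<comment> \<open>The facts \<open>2\<close> and \<open>3\<close> bring the six second-order
      terms of the Koszul formula to a common form, in which all cancel but the two that contain
      \<open>FD2 T x a b\<close>.\<close>
    have 2: "G' (T x) (FD T x w) (FD2 T x u v) = G' (T x) (FD2 T x v u) (FD T x w)" for u v w
      using G'.sym[OF Tx] s by metis
    have 3: "G' (T x) (FD2 T x b a) v = G' (T x) (FD2 T x a b) v"
       "G' (T x) (FD2 T x y a) v = G' (T x) (FD2 T x a y) v"
       "G' (T x) (FD2 T x y b) v = G' (T x) (FD2 T x b y) v" for v
      using s by metis+
    show "G' (T x) (FD T x (local_christoffel G x a b) - FD2 T x a b) z =
       (FD (\<lambda>y. G' y (FD T x b) z) (T x) (FD T x a) + FD (\<lambda>y. G' y (FD T x a) z) (T x) (FD T x b)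
         - FD (\<lambda>y. G' y (FD T x a) (FD T x b)) (T x) z) / 2"
      unfolding y G'.G_simps[OF Tx] 1 DG 2 by (simp add: 3 field_simps)
  qed
  then show ?thesis by (simp add: algebra_simps)
qed

section \<open>The Sasaki metric in coordinates\<close>

lemma FD_zero_on:
  assumes "open S" "x \<in> S" "\<And>y. y \<in> S \<Longrightarrow> f y = 0"
  shows "FD f x a = 0"
proof -
  have "(f has_derivative (\<lambda>a. 0)) (at x)"
    by (rule has_derivative_transform_within_open[OF has_derivative_const assms(1,2)]) (simp add: assms(3))
  then show ?thesis by (simp add: FD_eqI)
qed

text \<open>Here \<open>p = (x, v)\<close> are induced coordinates on the tangent bundle. The
  projection of \<open>q\<close> is \<open>fst q\<close>, and \<open>snd q\<close> plus the
  Christoffel term is the image of \<open>q\<close> under the connection map.\<close>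

definition sasaki_local ::
  "('e::euclidean_space \<Rightarrow> 'e \<Rightarrow> 'e \<Rightarrow> real) \<Rightarrow> 'e \<times> 'e \<Rightarrow> 'e \<times> 'e \<Rightarrow> 'e \<times> 'e \<Rightarrow> real" where
  "sasaki_local G p q q' = G (fst p) (fst q) (fst q')
     + G (fst p) (snd q + local_christoffel G (fst p) (snd p) (fst q)) (snd q' + local_christoffel G (fst p) (snd p) (fst q'))"

text \<open>One derivative more than in \<open>local_metric\<close>: it makes the Christoffel
  symbols differentiable and so lets \<open>sasaki_local G\<close> be a \<open>local_metric\<close>
  in turn.\<close>

locale c2_metric = local_metric +
  assumes DD: "x \<in> S \<Longrightarrow> (\<lambda>y. FD (\<lambda>z. G z v w) y a) differentiable (at x)"
begin

lemma has_derivative_local_christoffel_compose: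
  fixes T :: "'b::real_normed_vector \<Rightarrow> 'a"
  assumes "open U" "x \<in> U" "T ` U \<subseteq> S" and "(T has_derivative T') (at x)"
    and "(V has_derivative V') (at x)" and "(W has_derivative W') (at x)"
  shows "((\<lambda>y. local_christoffel G (T y) (V y) (W y)) has_derivative
     (\<lambda>a. FD (\<lambda>y. local_christoffel G y (V x) (W x)) (T x) (T' a) + local_christoffel G (T x) (V' a) (W x)
        + local_christoffel G (T x) (V x) (W' a))) (at x)"
  by (rule has_derivative_bilinear_family[OF open_S assms bilinear_local_christoffel])
    (auto intro: differentiable_local_christoffel DD)

lemma local_christoffel_simps:
  assumes "x \<in> S"
  shows "local_christoffel G x (u + v) w = local_christoffel G x u w + local_christoffel G x v w"
    "local_christoffel G x u (v + w) = local_christoffel G x u v + local_christoffel G x u w"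
    "local_christoffel G x (r *\<^sub>R u) w = r *\<^sub>R local_christoffel G x u w" "local_christoffel G x u (r *\<^sub>R w) = r *\<^sub>R local_christoffel G x u w"
    "local_christoffel G x 0 w = 0" "local_christoffel G x u 0 = 0"
  using bilinear_local_christoffel[OF assms]
  by (simp_all add: bilinear_ladd bilinear_radd bilinear_lmul bilinear_rmul bilinear_lzero bilinear_rzero)

lemma local_metric_sasaki: "local_metric (S \<times> UNIV) (sasaki_local G)"
proof
  show o: "open (S \<times> (UNIV::'a set))"
    using open_S by (simp add: open_Times)
  fix p v w :: "'a \<times> 'a" assume p: "p \<in> S \<times> UNIV"
  then have x: "fst p \<in> S" by auto
  note s = sasaki_local_def G_simps[OF x] local_christoffel_simps[OF x]
  show "bilinear (sasaki_local G p)"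
    unfolding bilinear_def by (intro conjI allI linearI) (simp_all add: s algebra_simps)
  show "sasaki_local G p v w = sasaki_local G p w v"
    unfolding sasaki_local_def using sym[OF x] by presburger
  show "sasaki_local G p v v > 0" if "v \<noteq> 0"
  \<comment> \<open>If \<open>v\<close> is vertical, the Christoffel term drops out and
    \<open>G\<close> measures \<open>snd v\<close>; otherwise the first summand is already
    positive.\<close>
  proof (cases "fst v = 0")
    case True
    then have "snd v \<noteq> 0" using that by (simp add: prod_eq_iff)
    then show ?thesis using True pos[OF x] by (simp add: s)
  next
    case False
    have "G (fst p) u u \<ge> 0" for u
      using pos[OF x, of u] G_simps(7)[OF x] by (cases "u = 0") auto
    then show ?thesis
      unfolding sasaki_local_def using pos[OF x False] by (simp add: add_pos_nonneg)
  qed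
  have i: "fst ` (S \<times> (UNIV::'a set)) \<subseteq> S" by auto
  note f = has_derivative_fst[OF has_derivative_ident] and sn = has_derivative_snd[OF has_derivative_ident]
  have "((\<lambda>y. snd q + local_christoffel G (fst y) (snd y) (fst q)) has_derivative
     (\<lambda>a. 0 + (FD (\<lambda>y. local_christoffel G y (snd p) (fst q)) (fst p) (fst a) + local_christoffel G (fst p) (snd a) (fst q)
        + local_christoffel G (fst p) (snd p) 0))) (at p)" for q
    by (rule has_derivative_add[OF has_derivative_const
          has_derivative_local_christoffel_compose[OF o p i f sn has_derivative_const]])
  from has_derivative_add[OF
      has_derivative_G_compose[OF o p i f has_derivative_const has_derivative_const]
      has_derivative_G_compose[OF o p i f this this]]
  show "(\<lambda>y. sasaki_local G y v w) differentiable (at p)"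
    unfolding differentiable_def sasaki_local_def by blast
qed

text \<open>Coordinates on the tangent bundle are translated by a field \<open>\<xi>\<close>, which becomes the zero section,
  where every term of \<open>Gm\<close> that contains a Christoffel symbol vanishes together with its relevant
  derivatives if \<open>\<xi>\<close> is parallel along \<open>V\<close>.\<close>

lemma local_christoffel_sasaki_translated:
  assumes Gm: "local_metric (S \<times> UNIV) Gm"
    and \<xi>: "smooth_on S \<xi>"
    and parallel: "\<And>x a. x \<in> S \<Longrightarrow> a \<in> V \<Longrightarrow> FD \<xi> x a + local_christoffel G x a (\<xi> x) = 0"
    and geodesic: "\<And>x a b. x \<in> S \<Longrightarrow> a \<in> V \<Longrightarrow> b \<in> V \<Longrightarrow> local_christoffel G x a b \<in> V"
    and eq: "\<And>p q q'. p \<in> S \<times> UNIV \<Longrightarrow> Gm p q q' = sasaki_local G (fst p, snd p + \<xi> (fst p))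
        (fst q, snd q + FD \<xi> (fst p) (fst q)) (fst q', snd q' + FD \<xi> (fst p) (fst q'))"
    and x: "x \<in> S" and ab: "a \<in> V" "b \<in> V"
  shows "local_christoffel Gm (x, 0) (a, 0) (b, 0) = (local_christoffel G x a b, 0)"
proof -
  interpret Gm: local_metric "S \<times> UNIV" Gm by fact
  \<comment> \<open>The connection map in the translated coordinates, as a function of the point
    \<open>p\<close> for fixed \<open>q\<close>.\<close>
  define H where "H q p = snd q + FD \<xi> (fst p) (fst q) + local_christoffel G (fst p) (snd p + \<xi> (fst p)) (fst q)"
    for q p
  have o: "open (S \<times> (UNIV::'a set))"
    using open_S by (simp add: open_Times)
  have p0: "(x, 0) \<in> S \<times> (UNIV::'a set)" using x by simp
  have i: "fst ` (S \<times> (UNIV::'a set)) \<subseteq> S" by auto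
  note f = has_derivative_fst[OF has_derivative_ident] and sn = has_derivative_snd[OF has_derivative_ident]
  \<comment> \<open>For \<open>c\<close> in \<open>V\<close> parallelism cancels every contribution
    of \<open>\<xi>\<close>; the rest is linear in the fibre coordinate, hence zero where that
    coordinate is zero.\<close>
  have H0: "H (c, 0) p = local_christoffel G (fst p) (snd p) c" if "p \<in> S \<times> UNIV" "c \<in> V" for p c
  proof -
    have y: "fst p \<in> S" using that by auto
    have "FD \<xi> (fst p) c = - local_christoffel G (fst p) (\<xi> (fst p)) c"
      using parallel[OF y that(2)] local_christoffel_sym[OF y] by (metis add_eq_0_iff2)
    then show ?thesis
      by (simp add: H_def local_christoffel_simps[OF y])
  qed
  have Gm_eq: "Gm p (c, 0) q = G (fst p) c (fst q) + G (fst p) (local_christoffel G (fst p) (snd p) c) (H q p)"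
    if "p \<in> S \<times> UNIV" "c \<in> V" for p c q
    using H0[OF that] eq[OF that(1), of "(c, 0)" q] by (simp add: sasaki_local_def H_def)
  \<comment> \<open>The factor \<open>local_christoffel G (fst p) (snd p) c\<close> is zero at
    \<open>(x, 0)\<close>, so the product rule keeps only its derivative times the value of
    \<open>H q\<close>. The derivative of \<open>H q\<close> has to exist but never has to be
    known.\<close>
  have Gm_deriv: "FD (\<lambda>p. Gm p (c, 0) q) (x, 0) r
      = FD (\<lambda>y. G y c (fst q)) x (fst r) + G x (local_christoffel G x (snd r) c) (H q (x, 0))"
    if c: "c \<in> V" for c q r
  proof -
    have d1: "((\<lambda>p. local_christoffel G (fst p) (snd p) c) has_derivative (\<lambda>r. local_christoffel G x (snd r) c)) (at (x, 0))"
      using has_derivative_local_christoffel_compose[OF o p0 i f sn has_derivative_const[of c]]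
        FD_zero_on[OF open_S x local_christoffel_simps(5)] by (simp add: local_christoffel_simps[OF x])
    have "\<exists>H'. (H q has_derivative H') (at (x, 0))"
    proof -
      have xi: "(\<xi> has_derivative FD \<xi> x) (at (fst (x, 0::'a)))"
        using has_derivative_FD smooth_on_imp_differentiable[OF \<xi> x] by simp
      have dxi: "((\<lambda>y. FD \<xi> y (fst q)) has_derivative FD (\<lambda>y. FD \<xi> y (fst q)) x) (at (fst (x, 0::'a)))"
        using has_derivative_FD[OF smooth_on_imp_differentiable[OF smooth_on_FD[OF \<xi>] x]] by simp
      from has_derivative_add[OF has_derivative_add[OF has_derivative_const
            has_derivative_compose[OF f dxi]]
          has_derivative_local_christoffel_compose[OF o p0 i f has_derivative_add[OF sn
              has_derivative_compose[OF f xi]] has_derivative_const]]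
      show ?thesis unfolding H_def by blast
    qed
    then obtain H' where dH: "(H q has_derivative H') (at (x, 0))" by blast
    have Z: "FD (\<lambda>y. G y 0 w) x u = 0" for w u
      by (rule FD_zero_on[OF open_S x]) (rule G_simps(7))
    have "((\<lambda>p. G (fst p) (local_christoffel G (fst p) (snd p) c) (H q p)) has_derivative
        (\<lambda>r. G x (local_christoffel G x (snd r) c) (H q (x, 0)))) (at (x, 0))"
      using has_derivative_G_compose[OF o p0 i f d1 dH]
      by (simp add: Z local_christoffel_simps(5)[OF x] G_simps(7)[OF x])
    moreover have "((\<lambda>p. G (fst p) c (fst q)) has_derivative (\<lambda>r. FD (\<lambda>y. G y c (fst q)) x (fst r))) (at (x, 0::'a))"
      using has_derivative_G_compose[OF o p0 i f has_derivative_const[of c] has_derivative_const[of "fst q"]]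
      by (simp add: G_simps[OF x])
    ultimately have "((\<lambda>p. G (fst p) c (fst q) + G (fst p) (local_christoffel G (fst p) (snd p) c) (H q p)) has_derivative
      (\<lambda>r. FD (\<lambda>y. G y c (fst q)) x (fst r) + G x (local_christoffel G x (snd r) c) (H q (x, 0)))) (at (x, 0))"
      using has_derivative_add by blast
    from has_derivative_transform_within_open[OF this o p0] have
      "((\<lambda>p. Gm p (c, 0) q) has_derivative
        (\<lambda>r. FD (\<lambda>y. G y c (fst q)) x (fst r) + G x (local_christoffel G x (snd r) c) (H q (x, 0)))) (at (x, 0))"
      using Gm_eq c by simp
    then show ?thesis by (simp add: FD_eqI)
  qed
  show ?thesis
  proof (rule Gm.local_christoffel_unique[OF p0])
    fix z
    have "Gm (x, 0) (local_christoffel G x a b, 0) z = G x (local_christoffel G x a b) (fst z)"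
      using Gm_eq[OF p0 geodesic[OF x ab]] by (simp add: local_christoffel_simps[OF x] G_simps[OF x])
    \<comment> \<open>In the first two derivatives the direction has fibre part zero; in the third
      \<open>H (b, 0)\<close> vanishes at \<open>(x, 0)\<close>. What remains is the Koszul formula
      of \<open>G\<close> for \<open>a\<close>, \<open>b\<close> and \<open>fst z\<close>.\<close>
    then show "Gm (x, 0) (local_christoffel G x a b, 0) z
        = (FD (\<lambda>y. Gm y (b, 0) z) (x, 0) (a, 0) + FD (\<lambda>y. Gm y (a, 0) z) (x, 0) (b, 0)
           - FD (\<lambda>y. Gm y (a, 0) (b, 0)) (x, 0) z) / 2"
      using H0[OF p0 ab(2)] ab
      by (simp add: Gm_deriv local_christoffel_eq[OF x] local_christoffel_simps[OF x] G_simps[OF x])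
  qed
qed

text \<open>In a foliated chart the vectors tangent to the leaves are those with
  \<open>b \<bullet> e = 0\<close>, the same at every point, so a constant \<open>b\<close> extends
  a tangent vector to a tangent field.\<close>

lemma normal_field_parallel:
  assumes \<xi>: "\<And>y. y \<in> S \<Longrightarrow> \<xi> differentiable (at y)"
    and len: "\<And>y. y \<in> S \<Longrightarrow> G y (\<xi> y) (\<xi> y) = l"
    and normal: "\<And>y b. y \<in> S \<Longrightarrow> b \<bullet> e = 0 \<Longrightarrow> G y (\<xi> y) b = 0"
    and geodesic: "\<And>y a b. y \<in> S \<Longrightarrow> a \<bullet> e = 0 \<Longrightarrow> b \<bullet> e = 0 \<Longrightarrow> local_christoffel G y a b \<bullet> e = 0"
    and e: "e \<noteq> 0" and x: "x \<in> S" and a: "a \<bullet> e = 0"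
  shows "FD \<xi> x a + local_christoffel G x a (\<xi> x) = 0"
\<comment> \<open>\<open>l\<close> is the squared length. If it is zero, \<open>\<xi>\<close>
  vanishes identically and does not complement the hyperplane.\<close>
proof (cases "l = 0")
  case True
  then have "\<xi> y = 0" if "y \<in> S" for y
    using len[OF that] pos[OF that, of "\<xi> y"] by fastforce
  then show ?thesis
    using FD_zero_on[OF open_S x, of \<xi>] x by (simp add: local_christoffel_simps)
next
  case False
  define z where "z = FD \<xi> x a + local_christoffel G x a (\<xi> x)"
  have d: "(\<xi> has_derivative FD \<xi> x) (at x)"
    using has_derivative_FD \<xi> x by blast
  have "G x z (\<xi> x) + G x (\<xi> x) z = 0"
  proof -
    have "((\<lambda>y. G y (\<xi> y) (\<xi> y)) has_derivative (\<lambda>a. 0)) (at x)"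
      by (rule has_derivative_transform_within_open[OF has_derivative_const open_S x]) (simp add: len)
    from FD_eqI[OF this] FD_eqI[OF FD_covariant[OF x d d]] show ?thesis
      unfolding z_def by metis
  qed
  then have z\<xi>: "G x z (\<xi> x) = 0"
    using sym[OF x] by simp
  have zb: "G x z b = 0" if "b \<bullet> e = 0" for b
  proof -
    have "((\<lambda>y. G y (\<xi> y) b) has_derivative (\<lambda>a. 0)) (at x)"
      by (rule has_derivative_transform_within_open[OF has_derivative_const open_S x]) (simp add: normal that)
    from FD_eqI[OF this] FD_eqI[OF FD_covariant[OF x d has_derivative_const[of b]]]
    have "G x z b + G x (\<xi> x) (local_christoffel G x a b) = 0"
      unfolding z_def by (simp add: fun_eq_iff)
    then show ?thesis
      using normal[OF x geodesic[OF x a that]] by simp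
  qed
  \<comment> \<open>Otherwise \<open>\<xi> x\<close> would be tangent to the leaf and so orthogonal
    to itself.\<close>
  have \<xi>e: "\<xi> x \<bullet> e \<noteq> 0"
    using normal[OF x, of "\<xi> x"] len[OF x] False by auto
  \<comment> \<open>Splits \<open>z\<close> into a multiple of \<open>\<xi> x\<close> and a vector
    tangent to the leaf, both orthogonal to \<open>z\<close>.\<close>
  define r where "r = (z \<bullet> e) / (\<xi> x \<bullet> e)"
  have "(z - r *\<^sub>R \<xi> x) \<bullet> e = 0"
    using \<xi>e by (simp add: r_def inner_diff_left)
  from zb[OF this] have "G x z z = 0"
    using z\<xi> by (simp add: G_simps[OF x])
  then show ?thesis
    using pos[OF x, of z] z_def by fastforce
qed

end

section \<open>Atlases\<close>

lemma chart_inv_chart: "is_chart c \<Longrightarrow> p \<in> fst c \<Longrightarrow> chart_inv c (snd c p) = p"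
  by (simp add: is_chart_def chart_inv_def)

lemma transition_chart: "is_chart c \<Longrightarrow> p \<in> fst c \<Longrightarrow> transition c d (snd c p) = snd d p"
  by (simp add: transition_def chart_inv_chart)

lemma chart_image_Int:
  "is_chart c \<Longrightarrow> S \<subseteq> fst c \<Longrightarrow> T \<subseteq> fst c \<Longrightarrow> snd c ` (S \<inter> T) = snd c ` S \<inter> snd c ` T"
  unfolding is_chart_def using inj_on_image_Int by metis

lemma chart_image_mem:
  "is_chart c \<Longrightarrow> p \<in> fst c \<Longrightarrow> S \<subseteq> fst c \<Longrightarrow> snd c p \<in> snd c ` S \<longleftrightarrow> p \<in> S"
  unfolding is_chart_def using inj_on_image_mem_iff by metis

lemma chart_preimage:
  "is_chart c \<Longrightarrow> {p \<in> fst c. snd c p \<in> snd c ` (U \<inter> fst c)} = U \<inter> fst c"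
  unfolding is_chart_def inj_on_def by blast

text \<open>Free of maximality, so that the family of induced charts on the tangent bundle is an
  instance as well as the maximal atlases \<open>A\<close> and \<open>TM A\<close>.\<close>

locale atlas =
  fixes A :: "('a, 'e::euclidean_space) chart set"
  assumes charts: "c \<in> A \<Longrightarrow> is_chart c"
    and compat: "c \<in> A \<Longrightarrow> d \<in> A \<Longrightarrow> compatible c d"
begin

lemma open_overlap: "c \<in> A \<Longrightarrow> d \<in> A \<Longrightarrow> open (snd c ` (fst c \<inter> fst d))"
  using compat[of c d] by (simp add: compatible_def)

lemma open_image: "c \<in> A \<Longrightarrow> open (snd c ` fst c)"
  using charts[of c] by (simp add: is_chart_def)

lemma smooth_transition: "c \<in> A \<Longrightarrow> d \<in> A \<Longrightarrow> smooth_on (snd c ` (fst c \<inter> fst d)) (transition c d)"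
  using compat[of c d] by (simp add: compatible_def)

lemma transition_image:
  assumes "c \<in> A" "d \<in> A"
  shows "transition c d ` (snd c ` (fst c \<inter> fst d)) = snd d ` (fst c \<inter> fst d)"
  unfolding image_image by (rule image_cong) (use transition_chart[OF charts[OF assms(1)]] in auto)

lemma differentiable_transition:
  "c \<in> A \<Longrightarrow> d \<in> A \<Longrightarrow> p \<in> fst c \<Longrightarrow> p \<in> fst d \<Longrightarrow> transition c d differentiable (at (snd c p))"
  using smooth_on_imp_differentiable[OF smooth_transition[of c d]] by blast

lemma FD_cocycle:
  assumes "c \<in> A" "d \<in> A" "e \<in> A" "p \<in> fst c" "p \<in> fst d" "p \<in> fst e"
  shows "FD (transition d e) (snd d p) (FD (transition c d) (snd c p) v) = FD (transition c e) (snd c p) v"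
proof -
  let ?U = "snd c ` (fst c \<inter> fst d) \<inter> snd c ` (fst c \<inter> fst e)"
  have U: "open ?U" "snd c p \<in> ?U"
    using open_Int[OF open_overlap open_overlap] assms by auto
  have 1: "(transition c d has_derivative FD (transition c d) (snd c p)) (at (snd c p))"
    using has_derivative_FD differentiable_transition assms by blast
  have "(transition d e has_derivative FD (transition d e) (snd d p)) (at (transition c d (snd c p)))"
    using has_derivative_FD[OF differentiable_transition[OF assms(2,3,5,6)]]
    by (simp add: transition_chart charts assms)
  from has_derivative_compose[OF 1 this]
  have "((\<lambda>x. transition d e (transition c d x)) has_derivative
      (\<lambda>v. FD (transition d e) (snd d p) (FD (transition c d) (snd c p) v))) (at (snd c p))"
    .
  moreover have "transition d e (transition c d x) = transition c e x" if "x \<in> ?U" for x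
  proof -
    obtain q where q: "q \<in> fst c" "q \<in> fst d" "x = snd c q"
      using \<open>x \<in> ?U\<close> by auto
    then show ?thesis
      using assms by (simp add: transition_chart charts)
  qed
  ultimately have "(transition c e has_derivative
      (\<lambda>v. FD (transition d e) (snd d p) (FD (transition c d) (snd c p) v))) (at (snd c p))"
    using has_derivative_transform_within_open U by blast
  then show ?thesis by (simp add: FD_eqI)
qed

lemma FD_transition_self:
  assumes "c \<in> A" "p \<in> fst c" shows "FD (transition c c) (snd c p) v = v"
proof -
  have "(transition c c has_derivative (\<lambda>v. v)) (at (snd c p))"
    by (rule has_derivative_transform_within_open[OF has_derivative_ident open_image[OF assms(1)]])
      (use assms in \<open>auto simp: transition_chart charts\<close>)
  then show ?thesis by (simp add: FD_eqI)
qed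

lemma FD_transition_inverse:
  assumes "c \<in> A" "d \<in> A" "p \<in> fst c" "p \<in> fst d"
  shows "FD (transition d c) (snd d p) (FD (transition c d) (snd c p) v) = v"
  using FD_cocycle[OF assms(1,2,1,3,4,3)] FD_transition_self[OF assms(1,3)] by simp

text \<open>Sets passing the test in every chart are closed under the operations that generate
  \<open>mtop A\<close>, and the generators pass it because transitions are continuous.\<close>

lemma openin_mtop_iff:
  "openin (mtop A) U \<longleftrightarrow> U \<subseteq> points A \<and> (\<forall>c\<in>A. open (snd c ` (U \<inter> fst c)))"
  (is "_ \<longleftrightarrow> ?good U")
proof
  assume "openin (mtop A) U"
  then have "generate_topology_on {{p \<in> fst c. snd c p \<in> Q} | c Q. c \<in> A \<and> open Q} U"
    by (simp add: mtop_def openin_topology_generated_by_iff)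
  then show "?good U"
  proof induction
    case (Int U V)
    have "snd c ` (U \<inter> V \<inter> fst c) = snd c ` (U \<inter> fst c) \<inter> snd c ` (V \<inter> fst c)" if "c \<in> A" for c
      using chart_image_Int[OF charts[OF that], of "U \<inter> fst c" "V \<inter> fst c"]
      by (simp add: Int_assoc Int_left_commute)
    then show ?case using Int.IH by auto
  next
    case (UN K)
    have "snd c ` (\<Union>K \<inter> fst c) = (\<Union>k\<in>K. snd c ` (k \<inter> fst c))" for c :: "('a, 'e) chart"
      by blast
    then have "open (snd c ` (\<Union>K \<inter> fst c))" if "c \<in> A" for c
      using UN.IH that by auto
    then show ?case using UN.IH by blast
  next
    case (Basis U)
    then obtain d Q where d: "d \<in> A" "open Q" "U = {p \<in> fst d. snd d p \<in> Q}" by blast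
    have "open (snd c ` (U \<inter> fst c))" if c: "c \<in> A" for c
    proof -
      have "snd c ` (U \<inter> fst c) = snd c ` (fst c \<inter> fst d) \<inter> transition c d -` Q"
        using d by (auto simp: transition_chart charts c)
      moreover have "open (transition c d -` Q \<inter> snd c ` (fst c \<inter> fst d))"
        using open_overlap[OF c d(1)] smooth_on_imp_continuous_on[OF smooth_transition[OF c d(1)]]
          d(2) continuous_on_open_vimage by blast
      ultimately show ?thesis by (simp add: Int_commute)
    qed
    moreover have "U \<subseteq> points A"
      using d by (auto simp: points_def)
    ultimately show ?case by blast
  qed auto
next
  assume U: "?good U"
  have "openin (mtop A) (U \<inter> fst c)" if c: "c \<in> A" for c
  proof -
    have "openin (mtop A) {p \<in> fst c. snd c p \<in> snd c ` (U \<inter> fst c)}"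
      unfolding mtop_def by (rule topology_generated_by_Basis) (use c U in blast)
    then show ?thesis
      by (simp add: chart_preimage[OF charts[OF c]])
  qed
  then have "openin (mtop A) (\<Union>c\<in>A. U \<inter> fst c)"
    by blast
  moreover have "U = (\<Union>c\<in>A. U \<inter> fst c)"
    using U by (auto simp: points_def)
  ultimately show "openin (mtop A) U" by simp
qed

text \<open>One chart around each point is enough. On the tangent bundle this lets induced charts
  stand for the whole maximal atlas.\<close>

lemma openin_mtopI:
  assumes "\<And>p. p \<in> U \<Longrightarrow> \<exists>c\<in>A. p \<in> fst c \<and> open (snd c ` (U \<inter> fst c))"
  shows "openin (mtop A) U"
proof -
  have "openin (mtop A) (U \<inter> fst c)" if c: "c \<in> A" and o: "open (snd c ` (U \<inter> fst c))" for c
  proof -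
    have "U \<inter> fst c = {p \<in> fst c. snd c p \<in> snd c ` (U \<inter> fst c)}"
      using chart_preimage[OF charts[OF c]] by blast
    moreover have "openin (mtop A) {p \<in> fst c. snd c p \<in> snd c ` (U \<inter> fst c)}"
      unfolding mtop_def by (rule topology_generated_by_Basis) (use c o in blast)
    ultimately show ?thesis by simp
  qed
  then show ?thesis
    by (subst openin_subopen) (metis IntI assms inf_le1)
qed

lemma topspace_mtop: "topspace (mtop A) = points A"
proof
  show "topspace (mtop A) \<subseteq> points A"
    using openin_topspace openin_mtop_iff by blast
  have "openin (mtop A) (points A)"
  proof (rule openin_mtopI)
    fix p assume "p \<in> points A"
    then obtain c where c: "c \<in> A" "p \<in> fst c" by (auto simp: points_def)
    then have "points A \<inter> fst c = fst c" by (auto simp: points_def)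
    then show "\<exists>c\<in>A. p \<in> fst c \<and> open (snd c ` (points A \<inter> fst c))"
      using c open_image by auto
  qed
  then show "points A \<subseteq> topspace (mtop A)"
    using openin_subset by blast
qed

lemma openin_chart: "c \<in> A \<Longrightarrow> openin (mtop A) (fst c)"
  unfolding openin_mtop_iff using open_overlap by (auto simp: points_def Int_commute)

text \<open>Near each point the transition factors through some chart \<open>e\<close> of
  \<open>A\<close>. Both claims are local, so this proves them; the other half of
  \<open>compatible\<close> follows by exchanging \<open>c\<close> and \<open>d\<close>.\<close>

lemma compatible_half:
  assumes c: "is_chart c" "fst c \<subseteq> points A" "\<And>e. e \<in> A \<Longrightarrow> compatible c e"
    and d: "is_chart d" "\<And>e. e \<in> A \<Longrightarrow> compatible d e"
  shows "open (snd c ` (fst c \<inter> fst d)) \<and> smooth_on (snd c ` (fst c \<inter> fst d)) (transition c d)"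
proof -
  have loc: "\<exists>U. open U \<and> x \<in> U \<and> U \<subseteq> snd c ` (fst c \<inter> fst d) \<and> smooth_on U (transition c d)"
    if x: "x \<in> snd c ` (fst c \<inter> fst d)" for x
  proof -
    obtain p where p: "p \<in> fst c" "p \<in> fst d" "x = snd c p" using x by auto
    then obtain e where e: "e \<in> A" "p \<in> fst e" using c(2) by (auto simp: points_def)
    let ?ce = "snd c ` (fst c \<inter> fst e)" and ?ed = "snd e ` (fst d \<inter> fst e)"
    have ce: "open ?ce" "smooth_on ?ce (transition c e)"
      using c(3)[OF e(1)] by (auto simp: compatible_def)
    have ed: "open ?ed" "smooth_on ?ed (transition e d)"
      using d(2)[OF e(1)] by (auto simp: compatible_def Int_commute)
    let ?U = "transition c e -` ?ed \<inter> ?ce"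
    have oU: "open ?U"
      using continuous_on_open_vimage[OF ce(1)] smooth_on_imp_continuous_on[OF ce(2)] ed(1) by blast
    have U: "\<exists>q \<in> fst c \<inter> fst d \<inter> fst e. y = snd c q" if "y \<in> ?U" for y
    proof -
      obtain q where q: "q \<in> fst c" "q \<in> fst e" "y = snd c q" using \<open>y \<in> ?U\<close> by auto
      then have "snd e q \<in> ?ed"
        using \<open>y \<in> ?U\<close> by (simp add: transition_chart c(1))
      then have "q \<in> fst d"
        using chart_image_mem[OF charts[OF e(1)] q(2), of "fst d \<inter> fst e"] by auto
      then show ?thesis using q by blast
    qed
    have "smooth_on ?U (\<lambda>y. transition e d (transition c e y))"
      by (rule smooth_on_compose[OF oU ed(1) _ ed(2) smooth_on_subset[OF ce(2)]]) auto
    moreover have "transition e d (transition c e y) = transition c d y" if "y \<in> ?U" for y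
      using U[OF that] by (auto simp: transition_chart c(1) charts e(1))
    ultimately have "smooth_on ?U (transition c d)"
      by (rule smooth_on_cong[OF oU, rotated])
    moreover have "x \<in> ?U"
      using p e by (auto simp: transition_chart c(1))
    moreover have "?U \<subseteq> snd c ` (fst c \<inter> fst d)"
      using U by blast
    ultimately show ?thesis using oU by blast
  qed
  show ?thesis
  proof
    show "open (snd c ` (fst c \<inter> fst d))"
      using loc by (subst open_subopen) blast
    show "smooth_on (snd c ` (fst c \<inter> fst d)) (transition c d)"
      using loc by (intro smooth_on_local) blast
  qed
qed

lemma atlas_maximal_atlas: "atlas (maximal_atlas A)"
proof
  show "is_chart c" if "c \<in> maximal_atlas A" for c
    using that by (simp add: maximal_atlas_def)
  show "compatible c d" if "c \<in> maximal_atlas A" "d \<in> maximal_atlas A" for c d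
  proof -
    have c: "is_chart c" "fst c \<subseteq> points A" "\<And>e. e \<in> A \<Longrightarrow> compatible c e"
      and d: "is_chart d" "fst d \<subseteq> points A" "\<And>e. e \<in> A \<Longrightarrow> compatible d e"
      using that by (auto simp: maximal_atlas_def)
    show ?thesis
      using compatible_half[OF c d(1,3)] compatible_half[OF d c(1,3)]
      by (simp add: compatible_def Int_commute)
  qed
qed

lemma subset_maximal_atlas: "A \<subseteq> maximal_atlas A"
  using charts compat by (auto simp: maximal_atlas_def points_def)

lemma points_maximal_atlas: "points (maximal_atlas A) = points A"
  using subset_maximal_atlas by (auto simp: maximal_atlas_def points_def)

text \<open>A change of coordinates by a diffeomorphism of the chart image, with smooth inverse
  \<open>\<psi>\<close>. It will be the translation of fibre coordinates by a vector field.\<close>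

lemma reparametrised_chart:
  assumes c: "c \<in> A" and \<phi>: "smooth_on (snd c ` fst c) \<phi>"
    and S: "open S" "\<phi> ` (snd c ` fst c) = S" and \<psi>: "smooth_on S \<psi>"
    and inv: "\<And>x. x \<in> snd c ` fst c \<Longrightarrow> \<psi> (\<phi> x) = x"
  shows "(fst c, \<lambda>p. \<phi> (snd c p)) \<in> maximal_atlas A"
proof -
  let ?c = "(fst c, \<lambda>p. \<phi> (snd c p))"
  have inj: "inj_on (snd c) (fst c)" using charts[OF c] by (simp add: is_chart_def)
  have ch: "is_chart ?c"
    unfolding is_chart_def
  proof
    show "inj_on (snd ?c) (fst ?c)"
      using inj inv by (auto simp: inj_on_def) (metis imageI)
    show "open (snd ?c ` fst ?c)"
      using S by (simp add: image_image)
  qed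
  have "compatible ?c d" if d: "d \<in> A" for d
  proof -
    let ?ov = "snd c ` (fst c \<inter> fst d)"
    have im: "snd ?c ` (fst ?c \<inter> fst d) = S \<inter> \<psi> -` ?ov"
    proof -
      have "\<phi> (snd c p) \<in> S" "\<psi> (\<phi> (snd c p)) = snd c p" if "p \<in> fst c" for p
        using S inv that by auto
      moreover have "y \<in> \<phi> ` ?ov" if "y \<in> S" "\<psi> y \<in> ?ov" for y
        using that S(2) inv by (metis image_iff)
      ultimately show ?thesis by (fastforce simp: image_image)
    qed
    have o: "open (S \<inter> \<psi> -` ?ov)"
      using continuous_on_open_vimage[OF S(1)] smooth_on_imp_continuous_on[OF \<psi>] open_overlap[OF c d]
      by (metis Int_commute)
    have "smooth_on (S \<inter> \<psi> -` ?ov) (\<lambda>y. transition c d (\<psi> y))"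
      by (rule smooth_on_compose[OF o open_overlap[OF c d] _ smooth_transition[OF c d]
            smooth_on_subset[OF \<psi>]]) auto
    moreover have "transition c d (\<psi> y) = transition ?c d y" if "y \<in> S \<inter> \<psi> -` ?ov" for y
    proof -
      have "y \<in> snd ?c ` (fst ?c \<inter> fst d)" unfolding im using that .
      then obtain p where "p \<in> fst c" "y = snd ?c p" by auto
      then show ?thesis
        using transition_chart[OF ch, of p d] inv by (simp add: transition_chart charts c)
    qed
    ultimately have 1: "smooth_on (S \<inter> \<psi> -` ?ov) (transition ?c d)"
      by (rule smooth_on_cong[OF o, rotated])
    have o': "open (snd d ` (fst c \<inter> fst d))"
      using open_overlap[OF d c] by (simp add: Int_commute)
    have 2: "smooth_on (snd d ` (fst c \<inter> fst d)) (transition d ?c)"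
    proof (rule smooth_on_cong[OF o'])
      show "smooth_on (snd d ` (fst c \<inter> fst d)) (\<lambda>x. \<phi> (transition d c x))"
        using transition_image[OF d c] smooth_transition[OF d c]
        by (intro smooth_on_compose[OF o' open_image[OF c] _ \<phi>]) (auto simp: Int_commute)
    qed (simp add: transition_def)
    show ?thesis
      unfolding compatible_def im using o 1 2 o' by simp
  qed
  then show ?thesis
    using ch c by (auto simp: maximal_atlas_def points_def)
qed

end

section \<open>The tangent bundle\<close>

context atlas
begin

lemma coord_vec_simps:
  assumes "c \<in> A" "p \<in> fst c"
  shows "fst (coord_vec A c (snd c p) v) = p"
    and "snd (coord_vec A c (snd c p) v) d
      = (if d \<in> A \<and> p \<in> fst d then FD (transition c d) (snd c p) v else 0)"
  using chart_inv_chart[OF charts] assms by (simp_all add: coord_vec_def)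

lemma coord_vec_self: "c \<in> A \<Longrightarrow> p \<in> fst c \<Longrightarrow> snd (coord_vec A c (snd c p) v) c = v"
  by (simp add: coord_vec_simps FD_transition_self)

lemma coord_vec_tangent_bundle:
  assumes "c \<in> A" "p \<in> fst c"
  shows "coord_vec A c (snd c p) v \<in> tangent_bundle A"
proof -
  have "p \<in> points A" using assms by (auto simp: points_def)
  then show ?thesis
    unfolding tangent_bundle_def
    by (simp add: case_prod_beta coord_vec_simps assms FD_cocycle[OF assms(1) _ _ assms(2)])
qed

lemma tangent_bundle_component:
  assumes "X \<in> tangent_bundle A" "c \<in> A" "d \<in> A" "fst X \<in> fst c" "fst X \<in> fst d"
  shows "snd X d = FD (transition c d) (snd c (fst X)) (snd X c)"
  using assms unfolding tangent_bundle_def case_prod_beta mem_Collect_eq by blast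

lemma tangent_bundle_chart:
  assumes "X \<in> tangent_bundle A"
  obtains c where "c \<in> A" "fst X \<in> fst c"
  using assms unfolding tangent_bundle_def case_prod_beta mem_Collect_eq points_def by blast

lemma coord_vec_component:
  assumes "X \<in> tangent_bundle A" "c \<in> A" "fst X \<in> fst c"
  shows "coord_vec A c (snd c (fst X)) (snd X c) = X"
proof (rule prod_eqI)
  show "snd (coord_vec A c (snd c (fst X)) (snd X c)) = snd X"
  proof
    fix d
    show "snd (coord_vec A c (snd c (fst X)) (snd X c)) d = snd X d"
    proof (cases "d \<in> A \<and> fst X \<in> fst d")
      case True
      then show ?thesis
        using tangent_bundle_component[OF assms(1,2) _ assms(3), of d] by (simp add: coord_vec_simps assms)
    next
      case False
      then have "snd X d = 0"
        using assms(1) unfolding tangent_bundle_def case_prod_beta mem_Collect_eq by blast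
      then show ?thesis using False by (auto simp: coord_vec_simps assms)
    qed
  qed
qed (simp add: coord_vec_simps assms)

lemma coord_vec_change:
  assumes "c \<in> A" "d \<in> A" "p \<in> fst c" "p \<in> fst d"
  shows "coord_vec A d (snd d p) (FD (transition c d) (snd c p) v) = coord_vec A c (snd c p) v"
  using coord_vec_component[OF coord_vec_tangent_bundle[OF assms(1,3), of v] assms(2)] assms
  by (simp add: coord_vec_simps)

section \<open>Induced charts of the tangent bundle\<close>

lemma lift_chart_simps:
  "fst (lift_chart A c) = {X \<in> tangent_bundle A. fst X \<in> fst c}"
  "snd (lift_chart A c) X = (snd c (fst X), snd X c)"
  by (simp_all add: lift_chart_def)

lemma lift_chart_image:
  assumes "c \<in> A" "T \<subseteq> fst c"
  shows "snd (lift_chart A c) ` {X \<in> tangent_bundle A. fst X \<in> T} = snd c ` T \<times> UNIV"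
proof (intro equalityI subsetI)
  fix z :: "'e \<times> 'e" assume "z \<in> snd c ` T \<times> UNIV"
  then obtain p v where z: "p \<in> T" "z = (snd c p, v)" by auto
  then have p: "p \<in> fst c" using assms by blast
  have "z = snd (lift_chart A c) (coord_vec A c (snd c p) v)"
    by (simp add: z lift_chart_simps coord_vec_simps(1) coord_vec_self assms(1) p)
  then show "z \<in> snd (lift_chart A c) ` {X \<in> tangent_bundle A. fst X \<in> T}"
    using coord_vec_tangent_bundle[OF assms(1) p] z by (auto simp: coord_vec_simps(1) assms(1) p)
qed (auto simp: lift_chart_simps)

lemma is_chart_lift_chart:
  assumes "c \<in> A" shows "is_chart (lift_chart A c)"
  unfolding is_chart_def
proof
  show "inj_on (snd (lift_chart A c)) (fst (lift_chart A c))"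
  proof (rule inj_onI)
    fix X Y assume X: "X \<in> fst (lift_chart A c)" and Y: "Y \<in> fst (lift_chart A c)"
      and eq: "snd (lift_chart A c) X = snd (lift_chart A c) Y"
    have "X = coord_vec A c (snd c (fst X)) (snd X c)"
      using X assms by (simp add: lift_chart_simps coord_vec_component)
    also have "\<dots> = coord_vec A c (snd c (fst Y)) (snd Y c)"
      using eq by (simp add: lift_chart_simps)
    also have "\<dots> = Y"
      using Y assms by (simp add: lift_chart_simps coord_vec_component)
    finally show "X = Y" .
  qed
  show "open (snd (lift_chart A c) ` fst (lift_chart A c))"
    using lift_chart_image[OF assms, of "fst c"] open_image[OF assms]
    by (simp add: lift_chart_simps open_Times)
qed

lemma chart_inv_lift_chart:
  assumes "c \<in> A" "x \<in> snd c ` fst c"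
  shows "chart_inv (lift_chart A c) (x, v) = coord_vec A c x v"
proof -
  obtain p where p: "p \<in> fst c" "x = snd c p" using assms by blast
  have "snd (lift_chart A c) (coord_vec A c x v) = (x, v)"
    by (simp add: p lift_chart_simps coord_vec_simps(1) coord_vec_self assms)
  moreover have "coord_vec A c x v \<in> fst (lift_chart A c)"
    by (simp add: p lift_chart_simps coord_vec_simps(1) coord_vec_tangent_bundle assms)
  ultimately show ?thesis
    using chart_inv_chart[OF is_chart_lift_chart[OF assms(1)]] by metis
qed

lemma lift_chart_overlap:
  assumes "c \<in> A"
  shows "snd (lift_chart A c) ` (fst (lift_chart A c) \<inter> fst (lift_chart A d))
    = snd c ` (fst c \<inter> fst d) \<times> UNIV"
proof -
  have "fst (lift_chart A c) \<inter> fst (lift_chart A d) = {X \<in> tangent_bundle A. fst X \<in> fst c \<inter> fst d}"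
    by (auto simp: lift_chart_simps)
  then show ?thesis
    using lift_chart_image[OF assms, of "fst c \<inter> fst d"] by simp
qed

lemma transition_lift_chart:
  assumes "c \<in> A" "d \<in> A" "x \<in> snd c ` (fst c \<inter> fst d)"
  shows "transition (lift_chart A c) (lift_chart A d) (x, v)
    = (transition c d x, FD (transition c d) x v)"
proof -
  obtain p where p: "p \<in> fst c" "p \<in> fst d" "x = snd c p" using assms by blast
  then have "transition (lift_chart A c) (lift_chart A d) (x, v)
    = snd (lift_chart A d) (coord_vec A c (snd c p) v)"
    by (simp add: transition_def chart_inv_lift_chart assms(1))
  then show ?thesis
    using p assms by (simp add: lift_chart_simps coord_vec_simps transition_chart charts)
qed

lemma smooth_transition_lift_chart:
  assumes "c \<in> A" "d \<in> A"
  shows "smooth_on (snd c ` (fst c \<inter> fst d) \<times> UNIV) (transition (lift_chart A c) (lift_chart A d))"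
proof -
  let ?S = "snd c ` (fst c \<inter> fst d)"
  have o: "open (?S \<times> (UNIV::'e set))"
    using open_overlap[OF assms] by (simp add: open_Times)
  have i: "fst ` (?S \<times> (UNIV::'e set)) \<subseteq> ?S" by auto
  have "smooth_on (?S \<times> UNIV) (\<lambda>p. (transition c d (fst p), FD (transition c d) (fst p) (snd p)))"
    by (rule smooth_on_Pair[OF o
          smooth_on_compose[OF o open_overlap[OF assms] i smooth_transition[OF assms]
            smooth_on_fst[OF o smooth_on_ident[OF o]]]
          smooth_on_FD_joint[OF open_overlap[OF assms] smooth_transition[OF assms]]])
  moreover have "(transition c d (fst p), FD (transition c d) (fst p) (snd p))
     = transition (lift_chart A c) (lift_chart A d) p" if "p \<in> ?S \<times> UNIV" for p
    using transition_lift_chart[OF assms, of "fst p" "snd p"] that by auto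
  ultimately show ?thesis
    by (rule smooth_on_cong[OF o, rotated])
qed

lemma atlas_lift_charts: "atlas (lift_chart A ` A)"
proof
  show "is_chart c" if "c \<in> lift_chart A ` A" for c
    using that is_chart_lift_chart by blast
  show "compatible c' d'" if cd': "c' \<in> lift_chart A ` A" "d' \<in> lift_chart A ` A" for c' d'
  proof -
    obtain c d where cd: "c \<in> A" "d \<in> A" "c' = lift_chart A c" "d' = lift_chart A d"
      using cd' by blast
    have "snd d' ` (fst c' \<inter> fst d') = snd d ` (fst c \<inter> fst d) \<times> UNIV"
      using lift_chart_overlap[OF cd(2), of c] cd by (simp add: Int_commute)
    moreover have "snd c' ` (fst c' \<inter> fst d') = snd c ` (fst c \<inter> fst d) \<times> UNIV"
      using lift_chart_overlap[OF cd(1), of d] cd by simp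
    moreover have "open (snd d ` (fst c \<inter> fst d))"
      using open_overlap[OF cd(2,1)] by (simp add: Int_commute)
    moreover have "smooth_on (snd d ` (fst c \<inter> fst d) \<times> UNIV) (transition d' c')"
      using smooth_transition_lift_chart[OF cd(2,1)] cd by (simp add: Int_commute)
    ultimately show ?thesis
      using open_overlap[OF cd(1,2)] smooth_transition_lift_chart[OF cd(1,2)] cd
      by (simp add: compatible_def open_Times)
  qed
qed

lemma atlas_TM: "atlas (TM A)"
  unfolding TM_def using atlas.atlas_maximal_atlas[OF atlas_lift_charts] .

lemma lift_chart_TM: "c \<in> A \<Longrightarrow> lift_chart A c \<in> TM A"
  unfolding TM_def using atlas.subset_maximal_atlas[OF atlas_lift_charts] by blast

lemma points_TM: "points (TM A) = tangent_bundle A"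
proof -
  have "points (lift_chart A ` A) = tangent_bundle A"
    by (auto simp: points_def lift_chart_simps elim: tangent_bundle_chart)
  then show ?thesis
    unfolding TM_def atlas.points_maximal_atlas[OF atlas_lift_charts] .
qed

text \<open>Smoothness is given in some pair of charts only, the second one an arbitrary chart of
  the tangent bundle. Transitions on both sides carry it over to \<open>c\<close> and its induced
  chart.\<close>

lemma smooth_component:
  assumes X: "vector_field_on A Q X" and c: "c \<in> A"
  shows "smooth_on (snd c ` (Q \<inter> fst c)) (\<lambda>x. snd (X (chart_inv c x)) c)"
proof (rule smooth_on_local)
  interpret TM: atlas "TM A" by (rule atlas_TM)
  fix x assume "x \<in> snd c ` (Q \<inter> fst c)"
  then obtain p where p: "p \<in> Q" "p \<in> fst c" "x = snd c p" by blast
  obtain c1 d1 where cd: "c1 \<in> A" "d1 \<in> TM A" "p \<in> fst c1" "fst c1 \<subseteq> Q" "X ` fst c1 \<subseteq> fst d1"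
    and sm: "smooth_on (snd c1 ` fst c1) (\<lambda>x. snd d1 (X (chart_inv c1 x)))"
    using X p(1) by (fastforce simp: vector_field_on_def smooth_map_on_def)
  let ?U = "snd c ` (fst c \<inter> fst c1)" and ?l = "lift_chart A c"
  let ?h = "\<lambda>x. snd d1 (X (chart_inv c1 (transition c c1 x)))"
  have oU: "open ?U" using open_overlap[OF c cd(1)] .
  have Xq: "X q \<in> fst d1 \<inter> fst ?l" if "q \<in> fst c" "q \<in> fst c1" for q
    using X that cd by (auto simp: vector_field_on_def tangent_space_def lift_chart_simps)
  have h: "?h (snd c q) = snd d1 (X q)" if "q \<in> fst c" "q \<in> fst c1" for q
    using that cd(1) c by (simp add: transition_chart charts chart_inv_chart)
  have sh: "smooth_on ?U ?h"
    by (rule smooth_on_compose[OF oU open_image[OF cd(1)] _ sm smooth_transition[OF c cd(1)]])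
      (use transition_image[OF c cd(1)] in auto)
  have im: "?h ` ?U \<subseteq> snd d1 ` (fst d1 \<inter> fst ?l)"
    using h Xq by auto
  have "smooth_on ?U (\<lambda>x. snd (transition d1 ?l (?h x)))"
    by (rule smooth_on_snd[OF oU smooth_on_compose[OF oU TM.open_overlap[OF cd(2) lift_chart_TM[OF c]] im
            TM.smooth_transition[OF cd(2) lift_chart_TM[OF c]] sh]])
  moreover have "snd (transition d1 ?l (?h x)) = snd (X (chart_inv c x)) c" if "x \<in> ?U" for x
  proof -
    obtain q where q: "q \<in> fst c" "q \<in> fst c1" "x = snd c q" using \<open>x \<in> ?U\<close> by blast
    then have "transition d1 ?l (?h x) = snd ?l (X q)"
      using Xq[OF q(1,2)] by (simp add: h transition_chart TM.charts cd(2))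
    then show ?thesis
      using q by (simp add: lift_chart_simps chart_inv_chart charts c)
  qed
  ultimately have "smooth_on ?U (\<lambda>x. snd (X (chart_inv c x)) c)"
    by (rule smooth_on_cong[OF oU, rotated])
  then show "\<exists>U. open U \<and> x \<in> U \<and> smooth_on U (\<lambda>x. snd (X (chart_inv c x)) c)"
    using oU p cd(3) by blast
qed

text \<open>Fields with constant components in a chart are the test fields for total
  geodesy.\<close>

lemma vector_field_coord_vec:
  assumes "c \<in> A"
  shows "vector_field_on A (fst c) (\<lambda>p. coord_vec A c (snd c p) v)"
  unfolding vector_field_on_def smooth_map_on_def
proof (intro conjI ballI)
  show "openin (mtop A) (fst c)" using openin_chart[OF assms] .
  fix p assume p: "p \<in> fst c"
  show "coord_vec A c (snd c p) v \<in> tangent_space A p"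
    using p assms by (simp add: tangent_space_def coord_vec_tangent_bundle coord_vec_simps)
  have "smooth_on (snd c ` fst c) (\<lambda>x. (x, v))"
    by (intro smooth_on_Pair open_image smooth_on_ident smooth_on_const assms)
  then have "smooth_on (snd c ` fst c)
      (\<lambda>x. snd (lift_chart A c) (coord_vec A c (snd c (chart_inv c x)) v))"
    by (rule smooth_on_cong[OF open_image[OF assms], rotated])
      (use assms in \<open>auto simp: lift_chart_simps chart_inv_chart charts coord_vec_simps(1) coord_vec_self\<close>)
  moreover have "(\<lambda>p. coord_vec A c (snd c p) v) ` fst c \<subseteq> fst (lift_chart A c)"
    using assms by (auto simp: lift_chart_simps coord_vec_tangent_bundle coord_vec_simps(1))
  ultimately show "\<exists>c'\<in>A. \<exists>d\<in>TM A. p \<in> fst c' \<and> fst c' \<subseteq> fst c \<and>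
      (\<lambda>p. coord_vec A c (snd c p) v) ` fst c' \<subseteq> fst d \<and>
      smooth_on (snd c' ` fst c') (\<lambda>x. snd d (coord_vec A c (snd c (chart_inv c' x)) v))"
    using assms p lift_chart_TM by blast
qed

end

section \<open>The Levi-Civita connection and the Sasaki metric\<close>

text \<open>Weaker than \<open>riemannian_manifold\<close>, so that the Sasaki metric qualifies with
  the single derivative that is established for it.\<close>

locale metric_atlas = atlas A
  for A :: "('a, 'e::euclidean_space) chart set" +
  fixes g :: "('a, 'e) metric"
  assumes metric: "c \<in> A \<Longrightarrow> local_metric (snd c ` fst c) (metric_comp A g c)"

context atlas
begin

lemma metric_comp_change:
  assumes "c \<in> A" "d \<in> A" "x \<in> snd c ` (fst c \<inter> fst d)"
  shows "metric_comp A g c x v w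
    = metric_comp A g d (transition c d x) (FD (transition c d) x v) (FD (transition c d) x w)"
proof -
  obtain p where "p \<in> fst c" "p \<in> fst d" "x = snd c p" using assms by blast
  then show ?thesis
    using assms by (simp add: metric_comp_def transition_chart charts coord_vec_change)
qed

text \<open>The maximal atlas of the tangent bundle has more charts than the induced ones. A metric
  checked in one chart around each point is pulled back to the others by transitions, whose
  derivatives are injective.\<close>

lemma metric_atlasI:
  assumes "\<And>d x. d \<in> A \<Longrightarrow> x \<in> fst d \<Longrightarrow>
      \<exists>c\<in>A. x \<in> fst c \<and> local_metric (snd c ` fst c) (metric_comp A g c)"
  shows "metric_atlas A g"
proof (intro metric_atlas.intro metric_atlas_axioms.intro atlas_axioms)
  fix d assume d: "d \<in> A"
  show "local_metric (snd d ` fst d) (metric_comp A g d)"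
  proof (rule local_metric_local)
    fix x assume "x \<in> snd d ` fst d"
    then obtain p where p: "p \<in> fst d" "x = snd d p" by blast
    then obtain c where c: "c \<in> A" "p \<in> fst c" "local_metric (snd c ` fst c) (metric_comp A g c)"
      using assms d by blast
    have "local_metric (snd d ` (fst d \<inter> fst c)) (metric_comp A g d)"
    proof (rule local_metric_pullback[OF c(3) open_overlap[OF d c(1)] smooth_transition[OF d c(1)]])
      show "transition d c ` (snd d ` (fst d \<inter> fst c)) \<subseteq> snd c ` fst c"
        using transition_image[OF d c(1)] by auto
      show "v = 0" if y: "y \<in> snd d ` (fst d \<inter> fst c)" and v: "FD (transition d c) y v = 0" for y v
      proof -
        obtain q where q: "q \<in> fst d" "q \<in> fst c" "y = snd d q" using y by blast
        then have "v = FD (transition c d) (snd c q) 0"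
          using FD_transition_inverse[OF d c(1) q(1,2), of v] v by simp
        also have "\<dots> = 0"
          using linear_0[OF linear_FD[OF differentiable_transition[OF c(1) d q(2,1)]]] .
        finally show ?thesis .
      qed
    qed (rule metric_comp_change[OF d c(1)])
    then show "\<exists>U. open U \<and> x \<in> U \<and> U \<subseteq> snd d ` fst d \<and> local_metric U (metric_comp A g d)"
      using open_overlap[OF d c(1)] p c by blast
  qed
qed

end

context metric_atlas
begin

lemma local_christoffel_change:
  assumes "c \<in> A" "d \<in> A" "p \<in> fst c" "p \<in> fst d"
  shows "FD (transition c d) (snd c p) (local_christoffel (metric_comp A g c) (snd c p) v w)
    = local_christoffel (metric_comp A g d) (snd d p) (FD (transition c d) (snd c p) v) (FD (transition c d) (snd c p) w)
      + FD2 (transition c d) (snd c p) v w"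
proof -
  have "surj (FD (transition c d) (snd c p))"
    using FD_transition_inverse[OF assms(2,1,4,3)] by (metis surjI)
  moreover have "transition c d ` (snd c ` (fst c \<inter> fst d)) \<subseteq> snd d ` fst d"
    using transition_image[OF assms(1,2)] by auto
  ultimately show ?thesis
    using local_christoffel_transform[OF metric[OF assms(1)] metric[OF assms(2)] open_overlap[OF assms(1,2)] _
        smooth_transition[OF assms(1,2)] _ metric_comp_change[OF assms(1,2)], of "snd c p" v w]
      assms by (auto simp: transition_chart charts)
qed

text \<open>Components must transform correctly between all charts. The second derivative of the
  transition that arises from differentiating the components of \<open>Y\<close> cancels the
  inhomogeneous term of the Christoffel symbols.\<close>

lemma cov_deriv_tangent_space:
  assumes X: "vector_field_on A Q X" and Y: "vector_field_on A Q Y" and p: "p \<in> Q"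
  shows "cov_deriv A g X Y p \<in> tangent_space A p"
proof -
  have tb: "X q \<in> tangent_bundle A" "Y q \<in> tangent_bundle A" "fst (X q) = q" "fst (Y q) = q"
    if "q \<in> Q" for q
    using X Y that by (auto simp: vector_field_on_def tangent_space_def)
  have oQ: "openin (mtop A) Q" using X by (simp add: vector_field_on_def)
  have change: "snd (cov_deriv A g X Y p) d = FD (transition c d) (snd c p) (snd (cov_deriv A g X Y p) c)"
    if c: "c \<in> A" "p \<in> fst c" and d: "d \<in> A" "p \<in> fst d" for c d
  proof -
    let ?T = "transition c d" and ?x = "snd c p"
    define Yc where "Yc x = snd (Y (chart_inv c x)) c" for x
    define Yd where "Yd x = snd (Y (chart_inv d x)) d" for x
    let ?U = "snd c ` (Q \<inter> fst c) \<inter> snd c ` (fst c \<inter> fst d)"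
    have oU: "open ?U"
      using oQ open_overlap[OF c(1) d(1)] c(1) by (simp add: openin_mtop_iff open_Int)
    have xU: "?x \<in> ?U" using p c d by blast
    have dT: "(?T has_derivative FD ?T ?x) (at ?x)"
      using has_derivative_FD differentiable_transition c d by blast
    have "Yd differentiable (at (snd d p))"
      unfolding Yd_def[abs_def] using smooth_on_imp_differentiable[OF smooth_component[OF Y d(1)]] p d(2) by blast
    then have dYd: "(Yd has_derivative FD Yd (snd d p)) (at (?T ?x))"
      using has_derivative_FD by (simp add: transition_chart charts c)
    have "Yc differentiable (at ?x)"
      unfolding Yc_def[abs_def] using smooth_on_imp_differentiable[OF smooth_component[OF Y c(1)]] p c(2) by blast
    then have dYc: "(Yc has_derivative FD Yc ?x) (at ?x)"
      by (rule has_derivative_FD)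
    have eq: "Yd (?T x) = FD ?T x (Yc x)" if "x \<in> ?U" for x
    proof -
      obtain q where q: "q \<in> fst c" "q \<in> fst d" "x = snd c q" using \<open>x \<in> ?U\<close> by blast
      have "q \<in> Q"
        using \<open>x \<in> ?U\<close> chart_image_mem[OF charts[OF c(1)] q(1), of "Q \<inter> fst c"] q(3) by auto
      then show ?thesis
        using tangent_bundle_component[OF tb(2) c(1) d(1), of q] q
        by (simp add: Yc_def Yd_def transition_chart chart_inv_chart charts c d tb)
    qed
    have dY: "((\<lambda>x. FD ?T x (Yc x)) has_derivative (\<lambda>v. FD Yd (snd d p) (FD ?T ?x v))) (at ?x)"
      using has_derivative_transform_within_open[OF has_derivative_compose[OF dT dYd] oU xU eq] .
    \<comment> \<open>The derivative of \<open>FD ?T x (Yc x)\<close> in two ways: by the chain rule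
      through \<open>Yd\<close>, and by the product rule.\<close>
    have "FD Yd (snd d p) (FD ?T ?x v) = FD2 ?T ?x v (Yc ?x) + FD ?T ?x (FD Yc ?x v)" for v
    proof -
      have x: "?x \<in> snd c ` (fst c \<inter> fst d)" and i: "(\<lambda>y. y) ` snd c ` (fst c \<inter> fst d) \<subseteq> snd c ` (fst c \<inter> fst d)"
        using c d by auto
      show ?thesis
        using fun_cong[OF has_derivative_unique[OF dY
            has_derivative_FD_compose[OF open_overlap[OF c(1) d(1)]
              smooth_transition[OF c(1) d(1)] open_overlap[OF c(1) d(1)] x i has_derivative_ident dYc]], of v]
        by simp
    qed
    moreover have "snd (X p) d = FD ?T ?x (snd (X p) c)" "snd (Y p) d = FD ?T ?x (snd (Y p) c)"
      using tangent_bundle_component[OF tb(1)[OF p] c(1) d(1)]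
        tangent_bundle_component[OF tb(2)[OF p] c(1) d(1)] c d tb p by auto
    moreover have "Yc ?x = snd (Y p) c"
      by (simp add: Yc_def chart_inv_chart charts c)
    ultimately show ?thesis
      using local_christoffel_change[OF c(1) d(1) c(2) d(2), of "snd (X p) c" "snd (Y p) c"]
        linear_add[OF has_derivative_linear[OF dT]]
      by (simp add: cov_deriv_def christoffel_eq_local c d Yc_def[abs_def] Yd_def[abs_def])
  qed
  have "p \<in> points A" using oQ p by (auto simp: openin_mtop_iff)
  moreover have "snd (cov_deriv A g X Y p) c = 0" if "\<not> (c \<in> A \<and> p \<in> fst c)" for c
    using that by (auto simp: cov_deriv_def)
  moreover have "fst (cov_deriv A g X Y p) = p"
    by (simp add: cov_deriv_def)
  ultimately show ?thesis
    using change unfolding tangent_space_def tangent_bundle_def mem_Collect_eq case_prod_beta by metis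
qed

end

section \<open>Riemannian manifolds as metrics in coordinates\<close>

lemma riemannian_manifold_atlas: "riemannian_manifold A g \<Longrightarrow> atlas A"
  by unfold_locales (auto simp: riemannian_manifold_def smooth_manifold_def)

lemma riemannian_manifold_c2_metric:
  assumes "riemannian_manifold A g" "c \<in> A"
  shows "c2_metric (snd c ` fst c) (metric_comp A g c)"
proof -
  interpret atlas A by (rule riemannian_manifold_atlas) fact
  let ?S = "snd c ` fst c" and ?G = "metric_comp A g c"
  have sm: "smooth_on ?S (\<lambda>x. ?G x v w)" for v w
    using assms by (auto simp: riemannian_manifold_def)
  show ?thesis
  proof
    show "open ?S" using open_image assms(2) .
    fix x v w assume x: "x \<in> ?S"
    show "bilinear (?G x)" "?G x v w = ?G x w v" "v \<noteq> 0 \<Longrightarrow> ?G x v v > 0"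
      using assms x unfolding riemannian_manifold_def by blast+
    show "(\<lambda>y. ?G y v w) differentiable (at x)"
      using smooth_on_imp_differentiable sm x by blast
    show "(\<lambda>y. FD (\<lambda>z. ?G z v w) y a) differentiable (at x)" for a
      using smooth_on_imp_differentiable smooth_on_FD sm x by blast
  qed
qed

lemma riemannian_manifold_metric_atlas:
  assumes "riemannian_manifold A g" shows "metric_atlas A g"
proof -
  interpret atlas A by (rule riemannian_manifold_atlas) fact
  show ?thesis
    using riemannian_manifold_c2_metric[OF assms] 
    by (intro metric_atlas.intro metric_atlas_axioms.intro atlas_axioms) (simp add: c2_metric_def)
qed

section \<open>The Sasaki metric in induced charts\<close>

context atlas
begin

text \<open>The second derivative in the fibre component is what the Christoffel term of the
  connection map has to compensate.\<close>

lemma FD_transition_lift_chart: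
  assumes "c \<in> A" "d \<in> A" "p \<in> fst c" "p \<in> fst d"
  shows "FD (transition (lift_chart A c) (lift_chart A d)) (snd c p, v) q
    = (FD (transition c d) (snd c p) (fst q),
       FD2 (transition c d) (snd c p) (fst q) v + FD (transition c d) (snd c p) (snd q))"
proof -
  let ?T = "transition c d" and ?x = "snd c p" and ?S = "snd c ` (fst c \<inter> fst d)"
  have x: "?x \<in> ?S" using assms by blast
  have o: "open (?S \<times> (UNIV::'e set))" and xv: "(?x, v) \<in> ?S \<times> UNIV"
    and i: "fst ` (?S \<times> (UNIV::'e set)) \<subseteq> ?S"
    using open_overlap[OF assms(1,2)] x by (auto simp: open_Times)
  note f = has_derivative_fst[OF has_derivative_ident] and sn = has_derivative_snd[OF has_derivative_ident]
  have dT: "(?T has_derivative FD ?T ?x) (at (fst (?x, v)))"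
    using has_derivative_FD[OF differentiable_transition[OF assms]] by simp
  from has_derivative_Pair[OF has_derivative_compose[OF f dT]
      has_derivative_FD_compose[OF open_overlap[OF assms(1,2)] smooth_transition[OF assms(1,2)] o xv i f sn]]
  have "((\<lambda>p. (?T (fst p), FD ?T (fst p) (snd p))) has_derivative
     (\<lambda>q. (FD ?T ?x (fst q), FD2 ?T ?x (fst q) v + FD ?T ?x (snd q)))) (at (?x, v))"
    by simp
  then have "(transition (lift_chart A c) (lift_chart A d) has_derivative
     (\<lambda>q. (FD ?T ?x (fst q), FD2 ?T ?x (fst q) v + FD ?T ?x (snd q)))) (at (?x, v))"
    by (rule has_derivative_transform_within_open[OF _ o xv])
      (use transition_lift_chart[OF assms(1,2)] in force)
  then show ?thesis by (simp add: FD_eqI)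
qed

lemma differential_projection:
  assumes c: "c \<in> A" "p \<in> fst c"
  shows "differential (TM A) A fst (coord_vec (TM A) (lift_chart A c) (snd c p, v) q)
    = coord_vec A c (snd c p) (fst q)"
proof -
  interpret TM: atlas "TM A" by (rule atlas_TM)
  let ?l = "lift_chart A c"
  define P where "P = coord_vec A c (snd c p) v"
  have P: "P \<in> fst ?l" "snd ?l P = (snd c p, v)" "fst P = p"
    using c by (simp_all add: P_def lift_chart_simps coord_vec_tangent_bundle coord_vec_simps(1) coord_vec_self)
  define V where "V = coord_vec (TM A) ?l (snd ?l P) q"
  have V: "fst V = P" "snd V d = (if d \<in> TM A \<and> P \<in> fst d then FD (transition ?l d) (snd ?l P) q else 0)" for d
    unfolding V_def using TM.coord_vec_simps[OF lift_chart_TM[OF c(1)] P(1)] by simp_all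
  \<comment> \<open>\<open>differential\<close> works in this arbitrarily chosen chart; the cocycle
    rule on the tangent bundle replaces it by an induced chart, in which the projection is
    \<open>fst\<close>.\<close>
  define e where "e = (SOME e. e \<in> TM A \<and> P \<in> fst e)"
  have e: "e \<in> TM A" "P \<in> fst e"
    using someI[of "\<lambda>e. e \<in> TM A \<and> P \<in> fst e" ?l] lift_chart_TM[OF c(1)] P(1) by (auto simp: e_def)
  have main: "FD (\<lambda>y. snd d (fst (chart_inv e y))) (snd e P) (snd V e) = FD (transition c d) (snd c p) (fst q)"
    if d: "d \<in> A" "p \<in> fst d" for d
  proof -
    let ?m = "lift_chart A d"
    have m: "?m \<in> TM A" "P \<in> fst ?m"
      using lift_chart_TM[OF d(1)] P(1,3) d(2) by (auto simp: lift_chart_simps)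
    have "(\<lambda>y. snd d (fst (chart_inv e y))) = (\<lambda>y. fst (transition e ?m y))"
      by (simp add: transition_def lift_chart_simps)
    moreover have d1: "((\<lambda>y. fst (transition e ?m y)) has_derivative (\<lambda>q. fst (FD (transition e ?m) (snd e P) q))) (at (snd e P))"
      by (rule has_derivative_fst[OF has_derivative_FD[OF TM.differentiable_transition[OF e(1) m(1) e(2) m(2)]]])
    ultimately have "FD (\<lambda>y. snd d (fst (chart_inv e y))) (snd e P) (snd V e)
        = fst (FD (transition e ?m) (snd e P) (FD (transition ?l e) (snd ?l P) q))"
      using FD_eqI[OF d1] e by (simp add: V(2))
    also have "\<dots> = fst (FD (transition ?l ?m) (snd ?l P) q)"
      using TM.FD_cocycle[OF lift_chart_TM[OF c(1)] e(1) m(1) P(1) e(2) m(2)] by simp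
    also have "\<dots> = FD (transition c d) (snd c p) (fst q)"
      by (simp add: P FD_transition_lift_chart[OF c(1) d(1) c(2) d(2)])
    finally show ?thesis .
  qed
  have "differential (TM A) A fst V = coord_vec A c (snd c p) (fst q)"
    unfolding differential_def Let_def V(1) P(3) e_def[symmetric]
    by (rule prod_eqI) (use main in \<open>auto simp: coord_vec_simps c\<close>)
  then show ?thesis
    by (simp add: V_def P)
qed

end

context metric_atlas
begin

lemma connection_map_coord_vec:
  assumes c: "c \<in> A" "p \<in> fst c"
  shows "connection_map A g (coord_vec (TM A) (lift_chart A c) (snd c p, v) q)
    = coord_vec A c (snd c p) (snd q + local_christoffel (metric_comp A g c) (snd c p) v (fst q))"
proof -
  interpret TM: atlas "TM A" by (rule atlas_TM)
  let ?l = "lift_chart A c"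
  define P where "P = coord_vec A c (snd c p) v"
  have P: "P \<in> fst ?l" "snd ?l P = (snd c p, v)" "fst P = p"
    using c by (simp_all add: P_def lift_chart_simps coord_vec_tangent_bundle coord_vec_simps(1) coord_vec_self)
  define V where "V = coord_vec (TM A) ?l (snd ?l P) q"
  have V: "fst V = P" "snd V d = (if d \<in> TM A \<and> P \<in> fst d then FD (transition ?l d) (snd ?l P) q else 0)" for d
    unfolding V_def using TM.coord_vec_simps[OF lift_chart_TM[OF c(1)] P(1)] by simp_all
  have main: "snd (snd V (lift_chart A d)) + christoffel A g d (snd d p) (snd P d) (fst (snd V (lift_chart A d)))
      = FD (transition c d) (snd c p) (snd q + local_christoffel (metric_comp A g c) (snd c p) v (fst q))"
    if d: "d \<in> A" "p \<in> fst d" for d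
  proof -
    have m: "lift_chart A d \<in> TM A" "P \<in> fst (lift_chart A d)"
      using lift_chart_TM[OF d(1)] P(1,3) d(2) by (auto simp: lift_chart_simps)
    \<comment> \<open>The induced transition contributes the second derivative with arguments
      \<open>fst q\<close>, \<open>v\<close>, the Christoffel symbols with \<open>v\<close>,
      \<open>fst q\<close>; symmetry lets the two cancel.\<close>
    have s: "FD2 (transition c d) (snd c p) (fst q) v = FD2 (transition c d) (snd c p) v (fst q)"
      using second_derivative_symmetric[OF open_overlap[OF c(1) d(1)] smooth_transition[OF c(1) d(1)]] c d
      by blast
    have "snd P d = FD (transition c d) (snd c p) v"
      using c d by (simp add: P_def coord_vec_simps)
    then show ?thesis
      using local_christoffel_change[OF c(1) d(1) c(2) d(2), of v "fst q"] s
        linear_add[OF linear_FD[OF differentiable_transition[OF c(1) d(1) c(2) d(2)]]]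
      by (simp add: V m P FD_transition_lift_chart[OF c(1) d(1) c(2) d(2)] christoffel_eq_local)
  qed
  have "connection_map A g V = coord_vec A c (snd c p) (snd q + local_christoffel (metric_comp A g c) (snd c p) v (fst q))"
    unfolding connection_map_def Let_def V(1) P(3)
    by (rule prod_eqI) (use main in \<open>auto simp: coord_vec_simps c\<close>)
  then show ?thesis
    by (simp add: V_def P)
qed

lemma sasaki_lift_chart:
  assumes "c \<in> A" "P \<in> (snd c ` fst c) \<times> UNIV"
  shows "metric_comp (TM A) (sasaki A g) (lift_chart A c) P q q'
    = sasaki_local (metric_comp A g c) P q q'"
proof -
  obtain p v where p: "p \<in> fst c" "P = (snd c p, v)" using assms by auto
  show ?thesis
    unfolding metric_comp_def[of "TM A"] sasaki_def p(2)
      differential_projection[OF assms(1) p(1)] connection_map_coord_vec[OF assms(1) p(1)]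
    by (simp add: sasaki_local_def metric_comp_def)
qed

lemma metric_atlas_sasaki:
  assumes c2: "\<And>c. c \<in> A \<Longrightarrow> c2_metric (snd c ` fst c) (metric_comp A g c)"
  shows "metric_atlas (TM A) (sasaki A g)"
proof (rule atlas.metric_atlasI[OF atlas_TM])
  fix d X assume "d \<in> TM A" "X \<in> fst d"
  then have X: "X \<in> tangent_bundle A"
    using points_TM by (auto simp: points_def)
  then obtain c where c: "c \<in> A" "fst X \<in> fst c" by (rule tangent_bundle_chart)
  let ?l = "lift_chart A c"
  have im: "snd ?l ` fst ?l = (snd c ` fst c) \<times> UNIV"
    using lift_chart_image[OF c(1), of "fst c"] by (simp add: lift_chart_simps)
  have "local_metric (snd ?l ` fst ?l) (sasaki_local (metric_comp A g c))"
    unfolding im using c2_metric.local_metric_sasaki[OF c2[OF c(1)]] .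
  then have "local_metric (snd ?l ` fst ?l) (metric_comp (TM A) (sasaki A g) ?l)"
    by (rule local_metric_cong) (use sasaki_lift_chart[OF c(1)] im in auto)
  then show "\<exists>c\<in>TM A. X \<in> fst c \<and> local_metric (snd c ` fst c) (metric_comp (TM A) (sasaki A g) c)"
    using lift_chart_TM[OF c(1)] X c by (intro bexI[of _ ?l]) (auto simp: lift_chart_simps)
qed

end

section \<open>Submanifolds\<close>

text \<open>Injectivity makes images commute with intersections, so the images of open sets already
  form a topology and generate nothing new.\<close>

lemma openin_image_submanifold:
  assumes "inj_on f (topspace N)"
  shows "openin (image_submanifold f N) V \<longleftrightarrow> (\<exists>U. openin N U \<and> V = f ` U)"
proof
  assume "openin (image_submanifold f N) V"
  then have "generate_topology_on {f ` U | U. openin N U} V"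
    by (simp add: image_submanifold_def openin_topology_generated_by_iff)
  then show "\<exists>U. openin N U \<and> V = f ` U"
  proof induction
    case Empty
    then show ?case by (intro exI[of _ "{}"]) simp
  next
    case (Int V V')
    then obtain U U' where U: "openin N U" "V = f ` U" "openin N U'" "V' = f ` U'" by blast
    then have "V \<inter> V' = f ` (U \<inter> U')"
      using inj_on_image_Int[OF assms openin_subset openin_subset] by metis
    then show ?case using U by blast
  next
    case (UN K)
    then obtain h where h: "\<And>k. k \<in> K \<Longrightarrow> openin N (h k) \<and> k = f ` h k" by metis
    have "\<Union>K = (\<Union>k\<in>K. f ` h k)"
      using h by (metis (no_types, lifting) SUP_cong image_ident)
    then have "\<Union>K = f ` (\<Union>k\<in>K. h k)"
      by (simp add: image_UN)
    moreover have "openin N (\<Union>k\<in>K. h k)"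
      using h by (intro openin_Union) blast
    ultimately show ?case by metis
  next
    case (Basis V)
    then show ?case by blast
  qed
next
  assume "\<exists>U. openin N U \<and> V = f ` U"
  then show "openin (image_submanifold f N) V"
    unfolding image_submanifold_def by (intro topology_generated_by_Basis) blast
qed

lemma homeomorphic_map_image_submanifold:
  assumes "inj_on f (topspace N)"
  shows "homeomorphic_map N (image_submanifold f N) f"
proof (rule bijective_open_imp_homeomorphic_map)
  note o = openin_image_submanifold[OF assms]
  show top: "f ` topspace N = topspace (image_submanifold f N)"
    unfolding image_submanifold_def topology_generated_by_topspace
    using openin_topspace[of N] openin_subset[of N] by blast
  show "continuous_map N (image_submanifold f N) f"
    unfolding continuous_map
  proof (intro conjI allI impI)
    fix V assume "openin (image_submanifold f N) V"
    then obtain U where U: "openin N U" "V = f ` U" using o by blast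
    then have "{x \<in> topspace N. f x \<in> V} = U"
      using inj_on_image_mem_iff[OF assms _ openin_subset] openin_subset by blast
    then show "openin N {x \<in> topspace N. f x \<in> V}" using U by simp
  qed (use top in auto)
  show "open_map N (image_submanifold f N) f"
    using o unfolding open_map_def by blast
qed (rule assms)

lemma topspace_image_submanifold:
  "inj_on f (topspace N) \<Longrightarrow> topspace (image_submanifold f N) = f ` topspace N"
  using homeomorphic_map_image_submanifold homeomorphic_imp_surjective_map by metis

lemma subtopology_image_submanifold:
  assumes "inj_on f (topspace N)" "L \<subseteq> topspace N"
  shows "subtopology (image_submanifold f N) (f ` L) = image_submanifold f (subtopology N L)"
proof -
  have inj: "inj_on f (topspace (subtopology N L))"
    using assms(1) by (rule inj_on_subset) auto
  have "f ` U \<inter> f ` L = f ` (U \<inter> L)" if "openin N U" for U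
    using inj_on_image_Int[OF assms(1) openin_subset[OF that] assms(2)] by simp
  then show ?thesis
    unfolding topology_eq openin_subtopology openin_image_submanifold[OF assms(1)]
      openin_image_submanifold[OF inj] by metis
qed

section \<open>Level submanifolds and their tangent vectors\<close>

lemma level_set_self: "p \<in> fst c \<Longrightarrow> p \<in> level_set c B p"
  by (simp add: level_set_def)

lemma adapted_chart_level_set:
  assumes "adapted_chart A m N p c B" "q \<in> level_set c B p"
  shows "adapted_chart A m N q c B"
proof -
  have "level_set c B q = level_set c B p" "q \<in> fst c"
    using assms(2) by (auto simp: level_set_def)
  then show ?thesis using assms(1) by (simp add: adapted_chart_def)
qed

lemma derivative_along_line:
  fixes f :: "'a::real_normed_vector \<Rightarrow> 'b::real_inner"
  assumes "(f has_derivative f') (at x)" "open U" "x \<in> U"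
    and const: "\<And>t. x + t *\<^sub>R v \<in> U \<Longrightarrow> f (x + t *\<^sub>R v) \<bullet> b = k"
  shows "f' v \<bullet> b = 0"
proof -
  let ?l = "\<lambda>t. x + t *\<^sub>R v"
  have l: "(?l has_derivative (\<lambda>t. t *\<^sub>R v)) (at 0)"
    by (auto intro!: derivative_eq_intros)
  have f: "(f has_derivative f') (at (?l 0))" using assms(1) by simp
  have 1: "((\<lambda>t. f (?l t) \<bullet> b) has_derivative (\<lambda>t. f' (t *\<^sub>R v) \<bullet> b)) (at 0)"
    by (rule has_derivative_inner_left[OF has_derivative_compose[OF l f]])
  have o: "open (?l -` U)"
    using assms(2) by (intro open_vimage) (auto intro!: continuous_intros)
  have "((\<lambda>t. f (?l t) \<bullet> b) has_derivative (\<lambda>t. 0)) (at 0)"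
    by (rule has_derivative_transform_within_open[OF has_derivative_const o])
      (use assms(3) const in auto)
  from fun_cong[OF has_derivative_unique[OF 1 this], of 1] show ?thesis by simp
qed

context atlas
begin

text \<open>Openness in \<open>N\<close> turned into openness in coordinates. On the level set
  \<open>N\<close> has the ambient topology, so some ambient neighbourhood of \<open>p\<close> meets
  the level set inside \<open>W\<close>; a line in a tangent direction stays in the level set as
  long as it stays in that neighbourhood.\<close>

lemma level_set_relatively_open:
  assumes ac: "adapted_chart A m N p c B" and W: "openin N W" "p \<in> W"
    and v: "\<And>b. b \<in> Basis - B \<Longrightarrow> v \<bullet> b = 0"
  obtains U where "open U" "snd c p \<in> U" "U \<subseteq> snd c ` fst c"
    "\<And>t. snd c p + t *\<^sub>R v \<in> U \<Longrightarrow>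
       \<exists>q \<in> W \<inter> level_set c B p. snd c q = snd c p + t *\<^sub>R v"
proof -
  let ?L = "level_set c B p"
  have c: "c \<in> A" "p \<in> fst c" using ac by (auto simp: adapted_chart_def)
  have "openin (subtopology N ?L) (W \<inter> ?L)"
    using W(1) by (auto simp: openin_subtopology)
  then have "openin (subtopology (mtop A) ?L) (W \<inter> ?L)"
    using ac by (simp add: adapted_chart_def)
  then obtain V where V: "openin (mtop A) V" "W \<inter> ?L = V \<inter> ?L"
    by (auto simp: openin_subtopology)
  have pV: "p \<in> V" using V W(2) level_set_self[OF c(2), of B] by blast
  show thesis
  proof
    show "open (snd c ` (V \<inter> fst c))"
      using V(1) c(1) by (simp add: openin_mtop_iff)
    show "snd c p \<in> snd c ` (V \<inter> fst c)" using pV c by blast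
    show "snd c ` (V \<inter> fst c) \<subseteq> snd c ` fst c" by blast
    fix t assume "snd c p + t *\<^sub>R v \<in> snd c ` (V \<inter> fst c)"
    then obtain q where q: "q \<in> V" "q \<in> fst c" "snd c q = snd c p + t *\<^sub>R v" by auto
    then have "q \<in> ?L"
      using v by (auto simp: level_set_def inner_add_left)
    then show "\<exists>q \<in> W \<inter> ?L. snd c q = snd c p + t *\<^sub>R v"
      using V(2) q by blast
  qed
qed

text \<open>\<open>tangent_to\<close> promises one adapted chart only. A segment in the direction of
  \<open>X\<close> in that chart stays in the level set of \<open>c\<close>, which is open in
  \<open>N\<close>, so the coordinates of \<open>c\<close> outside \<open>B\<close> are constant
  along it.\<close>

lemma tangent_to_component:
  assumes X: "X \<in> tangent_to A m N p" and ac: "adapted_chart A m N p c B" and b: "b \<in> Basis - B"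
  shows "snd X c \<bullet> b = 0"
proof -
  obtain d D where d: "adapted_chart A m N p d D" "\<And>b. b \<in> Basis - D \<Longrightarrow> snd X d \<bullet> b = 0"
    using X by (auto simp: tangent_to_def)
  have cA: "c \<in> A" "p \<in> fst c" and dA: "d \<in> A" "p \<in> fst d"
    using ac d by (auto simp: adapted_chart_def)
  have tb: "X \<in> tangent_bundle A" "fst X = p"
    using X by (auto simp: tangent_to_def tangent_space_def)
  have "openin N (level_set c B p)" "p \<in> level_set c B p"
    using ac level_set_self[OF cA(2)] by (auto simp: adapted_chart_def)
  from level_set_relatively_open[OF d(1) this d(2)] obtain U where U: "open U" "snd d p \<in> U" "U \<subseteq> snd d ` fst d"
    "\<And>t. snd d p + t *\<^sub>R snd X d \<in> U \<Longrightarrow>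
       \<exists>q \<in> level_set c B p \<inter> level_set d D p. snd d q = snd d p + t *\<^sub>R snd X d"
    by blast
  have "FD (transition d c) (snd d p) (snd X d) \<bullet> b = 0"
  proof (rule derivative_along_line[OF has_derivative_FD[OF differentiable_transition[OF dA(1) cA(1) dA(2) cA(2)]] U(1,2)])
    fix t assume "snd d p + t *\<^sub>R snd X d \<in> U"
    then obtain q where q: "q \<in> level_set c B p" "q \<in> level_set d D p" "snd d q = snd d p + t *\<^sub>R snd X d"
      using U(4) by blast
    then have "transition d c (snd d p + t *\<^sub>R snd X d) = snd c q"
      using transition_chart[OF charts[OF dA(1)]] by (metis (no_types, lifting) level_set_def mem_Collect_eq)
    then show "transition d c (snd d p + t *\<^sub>R snd X d) \<bullet> b = snd c p \<bullet> b"
      using q(1) b by (simp add: level_set_def)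
  qed
  then show ?thesis
    using tangent_bundle_component[OF tb(1) dA(1) cA(1)] tb(2) dA cA by simp
qed

lemma tangent_toI:
  assumes "X \<in> tangent_space A p" "adapted_chart A m N p c B" "\<And>b. b \<in> Basis - B \<Longrightarrow> snd X c \<bullet> b = 0"
  shows "X \<in> tangent_to A m N p"
  using assms unfolding tangent_to_def by blast

end

section \<open>Total geodesy in terms of Christoffel symbols\<close>

context metric_atlas
begin

text \<open>Only the Christoffel term needs a hypothesis: along a segment in \<open>W\<close> in the
  direction of \<open>X p\<close> the components of \<open>Y\<close> outside \<open>B\<close>
  vanish, hence so does their derivative.\<close>

lemma cov_deriv_tangent_to:
  assumes ac: "adapted_chart A m N p c B"
    and X: "vector_field_on A Q X" and Y: "vector_field_on A Q Y"
    and W: "openin N W" "W \<subseteq> Q" "p \<in> W"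
    and tan: "\<And>q. q \<in> W \<Longrightarrow> X q \<in> tangent_to A m N q \<and> Y q \<in> tangent_to A m N q"
    and geodesic: "\<And>v w b. (\<And>b. b \<in> Basis - B \<Longrightarrow> v \<bullet> b = 0) \<Longrightarrow> (\<And>b. b \<in> Basis - B \<Longrightarrow> w \<bullet> b = 0) \<Longrightarrow>
        b \<in> Basis - B \<Longrightarrow> local_christoffel (metric_comp A g c) (snd c p) v w \<bullet> b = 0"
  shows "cov_deriv A g X Y p \<in> tangent_to A m N p"
proof (rule tangent_toI[OF cov_deriv_tangent_space[OF X Y] ac])
  show "p \<in> Q" using W by blast
  have c: "c \<in> A" "p \<in> fst c" using ac by (auto simp: adapted_chart_def)
  fix b assume b: "b \<in> Basis - B"
  let ?Y = "\<lambda>x. snd (Y (chart_inv c x)) c"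
  have tX: "snd (X p) c \<bullet> b = 0" and tY: "snd (Y p) c \<bullet> b = 0" if "b \<in> Basis - B" for b
    using tangent_to_component[OF _ ac that] tan[OF W(3)] by blast+
  obtain U where U: "open U" "snd c p \<in> U" "U \<subseteq> snd c ` fst c"
    "\<And>t. snd c p + t *\<^sub>R snd (X p) c \<in> U \<Longrightarrow>
       \<exists>q \<in> W \<inter> level_set c B p. snd c q = snd c p + t *\<^sub>R snd (X p) c"
    using level_set_relatively_open[OF ac W(1,3) tX] by blast
  have "snd c p \<in> snd c ` (Q \<inter> fst c)" using W c by blast
  from has_derivative_FD[OF smooth_on_imp_differentiable[OF smooth_component[OF Y c(1)] this]]
  have "FD ?Y (snd c p) (snd (X p) c) \<bullet> b = 0"
  proof (rule derivative_along_line[OF _ U(1,2)])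
    fix t assume "snd c p + t *\<^sub>R snd (X p) c \<in> U"
    then obtain q where q: "q \<in> W" "q \<in> level_set c B p" "snd c q = snd c p + t *\<^sub>R snd (X p) c"
      using U(4) by blast
    then have "chart_inv c (snd c p + t *\<^sub>R snd (X p) c) = q"
      using chart_inv_chart[OF charts[OF c(1)], of q] by (simp add: level_set_def)
    then show "?Y (snd c p + t *\<^sub>R snd (X p) c) \<bullet> b = 0"
      using tangent_to_component[OF _ adapted_chart_level_set[OF ac q(2)] b] tan[OF q(1)] by simp
  qed
  then show "snd (cov_deriv A g X Y p) c \<bullet> b = 0"
    using geodesic[OF tX tY b] c by (simp add: cov_deriv_def christoffel_eq_local inner_add_left)
qed

text \<open>Tested on fields with constant components, whose covariant derivative is just the
  Christoffel term. They are known to be tangent along \<open>level_set c B p\<close> but not where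
  \<open>N\<close> may return to the chart, so that level set is taken for \<open>W\<close>.\<close>

lemma totally_geodesic_local_christoffel:
  assumes tg: "totally_geodesic A g m N" and ac: "adapted_chart A m N p c B"
    and v: "\<And>b. b \<in> Basis - B \<Longrightarrow> v \<bullet> b = 0" and w: "\<And>b. b \<in> Basis - B \<Longrightarrow> w \<bullet> b = 0"
    and b: "b \<in> Basis - B"
  shows "local_christoffel (metric_comp A g c) (snd c p) v w \<bullet> b = 0"
proof -
  have c: "c \<in> A" "p \<in> fst c" using ac by (auto simp: adapted_chart_def)
  let ?C = "\<lambda>v p. coord_vec A c (snd c p) v"
  have tan: "?C u q \<in> tangent_to A m N q"
    if q: "q \<in> level_set c B p" and u: "\<And>b. b \<in> Basis - B \<Longrightarrow> u \<bullet> b = 0" for u q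
  proof (rule tangent_toI[OF _ adapted_chart_level_set[OF ac q]])
    have "q \<in> fst c" using q by (simp add: level_set_def)
    then show "?C u q \<in> tangent_space A q" "\<And>b. b \<in> Basis - B \<Longrightarrow> snd (?C u q) c \<bullet> b = 0"
      using c(1) u by (simp_all add: tangent_space_def coord_vec_tangent_bundle coord_vec_simps(1) coord_vec_self)
  qed
  have "cov_deriv A g (?C v) (?C w) p \<in> tangent_to A m N p"
    using tg[unfolded totally_geodesic_def, rule_format, of "fst c" "?C v" "?C w" "level_set c B p" p]
      vector_field_coord_vec[OF c(1)] tan[OF _ v] tan[OF _ w] ac level_set_self[OF c(2)]
    by (auto simp: adapted_chart_def level_set_def)
  then have 1: "snd (cov_deriv A g (?C v) (?C w) p) c \<bullet> b = 0"
    by (rule tangent_to_component[OF _ ac b])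
  have "((\<lambda>x. snd (?C w (chart_inv c x)) c) has_derivative (\<lambda>a. 0)) (at (snd c p))"
    by (rule has_derivative_transform_within_open[OF has_derivative_const[of w] open_image[OF c(1)]])
      (use c in \<open>auto simp: chart_inv_chart charts coord_vec_self\<close>)
  then have "FD (\<lambda>x. snd (?C w (chart_inv c x)) c) (snd c p) u = 0" for u
    by (simp add: FD_eqI)
  then show ?thesis
    using 1 c by (simp add: cov_deriv_def christoffel_eq_local coord_vec_self)
qed

end

section \<open>The image of a vector field\<close>

text \<open>A chart of the tangent bundle in which the image of \<open>\<xi>\<close> is the level submanifold on which the
  second component vanishes.\<close>

definition field_chart ::
  "('a, 'e::euclidean_space) chart set \<Rightarrow> ('a \<Rightarrow> ('a, 'e) tvec) \<Rightarrow> ('a, 'e) chart \<Rightarrow>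
   (('a, 'e) tvec, 'e \<times> 'e) chart" where
  "field_chart A \<xi> c = (fst (lift_chart A c),
     \<lambda>X. (snd c (fst X), snd X c - snd (\<xi> (chart_inv c (snd c (fst X)))) c))"

text \<open>In a \<open>field_chart\<close>, at fibre coordinate zero, \<open>(b, 0)\<close> is the
  image of a coordinate direction under the differential of \<open>\<xi>\<close>. The name does not
  refer to the horizontal space of the connection.\<close>

definition horizontal :: "'e::euclidean_space set \<Rightarrow> ('e \<times> 'e) set" where
  "horizontal B = (\<lambda>b. (b, 0)) ` B"

lemma card_horizontal: "card (horizontal B) = card B"
  unfolding horizontal_def by (rule card_image) (auto simp: inj_on_def)

lemma horizontal_subset_Basis: "B \<subseteq> Basis \<Longrightarrow> horizontal B \<subseteq> Basis"
  by (auto simp: horizontal_def Basis_prod_def)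

lemma Basis_diff_horizontal:
  "B \<subseteq> Basis \<Longrightarrow> Basis - horizontal B = (\<lambda>b. (b, 0)) ` (Basis - B) \<union> Pair 0 ` Basis"
  by (auto simp: horizontal_def Basis_prod_def)

locale atlas_field = atlas A
  for A :: "('a, 'e::euclidean_space) chart set" +
  fixes \<xi> :: "'a \<Rightarrow> ('a, 'e) tvec"
  assumes field: "vector_field A \<xi>"
begin

sublocale TM: atlas "TM A"
  by (rule atlas_TM)

definition field_comp :: "('a, 'e) chart \<Rightarrow> 'e \<Rightarrow> 'e" where
  "field_comp c x = snd (\<xi> (chart_inv c x)) c"

lemma field_tangent: "p \<in> points A \<Longrightarrow> \<xi> p \<in> tangent_bundle A" "p \<in> points A \<Longrightarrow> fst (\<xi> p) = p"
  using field by (auto simp: vector_field_on_def tangent_space_def)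

lemma inj_field: "inj_on \<xi> (points A)"
  by (rule inj_on_inverseI[of _ fst]) (rule field_tangent)

lemma chart_points: "c \<in> A \<Longrightarrow> p \<in> fst c \<Longrightarrow> p \<in> points A"
  by (auto simp: points_def)

lemma smooth_field_comp: "c \<in> A \<Longrightarrow> smooth_on (snd c ` fst c) (field_comp c)"
proof -
  assume c: "c \<in> A"
  then have "points A \<inter> fst c = fst c" by (auto simp: points_def)
  then show ?thesis
    using smooth_component[OF field c] by (simp add: field_comp_def[abs_def])
qed

lemma field_comp_chart: "c \<in> A \<Longrightarrow> p \<in> fst c \<Longrightarrow> field_comp c (snd c p) = snd (\<xi> p) c"
  by (simp add: field_comp_def chart_inv_chart charts)

lemma field_coord_vec: "c \<in> A \<Longrightarrow> p \<in> fst c \<Longrightarrow> \<xi> p = coord_vec A c (snd c p) (field_comp c (snd c p))"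
  using coord_vec_component[of "\<xi> p" c] field_tangent[OF chart_points[of c p]]
  by (simp add: field_comp_chart)

lemma field_chart_simps:
  "fst (field_chart A \<xi> c) = {X \<in> tangent_bundle A. fst X \<in> fst c}"
  "snd (field_chart A \<xi> c) X = (snd c (fst X), snd X c - field_comp c (snd c (fst X)))"
  by (simp_all add: field_chart_def lift_chart_simps field_comp_def)

lemma field_chart_field:
  assumes "c \<in> A" "p \<in> fst c"
  shows "\<xi> p \<in> fst (field_chart A \<xi> c)" "snd (field_chart A \<xi> c) (\<xi> p) = (snd c p, 0)"
  using assms field_tangent[OF chart_points[OF assms]] by (simp_all add: field_chart_simps field_comp_chart)

text \<open>\<open>r = -1\<close> leads from induced coordinates to those of
  \<open>field_chart\<close>, \<open>r = 1\<close> back.\<close>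

lemma smooth_translation:
  assumes "c \<in> A"
  shows "smooth_on (snd c ` fst c \<times> UNIV) (\<lambda>p. (fst p, snd p + r *\<^sub>R field_comp c (fst p)))"
proof -
  have o: "open (snd c ` fst c \<times> (UNIV::'e set))" and i: "fst ` (snd c ` fst c \<times> (UNIV::'e set)) \<subseteq> snd c ` fst c"
    using open_image[OF assms] by (auto simp: open_Times)
  note f = smooth_on_fst[OF o smooth_on_ident[OF o]] and s = smooth_on_snd[OF o smooth_on_ident[OF o]]
  show ?thesis
    by (rule smooth_on_Pair[OF o f smooth_on_add[OF o s smooth_on_scaleR[OF o smooth_on_const
          smooth_on_compose[OF o open_image[OF assms] i smooth_field_comp[OF assms] f]]]])
qed

lemma lift_chart_full_image: "c \<in> A \<Longrightarrow> snd (lift_chart A c) ` fst (lift_chart A c) = snd c ` fst c \<times> UNIV"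
  using lift_chart_image[of c "fst c"] by (simp add: lift_chart_simps)

lemma field_chart_image:
  assumes "c \<in> A"
  shows "snd (field_chart A \<xi> c) ` fst (field_chart A \<xi> c) = snd c ` fst c \<times> UNIV"
proof -
  let ?\<phi> = "\<lambda>p. (fst p, snd p + (-1) *\<^sub>R field_comp c (fst p))"
  have "snd (field_chart A \<xi> c) ` fst (field_chart A \<xi> c) = ?\<phi> ` (snd c ` fst c \<times> UNIV)"
    unfolding lift_chart_full_image[OF assms, symmetric]
    by (simp add: image_image field_chart_simps lift_chart_simps)
  also have "\<dots> = snd c ` fst c \<times> UNIV"
  proof (intro equalityI subsetI)
    fix z assume "z \<in> snd c ` fst c \<times> (UNIV::'e set)"
    then have "z = ?\<phi> (fst z, snd z + field_comp c (fst z))" "(fst z, snd z + field_comp c (fst z)) \<in> snd c ` fst c \<times> UNIV"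
      by auto
    then show "z \<in> ?\<phi> ` (snd c ` fst c \<times> UNIV)" by (rule image_eqI)
  qed auto
  finally show ?thesis .
qed

lemma field_chart_TM:
  assumes "c \<in> A" shows "field_chart A \<xi> c \<in> TM A"
proof -
  let ?l = "lift_chart A c" and ?S = "snd c ` fst c \<times> (UNIV::'e set)"
  let ?\<phi> = "\<lambda>r p. (fst p, snd p + r *\<^sub>R field_comp c (fst p))"
  interpret L: atlas "lift_chart A ` A" by (rule atlas_lift_charts)
  have "(fst ?l, \<lambda>p. ?\<phi> (-1) (snd ?l p)) \<in> maximal_atlas (lift_chart A ` A)"
  proof (rule L.reparametrised_chart[where \<psi> = "?\<phi> 1" and S = ?S])
    show "?\<phi> (-1) ` snd ?l ` fst ?l = ?S"
      using field_chart_image[OF assms]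
      by (simp add: image_image field_chart_simps lift_chart_simps)
    show "smooth_on (snd ?l ` fst ?l) (?\<phi> (-1))"
      using smooth_translation[OF assms, of "-1"] by (simp add: lift_chart_full_image assms)
    show "smooth_on ?S (?\<phi> 1)" by (rule smooth_translation[OF assms])
    show "open ?S" using open_image[OF assms] by (simp add: open_Times)
  qed (use assms in auto)
  moreover have "(fst ?l, \<lambda>p. ?\<phi> (-1) (snd ?l p)) = field_chart A \<xi> c"
    by (simp add: field_chart_def lift_chart_simps field_comp_def)
  ultimately show ?thesis
    by (simp add: TM_def)
qed

lemma transition_field_lift:
  assumes "c \<in> A" "P \<in> snd c ` fst c \<times> UNIV"
  shows "transition (field_chart A \<xi> c) (lift_chart A c) P = (fst P, snd P + field_comp c (fst P))"
proof -
  let ?f = "field_chart A \<xi> c"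
  obtain X where X: "X \<in> fst ?f" "P = snd ?f X"
    using assms(2) unfolding field_chart_image[OF assms(1), symmetric] by blast
  then have "transition ?f (lift_chart A c) P = snd (lift_chart A c) X"
    using transition_chart[OF TM.charts[OF field_chart_TM[OF assms(1)]]] by simp
  then show ?thesis
    using X by (simp add: field_chart_simps lift_chart_simps)
qed

lemma FD_transition_field_lift:
  assumes "c \<in> A" "P \<in> snd c ` fst c \<times> UNIV"
  shows "FD (transition (field_chart A \<xi> c) (lift_chart A c)) P q
    = (fst q, snd q + FD (field_comp c) (fst P) (fst q))"
proof -
  have o: "open (snd c ` fst c \<times> (UNIV::'e set))"
    using open_image[OF assms(1)] by (simp add: open_Times)
  have x: "fst P \<in> snd c ` fst c" using assms(2) by auto
  note f = has_derivative_fst[OF has_derivative_ident] and s = has_derivative_snd[OF has_derivative_ident]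
  have "((\<lambda>p. (fst p, snd p + field_comp c (fst p))) has_derivative
      (\<lambda>q. (fst q, snd q + FD (field_comp c) (fst P) (fst q)))) (at P)"
    by (rule has_derivative_Pair[OF f has_derivative_add[OF s has_derivative_compose[OF f
          has_derivative_FD[OF smooth_on_imp_differentiable[OF smooth_field_comp[OF assms(1)] x]]]]])
  then have "(transition (field_chart A \<xi> c) (lift_chart A c) has_derivative
      (\<lambda>q. (fst q, snd q + FD (field_comp c) (fst P) (fst q)))) (at P)"
    by (rule has_derivative_transform_within_open[OF _ o assms(2)])
      (simp add: transition_field_lift[OF assms(1)])
  then show ?thesis by (simp add: FD_eqI)
qed

text \<open>All fibre coordinates are fixed at zero, their value at \<open>\<xi> p\<close>. This
  forces a vector in the level set to be the value of \<open>\<xi>\<close> at its base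
  point.\<close>

lemma level_set_field_chart:
  assumes "c \<in> A" "p \<in> fst c" "B \<subseteq> Basis"
  shows "level_set (field_chart A \<xi> c) (horizontal B) (\<xi> p) = \<xi> ` level_set c B p"
proof -
  let ?f = "field_chart A \<xi> c"
  have zero: "v = 0" if "\<And>b. b \<in> Basis \<Longrightarrow> v \<bullet> b = 0" for v :: 'e
    using that euclidean_all_zero_iff by blast
  have ls: "X \<in> level_set ?f (horizontal B) (\<xi> p) \<longleftrightarrow>
      X \<in> tangent_bundle A \<and> fst X \<in> fst c \<and> (\<forall>b\<in>Basis - B. snd c (fst X) \<bullet> b = snd c p \<bullet> b) \<and>
      snd X c = field_comp c (snd c (fst X))" for X
    using zero[of "snd X c - field_comp c (snd c (fst X))"] field_chart_field[OF assms(1,2)]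
    by (auto simp: level_set_def Basis_diff_horizontal[OF assms(3)] ball_Un field_chart_simps)
  show ?thesis
  proof (intro equalityI subsetI)
    fix X assume "X \<in> level_set ?f (horizontal B) (\<xi> p)"
    then have X: "X \<in> tangent_bundle A" "fst X \<in> fst c" "\<forall>b\<in>Basis - B. snd c (fst X) \<bullet> b = snd c p \<bullet> b"
      "snd X c = field_comp c (snd c (fst X))" using ls by blast+
    then have "X = \<xi> (fst X)"
      using field_coord_vec[OF assms(1) X(2)] coord_vec_component[OF X(1) assms(1) X(2)] by simp
    moreover have "fst X \<in> level_set c B p" using X by (simp add: level_set_def)
    ultimately show "X \<in> \<xi> ` level_set c B p" by (rule image_eqI)
  next
    fix X assume "X \<in> \<xi> ` level_set c B p"
    then obtain q where q: "X = \<xi> q" "q \<in> fst c" "\<forall>b\<in>Basis - B. snd c q \<bullet> b = snd c p \<bullet> b"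
      by (auto simp: level_set_def)
    then show "X \<in> level_set ?f (horizontal B) (\<xi> p)"
      using ls field_tangent[OF chart_points[OF assms(1) q(2)]] field_comp_chart[OF assms(1) q(2)] by simp
  qed
qed

text \<open>\<open>\<xi>\<close> is a topological embedding: its inverse is the restricted
  projection, and in a \<open>field_chart\<close> it reads \<open>x \<mapsto> (x, 0)\<close>. This
  reconciles the transported topology, used for the leaves, with the subspace topology of the whole
  image.\<close>

lemma image_submanifold_whole:
  "image_submanifold \<xi> (mtop A) = subtopology (mtop (TM A)) (\<xi> ` points A)"
proof -
  have inj: "inj_on \<xi> (topspace (mtop A))"
    using inj_field by (simp add: topspace_mtop)
  have "openin (subtopology (mtop (TM A)) (\<xi> ` points A)) V" if U: "openin (mtop A) U" "V = \<xi> ` U" for U V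
  proof -
    let ?O = "{X \<in> tangent_bundle A. fst X \<in> U}"
    have Up: "U \<subseteq> points A" using U(1) openin_mtop_iff by blast
    have "openin (mtop (TM A)) ?O"
    proof (rule TM.openin_mtopI)
      fix X assume X: "X \<in> ?O"
      then obtain c where c: "c \<in> A" "fst X \<in> fst c" using tangent_bundle_chart by blast
      have "?O \<inter> fst (lift_chart A c) = {X \<in> tangent_bundle A. fst X \<in> U \<inter> fst c}"
        by (auto simp: lift_chart_simps)
      then have "snd (lift_chart A c) ` (?O \<inter> fst (lift_chart A c)) = snd c ` (U \<inter> fst c) \<times> UNIV"
        using lift_chart_image[OF c(1), of "U \<inter> fst c"] by simp
      moreover have "open (snd c ` (U \<inter> fst c))"
        using U(1) c(1) openin_mtop_iff by blast
      ultimately have "open (snd (lift_chart A c) ` (?O \<inter> fst (lift_chart A c)))"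
        by (simp add: open_Times)
      then show "\<exists>c\<in>TM A. X \<in> fst c \<and> open (snd c ` (?O \<inter> fst c))"
        using X c lift_chart_TM[OF c(1)] by (intro bexI[of _ "lift_chart A c"]) (simp_all add: lift_chart_simps)
    qed
    moreover have "V = ?O \<inter> \<xi> ` points A"
      using U(2) Up field_tangent by auto
    ultimately show ?thesis
      by (auto simp: openin_subtopology)
  qed
  moreover have "\<exists>U. openin (mtop A) U \<and> V = \<xi> ` U"
    if V: "openin (subtopology (mtop (TM A)) (\<xi> ` points A)) V" for V
  proof -
    obtain W where W: "openin (mtop (TM A)) W" "V = W \<inter> \<xi> ` points A"
      using V by (auto simp: openin_subtopology)
    let ?U = "{p \<in> points A. \<xi> p \<in> W}"
    have "openin (mtop A) ?U"
    proof (rule openin_mtopI)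
      fix p assume "p \<in> ?U"
      then obtain c where c: "c \<in> A" "p \<in> fst c" by (auto simp: points_def)
      let ?f = "field_chart A \<xi> c"
      have f: "?f \<in> TM A" using field_chart_TM[OF c(1)] .
      have "\<xi> q \<in> W \<longleftrightarrow> (snd c q, 0) \<in> snd ?f ` (W \<inter> fst ?f)" if q: "q \<in> fst c" for q
        using chart_image_mem[OF TM.charts[OF f] field_chart_field(1)[OF c(1) q], of "W \<inter> fst ?f"]
          field_chart_field[OF c(1) q] by simp
      then have eq: "snd c ` (?U \<inter> fst c) = (\<lambda>x. (x, 0)) -` (snd ?f ` (W \<inter> fst ?f)) \<inter> snd c ` fst c"
        using chart_points[OF c(1)] by auto
      have "open ((\<lambda>x. (x, 0::'e)) -` (snd ?f ` (W \<inter> fst ?f)))"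
        using W(1) f TM.openin_mtop_iff by (intro open_vimage) (auto intro!: continuous_intros)
      then show "\<exists>c\<in>A. p \<in> fst c \<and> open (snd c ` (?U \<inter> fst c))"
        using c open_image[OF c(1)] by (intro bexI[of _ c]) (simp_all add: eq open_Int)
    qed
    moreover have "V = \<xi> ` ?U" using W(2) by auto
    ultimately show ?thesis by blast
  qed
  ultimately show ?thesis
    unfolding topology_eq openin_image_submanifold[OF inj] by blast
qed

text \<open>\<open>N\<close> is arbitrary, so this covers the whole manifold and every leaf,
  embedded or not.\<close>

lemma adapted_field_chart:
  assumes ac: "adapted_chart A m N p c B" and N: "topspace N \<subseteq> points A"
  shows "adapted_chart (TM A) m (image_submanifold \<xi> N) (\<xi> p) (field_chart A \<xi> c) (horizontal B)"
proof -
  let ?L = "level_set c B p"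
  have c: "c \<in> A" "p \<in> fst c" and B: "B \<subseteq> Basis" "card B = m" and o: "openin N ?L"
    and s: "subtopology N ?L = subtopology (mtop A) ?L"
    using ac by (auto simp: adapted_chart_def)
  have inj: "inj_on \<xi> (topspace N)" using inj_field N inj_on_subset by blast
  have inj': "inj_on \<xi> (topspace (mtop A))"
    using inj_field by (simp add: topspace_mtop)
  have LN: "?L \<subseteq> topspace N" using openin_subset[OF o] .
  have LA: "?L \<subseteq> points A" using LN N by blast
  note L = level_set_field_chart[OF c B(1)]
  have "openin (image_submanifold \<xi> N) (\<xi> ` ?L)"
    using openin_image_submanifold[OF inj] o by blast
  moreover have "subtopology (image_submanifold \<xi> N) (\<xi> ` ?L) = subtopology (mtop (TM A)) (\<xi> ` ?L)"
  proof -
    \<comment> \<open>\<open>N\<close> and \<open>mtop A\<close> agree on the level set before the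
      transport, hence after it; for \<open>mtop A\<close> the transported topology is the subspace
      topology.\<close>
    have "subtopology (image_submanifold \<xi> N) (\<xi> ` ?L) = image_submanifold \<xi> (subtopology (mtop A) ?L)"
      using subtopology_image_submanifold[OF inj LN] s by simp
    also have "\<dots> = subtopology (image_submanifold \<xi> (mtop A)) (\<xi> ` ?L)"
      using subtopology_image_submanifold[OF inj'] LA by (simp add: topspace_mtop)
    also have "\<dots> = subtopology (mtop (TM A)) (\<xi> ` points A \<inter> \<xi> ` ?L)"
      unfolding image_submanifold_whole subtopology_subtopology ..
    also have "\<xi> ` points A \<inter> \<xi> ` ?L = \<xi> ` ?L"
      using LA by blast
    finally show ?thesis .
  qed
  ultimately show ?thesis
    using c B field_chart_TM[OF c(1)] field_chart_field(1)[OF c]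
    by (simp add: adapted_chart_def L card_horizontal horizontal_subset_Basis)
qed

lemma submanifold_image:
  assumes "submanifold A m N"
  shows "submanifold (TM A) m (image_submanifold \<xi> N)"
proof -
  have N: "topspace N \<subseteq> points A" using assms by (simp add: submanifold_def)
  have inj: "inj_on \<xi> (topspace N)" using inj_field N inj_on_subset by blast
  have "N homeomorphic_space image_submanifold \<xi> N"
    using homeomorphic_map_image_submanifold[OF inj] homeomorphic_map_imp_homeomorphic_space by blast
  then have "second_countable (image_submanifold \<xi> N)"
    using assms homeomorphic_space_second_countability by (auto simp: submanifold_def)
  moreover have "\<exists>c B. adapted_chart (TM A) m (image_submanifold \<xi> N) P c B" if P: "P \<in> \<xi> ` topspace N" for P
  proof -
    obtain p where p: "p \<in> topspace N" "P = \<xi> p" using P by blast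
    then obtain c B where "adapted_chart A m N p c B"
      using assms unfolding submanifold_def by blast
    from adapted_field_chart[OF this N] show ?thesis using p(2) by blast
  qed
  moreover have "\<xi> ` topspace N \<subseteq> tangent_bundle A"
    using N field_tangent(1) by blast
  ultimately show ?thesis
    unfolding submanifold_def topspace_image_submanifold[OF inj] points_TM by blast
qed

lemma foliation_of_image:
  assumes "foliation_of A m N \<nu> I F"
  shows "foliation_of (TM A) m (image_submanifold \<xi> N) \<nu> I (\<lambda>\<alpha>. image_submanifold \<xi> (F \<alpha>))"
proof -
  note D = assms[unfolded foliation_of_def]
  note sN = D[THEN conjunct1] and leaf = D[THEN conjunct2, THEN conjunct1]
    and cover = D[THEN conjunct2, THEN conjunct2, THEN conjunct1]
    and disjoint = D[THEN conjunct2, THEN conjunct2, THEN conjunct2, THEN conjunct1]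
    and ch = D[THEN conjunct2, THEN conjunct2, THEN conjunct2, THEN conjunct2]
  have sF: "submanifold A \<nu> (F \<alpha>)" and con: "connected_space (F \<alpha>)" "topspace (F \<alpha>) \<noteq> {}"
    if "\<alpha> \<in> I" for \<alpha>
    using leaf that by blast+
  have disj: "topspace (F \<alpha>) \<inter> topspace (F \<beta>) = {}" if "\<alpha> \<in> I" "\<beta> \<in> I" "\<alpha> \<noteq> \<beta>" for \<alpha> \<beta>
    using disjoint that by blast
  have N: "topspace N \<subseteq> points A" using sN by (simp add: submanifold_def)
  have F: "topspace (F \<alpha>) \<subseteq> points A" if "\<alpha> \<in> I" for \<alpha> using sF[OF that] by (simp add: submanifold_def)
  have injF: "inj_on \<xi> (topspace (F \<alpha>))" if "\<alpha> \<in> I" for \<alpha>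
    using inj_field F[OF that] inj_on_subset by blast
  have injN: "inj_on \<xi> (topspace N)" using inj_field N inj_on_subset by blast
  note tops = topspace_image_submanifold[OF injF] topspace_image_submanifold[OF injN]
  show ?thesis
    unfolding foliation_of_def
  proof (intro conjI ballI impI)
    show "submanifold (TM A) m (image_submanifold \<xi> N)" using submanifold_image[OF sN] .
    fix \<alpha> assume a: "\<alpha> \<in> I"
    show "submanifold (TM A) \<nu> (image_submanifold \<xi> (F \<alpha>))" using submanifold_image[OF sF[OF a]] .
    show "connected_space (image_submanifold \<xi> (F \<alpha>))"
      using homeomorphic_connected_space[OF homeomorphic_map_imp_homeomorphic_space
          [OF homeomorphic_map_image_submanifold[OF injF[OF a]]]] con(1)[OF a] by blast
    show "topspace (image_submanifold \<xi> (F \<alpha>)) \<noteq> {}" using con(2)[OF a] by (simp add: tops a)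
    show "topspace (image_submanifold \<xi> (F \<alpha>)) \<inter> topspace (image_submanifold \<xi> (F \<beta>)) = {}"
      if "\<beta> \<in> I" "\<alpha> \<noteq> \<beta>" for \<beta>
      using inj_on_image_Int[OF inj_field F[OF a] F[OF that(1)]] disj[OF a that] by (simp add: tops a that)
  next
    show "topspace (image_submanifold \<xi> N) = (\<Union>\<alpha>\<in>I. topspace (image_submanifold \<xi> (F \<alpha>)))"
      by (simp add: tops cover image_UN)
  next
    fix P assume "P \<in> topspace (image_submanifold \<xi> N)"
    then obtain p where p: "p \<in> topspace N" "P = \<xi> p" by (auto simp: tops)
    obtain c B B' where c: "adapted_chart A m N p c B" "B' \<subseteq> B"
      "\<And>\<alpha> q. \<alpha> \<in> I \<Longrightarrow> q \<in> topspace (F \<alpha>) \<Longrightarrow> q \<in> level_set c B p \<Longrightarrow> adapted_chart A \<nu> (F \<alpha>) q c B'"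
      using bspec[OF ch p(1)] by blast
    have cA: "c \<in> A" "p \<in> fst c" "B \<subseteq> Basis" using c(1) by (auto simp: adapted_chart_def)
    have "adapted_chart (TM A) \<nu> (image_submanifold \<xi> (F \<alpha>)) Q (field_chart A \<xi> c) (horizontal B')"
      if a: "\<alpha> \<in> I" and Q: "Q \<in> topspace (image_submanifold \<xi> (F \<alpha>)) \<inter> level_set (field_chart A \<xi> c) (horizontal B) P"
      for \<alpha> Q
    proof -
      \<comment> \<open>The leaf and the level set each provide a preimage of \<open>Q\<close>.
        Injectivity of \<open>\<xi>\<close> identifies them, and the condition on
        \<open>F \<alpha>\<close> applies there.\<close>
      obtain q q' where q: "q \<in> topspace (F \<alpha>)" "Q = \<xi> q" "q' \<in> level_set c B p" "Q = \<xi> q'"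
        using Q by (auto simp: tops a p(2) level_set_field_chart[OF cA])
      have "q' \<in> points A" using q(3) chart_points[OF cA(1)] by (auto simp: level_set_def)
      then have "q = q'" using inj_onD[OF inj_field, of q q'] q F[OF a] by blast
      then show ?thesis using adapted_field_chart[OF c(3)[OF a q(1)] F[OF a]] q by simp
    qed
    moreover have "horizontal B' \<subseteq> horizontal B" using c(2) by (auto simp: horizontal_def)
    ultimately show "\<exists>c B B'. adapted_chart (TM A) m (image_submanifold \<xi> N) P c B \<and> B' \<subseteq> B \<and>
        (\<forall>\<alpha>\<in>I. \<forall>q \<in> topspace (image_submanifold \<xi> (F \<alpha>)) \<inter> level_set c B P.
           adapted_chart (TM A) \<nu> (image_submanifold \<xi> (F \<alpha>)) q c B')"
      using adapted_field_chart[OF c(1) N] p(2) by blast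
  qed
qed

end

section \<open>The image of a normal field of constant length\<close>

lemma hyperplane_basis:
  assumes "B \<subseteq> (Basis :: 'e::euclidean_space set)" "card B = DIM('e) - 1"
  obtains e where "e \<in> Basis" "Basis - B = {e}"
proof -
  have "card (Basis - B) = 1"
    using assms card_Diff_subset[OF finite_subset[OF assms(1)] assms(1)] DIM_positive[where 'a = 'e] by simp
  then obtain e where "Basis - B = {e}" by (rule card_1_singletonE)
  then show thesis using that by blast
qed

lemma horizontal_iff:
  fixes v :: "'e::euclidean_space \<times> 'e"
  assumes "B \<subseteq> Basis"
  shows "(\<forall>b\<in>Basis - horizontal B. v \<bullet> b = 0) \<longleftrightarrow> (\<forall>b\<in>Basis - B. fst v \<bullet> b = 0) \<and> snd v = 0"
proof -
  have "(\<forall>b\<in>Basis. snd v \<bullet> b = 0) \<longleftrightarrow> snd v = 0"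
    by (rule euclidean_all_zero_iff)
  then show ?thesis
    by (simp add: Basis_diff_horizontal[OF assms] ball_Un inner_prod_def)
qed

lemma totally_geodesic_image:
  fixes A :: "('a, 'e::euclidean_space) chart set" and \<xi> :: "'a \<Rightarrow> ('a, 'e) tvec"
  assumes riem: "riemannian_manifold A g"
    and fol: "hyperfoliation A I F"
    and geo: "totally_geodesic_foliation A g (DIM('e) - 1) I F"
    and normal: "field_of_normals A g (DIM('e) - 1) I F \<xi>"
    and len: "\<And>p. p \<in> points A \<Longrightarrow> tvec_length g (\<xi> p) = l"
    and \<alpha>: "\<alpha> \<in> I"
  shows "totally_geodesic (TM A) (sasaki A g) (DIM('e) - 1) (image_submanifold \<xi> (F \<alpha>))"
proof -
  let ?n = "DIM('e) - 1"
  interpret metric_atlas A g by (rule riemannian_manifold_metric_atlas[OF riem])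
  interpret atlas_field A \<xi>
    using normal by unfold_locales (simp add: field_of_normals_def)
  interpret s: metric_atlas "TM A" "sasaki A g"
    by (rule metric_atlas_sasaki[OF riemannian_manifold_c2_metric[OF riem]])
  note D = fol[unfolded foliation_of_def]
  note leaf = D[THEN conjunct2, THEN conjunct1]
    and cover = D[THEN conjunct2, THEN conjunct2, THEN conjunct1]
    and ch = D[THEN conjunct2, THEN conjunct2, THEN conjunct2, THEN conjunct2]
  have F\<alpha>: "topspace (F \<alpha>) \<subseteq> points A"
    using leaf \<alpha> by (auto simp: submanifold_def)
  show ?thesis
    unfolding totally_geodesic_def
  proof (intro allI impI ballI, elim conjE)
    fix Q W X Y P
    assume X: "vector_field_on (TM A) Q X" and Y: "vector_field_on (TM A) Q Y"
      and W: "openin (image_submanifold \<xi> (F \<alpha>)) W" "W \<subseteq> Q" and P: "P \<in> W"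
      and tan: "\<forall>p\<in>W. X p \<in> tangent_to (TM A) ?n (image_submanifold \<xi> (F \<alpha>)) p \<and>
                      Y p \<in> tangent_to (TM A) ?n (image_submanifold \<xi> (F \<alpha>)) p"
    have "P \<in> topspace (image_submanifold \<xi> (F \<alpha>))"
      using openin_subset[OF W(1)] P by blast
    then obtain p where p: "p \<in> topspace (F \<alpha>)" "P = \<xi> p"
      using topspace_image_submanifold[OF inj_on_subset[OF inj_field F\<alpha>]] by auto
    have "p \<in> topspace (mtop A)" using p F\<alpha> by (auto simp: topspace_mtop)
    from bspec[OF ch this] obtain c B0 B where c: "adapted_chart A DIM('e) (mtop A) p c B0" "B \<subseteq> B0"
      and lf: "\<And>\<beta> q. \<beta> \<in> I \<Longrightarrow> q \<in> topspace (F \<beta>) \<inter> level_set c B0 p \<Longrightarrow> adapted_chart A ?n (F \<beta>) q c B"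
      by blast
    have cA: "c \<in> A" "p \<in> fst c" and "B0 \<subseteq> Basis" "card B0 = DIM('e)"
      using c(1) by (auto simp: adapted_chart_def)
    \<comment> \<open>All coordinates of the chart vary, so its level set is the whole domain, and
      one \<open>B\<close> serves all leaves met there.\<close>
    then have "B0 = Basis" by (intro card_subset_eq) auto
    then have "level_set c B0 p = fst c" by (auto simp: level_set_def)
    then have leaf_chart: "\<exists>\<beta>\<in>I. q \<in> topspace (F \<beta>) \<and> adapted_chart A ?n (F \<beta>) q c B" if "q \<in> fst c" for q
      using lf that chart_points[OF cA(1) that] cover by (auto simp: topspace_mtop)
    have ac: "adapted_chart A ?n (F \<alpha>) p c B"
      using lf[OF \<alpha>] p cA(2) \<open>level_set c B0 p = fst c\<close> by simp
    then have B: "B \<subseteq> Basis" "card B = ?n" by (auto simp: adapted_chart_def)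
    obtain e where e: "e \<in> Basis" "Basis - B = {e}"
      using hyperplane_basis[OF B] .
    let ?S = "snd c ` fst c" and ?G = "metric_comp A g c"
    interpret G: c2_metric ?S ?G
      by (rule riemannian_manifold_c2_metric[OF riem cA(1)])
    \<comment> \<open>Required at all points of the chart, hence taken from the leaf through each of
      them and not from \<open>F \<alpha>\<close> alone.\<close>
    have geodesic: "local_christoffel ?G x v w \<bullet> e = 0" if "x \<in> ?S" "v \<bullet> e = 0" "w \<bullet> e = 0" for x v w
    proof -
      obtain q where q: "q \<in> fst c" "x = snd c q" using \<open>x \<in> ?S\<close> by blast
      obtain \<beta> where \<beta>: "\<beta> \<in> I" "adapted_chart A ?n (F \<beta>) q c B"
        using leaf_chart[OF q(1)] by blast
      have "totally_geodesic A g ?n (F \<beta>)"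
        using geo \<beta>(1) by (simp add: totally_geodesic_foliation_def)
      from totally_geodesic_local_christoffel[OF this \<beta>(2), of v w e] show ?thesis
        using that e q(2) by simp
    qed
    have perp: "?G x (field_comp c x) b = 0" if "x \<in> ?S" "b \<bullet> e = 0" for x b
    proof -
      obtain q where q: "q \<in> fst c" "x = snd c q" using \<open>x \<in> ?S\<close> by blast
      obtain \<beta> where \<beta>: "\<beta> \<in> I" "q \<in> topspace (F \<beta>)" "adapted_chart A ?n (F \<beta>) q c B"
        using leaf_chart[OF q(1)] by blast
      have "coord_vec A c x b \<in> tangent_to A ?n (F \<beta>) q"
        using q cA(1) e that(2)
        by (intro tangent_toI[OF _ \<beta>(3)])
          (simp_all add: tangent_space_def coord_vec_tangent_bundle coord_vec_simps(1) coord_vec_self)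
      then have "g (\<xi> q) (coord_vec A c x b) = 0"
        using normal \<beta> by (auto simp: field_of_normals_def)
      then show ?thesis
        using field_coord_vec[OF cA(1) q(1)] q(2) by (simp add: metric_comp_def)
    qed
    \<comment> \<open>The square root is injective, so constant length makes
      \<open>g (\<xi> q) (\<xi> q)\<close> constant; its value at \<open>p\<close> serves as the
      constant.\<close>
    have length: "?G x (field_comp c x) (field_comp c x) = g (\<xi> p) (\<xi> p)" if "x \<in> ?S" for x
    proof -
      obtain q where q: "q \<in> fst c" "x = snd c q" using \<open>x \<in> ?S\<close> by blast
      have "sqrt (g (\<xi> q) (\<xi> q)) = sqrt (g (\<xi> p) (\<xi> p))"
        using len[OF chart_points[OF cA(1) q(1)]] len[OF chart_points[OF cA]]
        by (simp add: tvec_length_def)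
      then have "g (\<xi> q) (\<xi> q) = g (\<xi> p) (\<xi> p)"
        by (rule iffD1[OF real_sqrt_eq_iff])
      then show ?thesis
        using field_coord_vec[OF cA(1) q(1)] q(2) by (simp add: metric_comp_def)
    qed
    have parallel: "FD (field_comp c) x v + local_christoffel ?G x v (field_comp c x) = 0" if "x \<in> ?S" "v \<bullet> e = 0" for x v
      using G.normal_field_parallel[of "field_comp c", OF smooth_on_imp_differentiable[OF smooth_field_comp[OF cA(1)]]
          length perp geodesic nonzero_Basis[OF e(1)] that] .
    let ?f = "field_chart A \<xi> c"
    let ?Gm = "metric_comp (TM A) (sasaki A g) ?f"
    \<comment> \<open>In induced coordinates the metric is \<open>sasaki_local\<close>; the
      transition to them adds \<open>field_comp c\<close> to the fibre coordinate and its derivative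
      to the fibre part of a vector.\<close>
    have Gm: "?Gm q v w = sasaki_local ?G (fst q, snd q + field_comp c (fst q))
        (fst v, snd v + FD (field_comp c) (fst q) (fst v)) (fst w, snd w + FD (field_comp c) (fst q) (fst w))"
      if q: "q \<in> ?S \<times> UNIV" for q v w
    proof -
      have "fst ?f \<inter> fst (lift_chart A c) = fst ?f"
        by (auto simp: field_chart_def)
      then have "q \<in> snd ?f ` (fst ?f \<inter> fst (lift_chart A c))"
        using q field_chart_image[OF cA(1)] by simp
      from TM.metric_comp_change[OF field_chart_TM[OF cA(1)] lift_chart_TM[OF cA(1)] this]
      show ?thesis
        using q sasaki_lift_chart[OF cA(1)]
        by (auto simp: transition_field_lift[OF cA(1)] FD_transition_field_lift[OF cA(1)])
    qed
    have mGm: "local_metric (?S \<times> UNIV) ?Gm"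
      using s.metric[OF field_chart_TM[OF cA(1)]] by (simp add: field_chart_image[OF cA(1)])
    have chris0: "local_christoffel ?Gm (x, 0) (v, 0) (w, 0) = (local_christoffel ?G x v w, 0)"
      if "x \<in> ?S" "v \<bullet> e = 0" "w \<bullet> e = 0" for x v w
      by (rule G.local_christoffel_sasaki_translated[where V = "{v. v \<bullet> e = 0}", OF mGm smooth_field_comp[OF cA(1)] _ _ Gm])
        (use parallel geodesic that in auto)
    show "cov_deriv (TM A) (sasaki A g) X Y P \<in> tangent_to (TM A) ?n (image_submanifold \<xi> (F \<alpha>)) P"
      unfolding p(2)
    proof (rule s.cov_deriv_tangent_to[OF adapted_field_chart[OF ac F\<alpha>] X Y W])
      show "\<xi> p \<in> W" using P p(2) by simp
      show "X q \<in> tangent_to (TM A) ?n (image_submanifold \<xi> (F \<alpha>)) q \<and>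
            Y q \<in> tangent_to (TM A) ?n (image_submanifold \<xi> (F \<alpha>)) q" if "q \<in> W" for q
        using tan that by blast
      fix v w b :: "'e \<times> 'e"
      assume v: "\<And>b. b \<in> Basis - horizontal B \<Longrightarrow> v \<bullet> b = 0"
        and w: "\<And>b. b \<in> Basis - horizontal B \<Longrightarrow> w \<bullet> b = 0" and b: "b \<in> Basis - horizontal B"
      \<comment> \<open>Vectors tangent to the image of the leaf are \<open>(a, 0)\<close> with
        \<open>a\<close> tangent to the leaf, so \<open>chris0\<close> applies to them.\<close>
      have hv: "fst v \<bullet> e = 0 \<and> snd v = 0" and hw: "fst w \<bullet> e = 0 \<and> snd w = 0"
        using horizontal_iff[OF B(1), of v] horizontal_iff[OF B(1), of w] v w e by auto
      have x: "snd c p \<in> ?S" using cA by blast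
      have "v = (fst v, 0)" "w = (fst w, 0)" using hv hw by (simp_all add: prod_eq_iff)
      then have "local_christoffel ?Gm (snd ?f (\<xi> p)) v w = (local_christoffel ?G (snd c p) (fst v) (fst w), 0)"
        using chris0[OF x, of "fst v" "fst w"] hv hw field_chart_field(2)[OF cA] by simp
      moreover have "local_christoffel ?G (snd c p) (fst v) (fst w) \<bullet> e = 0"
        using geodesic[OF x] hv hw by blast
      ultimately show "local_christoffel ?Gm (snd ?f (\<xi> p)) v w \<bullet> b = 0"
        using horizontal_iff[OF B(1), of "local_christoffel ?Gm (snd ?f (\<xi> p)) v w"] e b by simp
    qed
  qed
qed

theorem corollary3p5:
  fixes A :: "('a, 'e::euclidean_space) chart set"
    and g :: "('a, 'e) metric"
    and I :: "'i set"
    and F :: "'i \<Rightarrow> 'a topology"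
    and \<xi> :: "'a \<Rightarrow> ('a, 'e) tvec"
    and l :: real
  assumes "riemannian_manifold A g"
    and "hyperfoliation A I F"
    and "transversally_orientable A I F"
    and "totally_geodesic_foliation A g (DIM('e) - 1) I F"
    and "field_of_normals A g (DIM('e) - 1) I F \<xi>"
    and "\<And>p. p \<in> points A \<Longrightarrow> tvec_length g (\<xi> p) = l"
  shows "ruled_submanifold (TM A) (sasaki A g) DIM('e) (DIM('e) - 1)
           (subtopology (mtop (TM A)) (\<xi> ` points A))
           I (\<lambda>\<alpha>. image_submanifold \<xi> (F \<alpha>))"
proof -
  interpret atlas A by (rule riemannian_manifold_atlas[OF assms(1)])
  interpret atlas_field A \<xi>
    using assms(5) by unfold_locales (simp add: field_of_normals_def)
  \<comment> \<open>The foliation is transported together with the topology of the manifold, which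
    then becomes the subspace topology of the image.\<close>
  have "foliation_of (TM A) DIM('e) (subtopology (mtop (TM A)) (\<xi> ` points A)) (DIM('e) - 1) I
      (\<lambda>\<alpha>. image_submanifold \<xi> (F \<alpha>))"
    using foliation_of_image[OF assms(2)] by (simp only: image_submanifold_whole)
  moreover from this have "submanifold (TM A) DIM('e) (subtopology (mtop (TM A)) (\<xi> ` points A))"
    by (simp add: foliation_of_def)
  ultimately show ?thesis
    using totally_geodesic_image[OF assms(1,2,4,5,6)]
    by (simp add: ruled_submanifold_def totally_geodesic_foliation_def)
qed

end
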